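(* For each integer $N\ge0$ there exists an analytic function $\Gamma_N(s)$ on the strip $0<\mathrm{Re}(s)<1$, depending only on $N$, such that for every $F\in W_N$ and every $s$ with $0<\mathrm{Re}(s)<1$ the following identity of tempered distributions on $\mathbb{H}$ holds: $$\mathcal{F}\big(F(\tfrac1x)\,|x|^{s-1}\big)=\Gamma_N(s)\,F(x)\,|x|^{-s}.$$
   Context: $\mathbb{H}$ is the algebra of quaternions $x=x_0+x_1i+x_2j+x_3k$, with conjugate $\overline{x}$, reduced norm $n(x)=x\overline{x}$ and module $|x|=n(x)^2$. $G_0=\{g\in\mathbb{H}^\times:n(g)=1\}\cong SU(2)$. $dx=4\,dx_0dx_1dx_2dx_3$, $\lambda(x)=e^{-2\pi i(x+\overline{x})}$, $\mathcal{F}(\varphi)(y)=\int\varphi(x)\lambda(-xy)\,dx$ for Schwartz functions, extended to tempered distributions by $\langle\mathcal{F}(T),\varphi\rangle=\langle T,\mathcal{F}(\varphi)\rangle$; locally integrable functions define distributions by integration against $dx$. $W_N\subset L^2(G_0)$ is the span of the matrix coefficients of the $(N+1)$-dimensional irreducible representation of $G_0\cong SU(2)$; an element $F\in W_N$ is regarded as a function on $\mathbb{H}^\times$ by extending it to be constant along radial lines: $F(x)=F(x/|x|^{1/4})$. *)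

theory Defs
  imports "HOL-Analysis.Analysis" "Jordan_Normal_Form.VS_Connect"
begin

no_notation Matrix.vec_index (infixl "$" 100)

section \<open>Quaternions\<close>

text \<open>The quaternion \<open>x\<^sub>0 + x\<^sub>1 i + x\<^sub>2 j + x\<^sub>3 k\<close> is the vector with components
  \<open>x $ 1, x $ 2, x $ 3, x $ 4\<close>, in this order. The product \<open>*\<close> that the library provides on
  \<^typ>\<open>real^4\<close> is componentwise and is never used.\<close>

type_synonym quat = "real^4"

definition qone :: quat where
  "qone = vector [1, 0, 0, 0]"

definition qmul :: "quat \<Rightarrow> quat \<Rightarrow> quat" (infixl "\<star>" 70) where
  "x \<star> y = vector
    [x$1 * y$1 - x$2 * y$2 - x$3 * y$3 - x$4 * y$4,
     x$1 * y$2 + x$2 * y$1 + x$3 * y$4 - x$4 * y$3,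
     x$1 * y$3 - x$2 * y$4 + x$3 * y$1 + x$4 * y$2,
     x$1 * y$4 + x$2 * y$3 - x$3 * y$2 + x$4 * y$1]"

definition qconj :: "quat \<Rightarrow> quat" where
  "qconj x = vector [x$1, - x$2, - x$3, - x$4]"

text \<open>Both \<open>x \<star> qconj x\<close> and \<open>x + qconj x\<close> are real quaternions (see the lemmas below); the reduced
  norm and trace are the real numbers they represent.\<close>

definition qnrm :: "quat \<Rightarrow> real" where
  "qnrm x = (x \<star> qconj x) $ 1"

definition qtr :: "quat \<Rightarrow> real" where
  "qtr x = (x + qconj x) $ 1"

definition qmod :: "quat \<Rightarrow> real" where
  "qmod x = (qnrm x)\<^sup>2"

definition qinv :: "quat \<Rightarrow> quat" where
  "qinv x = qconj x /\<^sub>R qnrm x"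

lemma vector_4 [simp]:
  "(vector [a, b, c, d] :: 'a::zero^4) $ 1 = a"
  "(vector [a, b, c, d] :: 'a::zero^4) $ 2 = b"
  "(vector [a, b, c, d] :: 'a::zero^4) $ 3 = c"
  "(vector [a, b, c, d] :: 'a::zero^4) $ 4 = d"
  unfolding vector_def by auto

lemma qmul_qconj: "x \<star> qconj x = qnrm x *\<^sub>R qone"
  by (simp add: Finite_Cartesian_Product.vec_eq_iff forall_4 qmul_def qconj_def qnrm_def qone_def)

lemma add_qconj: "x + qconj x = qtr x *\<^sub>R qone"
  by (simp add: Finite_Cartesian_Product.vec_eq_iff forall_4 qconj_def qtr_def qone_def)

lemma qnrm_eq_norm: "qnrm x = (norm x)\<^sup>2"
  by (simp add: norm_vec_def L2_set_def sum_4 qnrm_def qmul_def qconj_def power2_eq_square)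

lemma qmul_qinv:
  assumes "x \<noteq> 0"
  shows "x \<star> qinv x = qone" and "qinv x \<star> x = qone"
proof -
  have n: "qnrm x = x$1 * x$1 + x$2 * x$2 + x$3 * x$3 + x$4 * x$4"
    by (simp add: qnrm_def qmul_def qconj_def)
  have "qnrm x \<noteq> 0"
    using assms by (simp add: qnrm_eq_norm)
  then show "x \<star> qinv x = qone" "qinv x \<star> x = qone"
    by (simp_all add: Finite_Cartesian_Product.vec_eq_iff forall_4 qmul_def qinv_def qconj_def qone_def field_simps)
       (simp_all add: n algebra_simps)
qed

definition G0 :: "quat set" where
  "G0 = {g. qnrm g = 1}"

text \<open>Extension of a function on \<^const>\<open>G0\<close> that is constant along radial lines. The value at \<open>0\<close> is
  irrelevant, since \<open>{0}\<close> is a null set.\<close>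

definition radial :: "(quat \<Rightarrow> complex) \<Rightarrow> quat \<Rightarrow> complex" where
  "radial F x = F (x /\<^sub>R (qmod x powr (1/4)))"

section \<open>Schwartz functions and tempered distributions\<close>

definition dq :: "quat measure" where
  "dq = density lborel (\<lambda>_. 4)"

definition partial_deriv :: "4 \<Rightarrow> (quat \<Rightarrow> complex) \<Rightarrow> quat \<Rightarrow> complex" where
  "partial_deriv i f x = frechet_derivative f (at x) (axis i 1)"

text \<open>\<open>partial_derivs [i\<^sub>1, \<dots>, i\<^sub>m] f\<close> is the iterated partial derivative of \<open>f\<close> of order \<open>m\<close>. Since every
  iterated partial derivative of a Schwartz function is required to be differentiable, such a
  function is smooth.\<close>

definition partial_derivs :: "4 list \<Rightarrow> (quat \<Rightarrow> complex) \<Rightarrow> quat \<Rightarrow> complex" where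
  "partial_derivs is f = foldr partial_deriv is f"

definition schwartz :: "(quat \<Rightarrow> complex) set" where
  "schwartz = {\<phi>. \<forall>is. (\<forall>x. partial_derivs is \<phi> differentiable (at x)) \<and>
     (\<forall>k::nat. bounded (range (\<lambda>x. (1 + norm x) ^ k * cmod (partial_derivs is \<phi> x))))}"

definition schwartz_seminorm :: "nat \<Rightarrow> nat \<Rightarrow> (quat \<Rightarrow> complex) \<Rightarrow> real" where
  "schwartz_seminorm k m \<phi> =
     (\<Sum>is | length is \<le> m. SUP x. (1 + norm x) ^ k * cmod (partial_derivs is \<phi> x))"

text \<open>A distribution is represented by a functional on all functions, of which only the values on
  \<^const>\<open>schwartz\<close> matter. Continuity for the Schwartz topology is domination by one of the
  (increasing) seminorms above.\<close>

definition tempered_distribution :: "((quat \<Rightarrow> complex) \<Rightarrow> complex) \<Rightarrow> bool" where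
  "tempered_distribution T \<longleftrightarrow>
     (\<forall>\<phi>\<in>schwartz. \<forall>\<psi>\<in>schwartz. T (\<lambda>x. \<phi> x + \<psi> x) = T \<phi> + T \<psi>) \<and>
     (\<forall>c. \<forall>\<phi>\<in>schwartz. T (\<lambda>x. c * \<phi> x) = c * T \<phi>) \<and>
     (\<exists>C k m. \<forall>\<phi>\<in>schwartz. cmod (T \<phi>) \<le> C * schwartz_seminorm k m \<phi>)"

definition distribution_of :: "(quat \<Rightarrow> complex) \<Rightarrow> (quat \<Rightarrow> complex) \<Rightarrow> complex" where
  "distribution_of f \<phi> = (LINT x|dq. f x * \<phi> x)"

definition defines_tempered :: "(quat \<Rightarrow> complex) \<Rightarrow> bool" where
  "defines_tempered f \<longleftrightarrow>
     (\<forall>K. compact K \<longrightarrow> set_integrable dq K f) \<and>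
     (\<forall>\<phi>\<in>schwartz. integrable dq (\<lambda>x. f x * \<phi> x)) \<and>
     tempered_distribution (distribution_of f)"

definition add_char :: "quat \<Rightarrow> complex" where
  "add_char x = exp (- 2 * of_real pi * \<i> * of_real (qtr x))"

definition fourier :: "(quat \<Rightarrow> complex) \<Rightarrow> quat \<Rightarrow> complex" where
  "fourier \<phi> y = (LINT x|dq. \<phi> x * add_char (- (x \<star> y)))"

definition fourier_distribution ::
    "((quat \<Rightarrow> complex) \<Rightarrow> complex) \<Rightarrow> (quat \<Rightarrow> complex) \<Rightarrow> complex" where
  "fourier_distribution T \<phi> = T (fourier \<phi>)"

section \<open>Matrix coefficients of irreducible representations\<close>

definition is_representation :: "nat \<Rightarrow> (quat \<Rightarrow> complex mat) \<Rightarrow> bool" where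
  "is_representation d \<pi> \<longleftrightarrow>
     (\<forall>g\<in>G0. \<pi> g \<in> carrier_mat d d) \<and>
     \<pi> qone = 1\<^sub>m d \<and>
     (\<forall>g\<in>G0. \<forall>h\<in>G0. \<pi> (g \<star> h) = \<pi> g * \<pi> h) \<and>
     (\<forall>i<d. \<forall>j<d. continuous_on G0 (\<lambda>g. \<pi> g $$ (i, j)))"

definition irreducible_representation :: "nat \<Rightarrow> (quat \<Rightarrow> complex mat) \<Rightarrow> bool" where
  "irreducible_representation d \<pi> \<longleftrightarrow> is_representation d \<pi> \<and> d > 0 \<and>
     (\<forall>U. VectorSpace.subspace class_ring U (module_vec TYPE(complex) d) \<and>
          (\<forall>g\<in>G0. \<forall>u\<in>U. \<pi> g *\<^sub>v u \<in> U) \<longrightarrow>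
          U = {0\<^sub>v d} \<or> U = carrier_vec d)"

definition matrix_coeff ::
    "(quat \<Rightarrow> complex mat) \<Rightarrow> complex Matrix.vec \<Rightarrow> complex Matrix.vec \<Rightarrow> quat \<Rightarrow> complex" where
  "matrix_coeff \<pi> w v g = scalar_prod w (\<pi> g *\<^sub>v v)"

text \<open>The irreducible representation of dimension \<open>N + 1\<close> is unique up to isomorphism, and isomorphic
  representations have the same matrix coefficients; hence the representation \<open>\<pi>\<close> may be any
  irreducible one of this dimension. The values of \<open>F\<close> outside \<^const>\<open>G0\<close> are arbitrary.\<close>

definition coeff_space :: "nat \<Rightarrow> (quat \<Rightarrow> complex) set" where
  "coeff_space N = {F. \<exists>\<pi>. irreducible_representation (N + 1) \<pi> \<and>
     (\<exists>(m::nat) c w v.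
        (\<forall>l<m. w l \<in> carrier_vec (N + 1) \<and> v l \<in> carrier_vec (N + 1)) \<and>
        (\<forall>g\<in>G0. F g = (\<Sum>l<m. c l * matrix_coeff \<pi> (w l) (v l) g)))}"

end

theory Submission
  imports Defs "HOL-Probability.Probability"
begin

text \<open>Write \<open>x = \<alpha> + \<beta> j\<close>. The polynomials \<open>P = \<alpha> ^ j * cnj \<beta> ^ (n - j)\<close> are products of linear forms
  spanning a totally isotropic plane, so differentiating \<open>P * exp (- c \<bar>x\<bar>\<^sup>2)\<close> along those directions
  only hits the Gaussian. Integration by parts then gives Hecke's formula: the Fourier transform of
  \<open>P * exp (- c \<bar>x\<bar>\<^sup>2)\<close> is a constant times \<open>P * exp (- \<bar>x\<bar>\<^sup>2 / c')\<close>. Integrating over \<open>c\<close> against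
  \<open>c powr (z - 1)\<close> turns Gaussians into powers of the norm and yields the identity, whose factor is a
  quotient of two Gamma functions times elementary factors.

  It remains to see that every matrix coefficient of an irreducible representation \<open>\<pi>\<close> of dimension
  \<open>N + 1\<close> is a combination of right translates of such \<open>P\<close> with \<open>n = N\<close>. Averaging \<open>cnj \<alpha> ^ n\<close> over
  conjugacy classes gives a polynomial of degree exactly \<open>n\<close> in the real part, so by Weierstrass
  approximation the character of \<open>\<pi>\<close> is not orthogonal to all of these. Hence \<open>\<integral> cnj \<alpha> ^ n * \<pi>\<close> is
  nonzero for some \<open>n\<close>, and any nonzero vector in its image embeds the dual of \<open>\<pi>\<close> into the homogeneous
  polynomials of degree \<open>n\<close> in \<open>(\<alpha>, cnj \<beta>)\<close>. As those form an irreducible representation of dimension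
  \<open>n + 1\<close>, we get \<open>n = N\<close>.\<close>

section \<open>Integration on Euclidean space\<close>

text \<open>Two coincidences give the identity its shape. The trace pairing is
  \<open>qtr (x \<star> y) = 2 * inner x (qconj y)\<close>, so the transform lives at
  \<open>qconj y\<close>; and for radial extensions the argument \<open>1/x\<close> also amounts to
  \<open>qconj x\<close>. One change of variable by \<open>qconj\<close> removes both. Moreover the
  module is the fourth power of the Euclidean norm, so the two functions have degrees
  \<open>4 * s - 4\<close> and \<open>- 4 * s\<close>; in the strip both real parts lie strictly
  between -4 and 0, and everything converges absolutely at the origin of a four-dimensional space.

  The obstacle is the two-sided action. Left translation maps the plane spanned by \<open>qa\<close>
  and \<open>qb\<close> to itself, right translation does not. Left translation therefore serves to
  recognise the coefficients against one fixed vector as polynomials, and right translation to reach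
  all other vectors. For the latter, Hecke's formula is kept as a predicate \<open>hecke\<close>,
  stable under linear combinations and all orthogonal maps, so that translates require no
  computation.\<close>

lemma lborel_distr_orthogonal:
  fixes T :: "real^'n::{finite,wellorder} \<Rightarrow> real^'n::_"
  assumes T: "orthogonal_transformation T"
  shows "distr lborel borel T = lborel"
proof (rule sym, rule lborel_eqI)
  have cont: "continuous_on UNIV T"
    using orthogonal_transformation_linear[OF T] by (simp add: linear_continuous_on linear_conv_bounded_linear)
  then have meas: "T \<in> measurable lborel borel"
    by (simp add: borel_measurable_continuous_onI)
  fix l u :: "real^'n::_"
  assume lu: "\<And>b. b \<in> Basis \<Longrightarrow> inner l b \<le> inner u b"
  have bij: "bij T"
    using T by (rule orthogonal_transformation_bij)
  \<comment> \<open>Invariance of measure is stated for images, so the preimage of a box is read as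
    its image under the inverse map, which is again orthogonal.\<close>
  have S: "T -` box l u = inv_into UNIV T ` box l u"
    using bij by (rule bij_vimage_eq_inv_image)
  have inv: "orthogonal_transformation (inv_into UNIV T)"
    using T by (rule orthogonal_transformation_inv)
  have fm: "inv_into UNIV T ` box l u \<in> lmeasurable"
    by (rule measurable_orthogonal_image[OF inv]) simp
  have "emeasure (distr lborel borel T) (box l u) = emeasure lborel (T -` box l u)"
    using meas by (simp add: emeasure_distr)
  also have "\<dots> = emeasure lebesgue (inv_into UNIV T ` box l u)"
    using measurable_sets[OF meas, of "box l u"] by (simp add: S[symmetric])
  also have "\<dots> = measure lebesgue (inv_into UNIV T ` box l u)"
    using fm by (simp add: emeasure_eq_measure2)
  also have "\<dots> = measure lebesgue (box l u)"
    by (subst measure_orthogonal_image[OF inv]) auto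
  also have "\<dots> = (\<Prod>b\<in>Basis. inner (u - l) b)"
    using lu by (simp add: measure_lborel_box_eq)
  finally show "emeasure (distr lborel borel T) (box l u) = (\<Prod>b\<in>Basis. inner (u - l) b)" .
qed simp

lemma lborel_integral_orthogonal:
  fixes T :: "real^'n::{finite,wellorder} \<Rightarrow> real^'n::_" and f :: "(real^'n::_) \<Rightarrow> 'b::{banach,second_countable_topology}"
  assumes T: "orthogonal_transformation T" and f: "f \<in> borel_measurable borel"
  shows "(LINT x|lborel. f (T x)) = (LINT x|lborel. f x)"
    and "integrable lborel (\<lambda>x. f (T x)) \<longleftrightarrow> integrable lborel f"
proof -
  have "continuous_on UNIV T"
    using orthogonal_transformation_linear[OF T] by (simp add: linear_continuous_on linear_conv_bounded_linear)
  then have meas: "T \<in> measurable lborel borel"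
    by (simp add: borel_measurable_continuous_onI)
  show "(LINT x|lborel. f (T x)) = (LINT x|lborel. f x)"
    by (subst (2) lborel_distr_orthogonal[OF T, symmetric]) (simp add: integral_distr[OF meas] f)
  show "integrable lborel (\<lambda>x. f (T x)) \<longleftrightarrow> integrable lborel f"
    by (subst (2) lborel_distr_orthogonal[OF T, symmetric]) (simp add: integrable_distr_eq[OF meas] f)
qed

lemma
  fixes f :: "'a::euclidean_space \<Rightarrow> real \<Rightarrow> 'b::{real_normed_field,banach,second_countable_topology}"
  assumes f: "\<And>b. b \<in> Basis \<Longrightarrow> integrable lborel (f b)"
  shows lborel_integrable_prod: "integrable lborel (\<lambda>x. \<Prod>b\<in>Basis. f b (inner x b))"
    and lborel_integral_prod:
      "(LINT x|lborel. (\<Prod>b\<in>Basis. f b (inner x b))) = (\<Prod>b\<in>Basis. LINT t|lborel. f b t)"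
proof -
  interpret product_sigma_finite "\<lambda>_::'a. lborel :: real measure"
    by standard
  let ?g = "\<lambda>v. \<Sum>b\<in>Basis. v b *\<^sub>R b :: 'a"
  have g: "?g \<in> measurable (PiM Basis (\<lambda>_. lborel)) borel"
    by measurable
  have [measurable]: "f b \<in> borel_measurable borel" if "b \<in> Basis" for b
    using f[OF that] by (auto dest: borel_measurable_integrable)
  have meas: "(\<lambda>x. \<Prod>b\<in>Basis. f b (inner x b)) \<in> borel_measurable borel"
    by measurable
  have eq: "(\<Prod>b\<in>Basis. f b (inner (?g v) b)) = (\<Prod>b\<in>Basis. f b (v b))" for v
    by (intro prod.cong refl arg_cong2[where f=f]) simp
  show "integrable lborel (\<lambda>x. \<Prod>b\<in>Basis. f b (inner x b))"
    unfolding lborel_eq[where 'a='a]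
    by (subst integrable_distr_eq[OF g meas], unfold eq)
       (rule product_integrable_prod, auto intro: f)
  show "(LINT x|lborel. (\<Prod>b\<in>Basis. f b (inner x b))) = (\<Prod>b\<in>Basis. LINT t|lborel. f b t)"
    unfolding lborel_eq[where 'a='a]
    by (subst integral_distr[OF g meas], unfold eq)
       (rule product_integral_prod, auto intro: f)
qed

text \<open>Dominated by \<open>t powr (- b)\<close> on \<open>(0, 1]\<close> and by
  \<open>t powr (- b - 1)\<close> from 1 on; reflection handles negative \<open>t\<close>.\<close>

lemma integrable_powr_decay_1:
  fixes b :: real
  assumes b: "0 < b" "b < 1"
  shows "integrable lborel (\<lambda>t. \<bar>t\<bar> powr (- b) / (1 + \<bar>t\<bar>))"
proof -
  let ?f = "\<lambda>t::real. t powr (- b) / (1 + t)"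
  have 1: "set_integrable lborel {0<..1} ?f"
  proof (rule set_integrable_bound)
    have "(\<lambda>t. t powr (- b)) integrable_on {0<..1}"
      using integrable_on_powr_from_0'[of "- b" 1] b by simp
    then have "(\<lambda>t. t powr (- b)) absolutely_integrable_on {0<..1}"
      by (rule nonnegative_absolutely_integrable_1) auto
    then show "set_integrable lborel {0<..1} (\<lambda>t. t powr (- b))"
      by (simp add: set_integrable_def integrable_completion)
  qed (auto simp: set_borel_measurable_def divide_le_eq intro!: AE_I2 mult_left_mono[of 1, simplified])
  have 2: "set_integrable lborel {1..} ?f"
  proof (rule set_integrable_bound)
    have "(\<lambda>t. t powr (- b - 1)) integrable_on {1..}"
      using has_integral_powr_to_inf[of "-b-1" 1] b by (auto simp: integrable_on_def)
    then have "(\<lambda>t. t powr (- b - 1)) absolutely_integrable_on {1..}"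
      by (rule nonnegative_absolutely_integrable_1) auto
    then show "set_integrable lborel {1..} (\<lambda>t. t powr (- b - 1))"
      by (simp add: set_integrable_def integrable_completion)
    show "AE t in lborel. t \<in> {1..} \<longrightarrow> norm (?f t) \<le> norm (t powr (- b - 1))"
      by (auto simp: powr_diff divide_simps mult_left_mono intro!: AE_I2)
  qed (auto simp: set_borel_measurable_def)
  have "set_integrable lborel ({0<..1} \<union> {1..}) ?f"
    by (intro set_integrable_Un 1 2) auto
  also have "{0<..1} \<union> {1..} = {0::real<..}"
    by auto
  finally have pos: "integrable lborel (\<lambda>t. indicator {0<..} t * ?f t)"
    by (simp add: set_integrable_def)
  then have neg: "integrable lborel (\<lambda>t. indicator {0<..} (- t) * ?f (- t))"
    using lborel_integrable_real_affine_iff[of "-1" "\<lambda>t. indicator {0<..} t * ?f t" 0] by simp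
  have "integrable lborel (\<lambda>t. indicator {0<..} t * ?f t + indicator {0<..} (- t) * ?f (- t))"
    using pos neg by (rule Bochner_Integration.integrable_add)
  then show ?thesis
    by (rule back_subst[of "integrable lborel"]) (auto simp: fun_eq_iff indicator_def abs_if)
qed

text \<open>The integrand is dominated by a product of functions of one coordinate, since \<open>norm x\<close> is at least
  each \<open>\<bar>inner x b\<bar>\<close>; the exponents are distributed evenly over the four coordinates.\<close>

lemma integrable_norm_powr_decay:
  fixes \<alpha> :: real
  assumes \<alpha>: "0 < \<alpha>" "\<alpha> < 4"
  shows "integrable lborel (\<lambda>x::real^4. norm x powr (- \<alpha>) / (1 + norm x) ^ 4)"
proof (rule Bochner_Integration.integrable_bound)
  let ?g = "\<lambda>t::real. \<bar>t\<bar> powr (- (\<alpha>/4)) / (1 + \<bar>t\<bar>)"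
  show "integrable lborel (\<lambda>x::real^4. \<Prod>b\<in>Basis. ?g (inner x b))"
    using \<alpha> by (intro lborel_integrable_prod integrable_powr_decay_1) auto
  have card: "card (Basis :: (real^4) set) = 4"
    using DIM_cart[where 'a=real and 'b=4] by simp
  have *: "norm x powr (- \<alpha>) / (1 + norm x) ^ 4 \<le> (\<Prod>b\<in>Basis. ?g (inner x b))"
    if nz: "\<And>b. b \<in> Basis \<Longrightarrow> inner x b \<noteq> 0" for x :: "real^4"
  proof -
    have x: "x \<noteq> 0"
      using nz by (metis SOME_Basis inner_zero_left)
    have "norm x powr (- \<alpha>) / (1 + norm x) ^ 4 = (\<Prod>b\<in>(Basis::(real^4) set). ?g (norm x))"
      using x by (simp add: card power_divide powr_power)
    also have "\<dots> \<le> (\<Prod>b\<in>Basis. ?g (inner x b))"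
    proof (rule prod_mono, intro conjI)
      fix b :: "real^4" assume b: "b \<in> Basis"
      have le: "\<bar>inner x b\<bar> \<le> norm x"
        using b by (rule Basis_le_norm)
      show "?g (norm x) \<le> ?g (inner x b)"
        using le nz[OF b] \<alpha> x by (intro frac_le) (auto intro!: powr_mono2')
    qed simp
    finally show ?thesis .
  qed
  \<comment> \<open>Where a coordinate of a nonzero \<open>x\<close> vanishes,
    \<open>0 powr _ = 0\<close> makes the product 0 and the bound fails, so the coordinate
    hyperplanes are removed as null sets.\<close>
  have "AE x in lborel. \<forall>b\<in>(Basis::(real^4) set). inner x b \<noteq> 0"
  proof (subst AE_ball_countable)
    show "countable (Basis :: (real^4) set)"
      by (simp add: countable_finite)
    show "\<forall>b\<in>Basis. AE x::real^4 in lborel. inner x b \<noteq> 0"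
    proof
      fix b :: "real^4" assume b: "b \<in> Basis"
      have "negligible {x. inner b x = 0}"
        using b by (intro negligible_hyperplane) auto
      then have "{x. inner b x = 0} \<in> null_sets lborel"
        by (subst null_sets_completion_iff[symmetric])
          (auto simp: negligible_iff_null_sets closed_hyperplane borel_closed)
      then show "AE x in lborel. inner x b \<noteq> 0"
        by (auto dest!: AE_not_in simp: inner_commute)
    qed
  qed
  then show "AE x::real^4 in lborel. norm (norm x powr (- \<alpha>) / (1 + norm x) ^ 4) \<le> norm (\<Prod>b\<in>Basis. ?g (inner x b))"
    by eventually_elim (use * in \<open>force simp: abs_prod\<close>)
qed simp

text \<open>The exponent \<open>\<alpha>\<close> controls the singularity at the origin, the weight
  the decay at infinity. The criterion serves both for fast decay (with \<open>\<alpha> = 1\<close>)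
  and for products with powers of the norm.\<close>

lemma integrable_of_bound:
  fixes f :: "real^4 \<Rightarrow> complex"
  assumes meas: "f \<in> borel_measurable borel" and \<alpha>: "0 < \<alpha>" "\<alpha> < 4"
    and bnd: "\<And>x. x \<noteq> 0 \<Longrightarrow> cmod (f x) * (1 + norm x) ^ 4 \<le> C * norm x powr (- \<alpha>)"
  shows "integrable lborel f"
proof (rule Bochner_Integration.integrable_bound)
  show "integrable lborel (\<lambda>x::real^4. C * (norm x powr (- \<alpha>) / (1 + norm x) ^ 4))"
    by (intro integrable_mult_right integrable_norm_powr_decay \<alpha>)
  have "AE x::real^4 in lborel. x \<noteq> 0"
    by (rule AE_lborel_singleton)
  then show "AE x in lborel. norm (f x) \<le> norm (C * (norm x powr (- \<alpha>) / (1 + norm x) ^ 4))"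
  proof eventually_elim
    case (elim x)
    have pos: "0 < (1 + norm x) ^ 4"
      by (intro zero_less_power add_pos_nonneg) auto
    have "norm (f x) \<le> C * norm x powr (- \<alpha>) / (1 + norm x) ^ 4"
      using bnd[OF elim] pos by (simp add: pos_le_divide_eq)
    also have "\<dots> = C * (norm x powr (- \<alpha>) / (1 + norm x) ^ 4)"
      by simp
    also have "\<dots> \<le> norm (C * (norm x powr (- \<alpha>) / (1 + norm x) ^ 4))"
      unfolding real_norm_def by (rule abs_ge_self)
    finally show ?case .
  qed
qed (use meas in simp)

lemma one_plus_norm_power_pos [simp]: "0 < (1 + norm x) ^ k"
  by (intro zero_less_power add_pos_nonneg) auto

text \<open>Difference quotients integrate to zero by translation invariance, and the mean value
  inequality dominates them uniformly, so the limit passes under the integral. Only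
  differentiability is assumed; the derivative is measurable as a limit of quotients. The weight 8
  leaves a margin above the dimension 4.\<close>

lemma
  fixes g :: "real^4 \<Rightarrow> complex"
  assumes der: "\<And>x. (g has_derivative g' x) (at x)"
    and bnd: "\<And>x. cmod (g' x e) * (1 + norm x) ^ 8 \<le> C"
    and e: "norm e = 1"
    and int: "integrable lborel g"
  shows integrable_directional_derivative: "integrable lborel (\<lambda>x. g' x e)"
    and integral_directional_derivative: "(LINT x|lborel. g' x e) = 0"
proof -
  define q where "q n x = of_nat (Suc n) * (g (x + (1 / Suc n) *\<^sub>R e) - g x)" for n x
  \<comment> \<open>For \<open>z\<close> at distance at most 1 from \<open>x\<close> one has
    \<open>1 + norm x \<le> 2 * (1 + norm z)\<close>; the eighth power of this 2 is the constant
    here.\<close>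
  define D where "D x = 2 ^ 8 * C / (1 + norm x) ^ 8" for x :: "real^4"
  have g_cont: "continuous_on UNIV g"
    using der has_derivative_continuous by (intro continuous_at_imp_continuous_on) blast
  then have g_meas [measurable]: "g \<in> borel_measurable borel"
    by (rule borel_measurable_continuous_onI)
  have q_meas: "q n \<in> borel_measurable borel" for n
    unfolding q_def by measurable
  have lim: "(\<lambda>n. q n x) \<longlonglongrightarrow> g' x e" for x
  proof -
    have lin: "g' x (s *\<^sub>R e) = s *\<^sub>R g' x e" for s
      using bounded_linear.linear[OF has_derivative_bounded_linear[OF der[of x]]]
      by (simp add: linear_cmul)
    have "((\<lambda>h. norm (g (x + h) - g x - g' x h) / norm h) \<longlongrightarrow> 0) (at 0)"
      using der[of x] by (simp add: has_derivative_at)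
    moreover have "filterlim (\<lambda>n. (1 / real (Suc n)) *\<^sub>R e) (at 0) sequentially"
      unfolding filterlim_at
      using e tendsto_scaleR[OF LIMSEQ_Suc[OF lim_1_over_n] tendsto_const, of e]
      by (auto simp del: of_nat_Suc)
    ultimately have "(\<lambda>n. norm (g (x + (1 / real (Suc n)) *\<^sub>R e) - g x - g' x ((1 / real (Suc n)) *\<^sub>R e))
        / norm ((1 / real (Suc n)) *\<^sub>R e)) \<longlonglongrightarrow> 0"
      by (rule filterlim_compose)
    also have "(\<lambda>n. norm (g (x + (1 / real (Suc n)) *\<^sub>R e) - g x - g' x ((1 / real (Suc n)) *\<^sub>R e))
        / norm ((1 / real (Suc n)) *\<^sub>R e)) = (\<lambda>n. norm (q n x - g' x e))"
    proof
      fix n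
      let ?d = "g (x + (1 / real (Suc n)) *\<^sub>R e) - g x" and ?N = "real (Suc n)"
      have "q n x - g' x e = of_real ?N * (?d - (1 / ?N) *\<^sub>R g' x e)"
        by (simp add: q_def scaleR_conv_of_real right_diff_distrib del: of_nat_Suc)
      then have "norm (q n x - g' x e) = ?N * norm (?d - (1 / ?N) *\<^sub>R g' x e)"
        by (simp add: norm_mult del: of_nat_Suc)
      then show "norm (?d - g' x ((1 / ?N) *\<^sub>R e)) / norm ((1 / ?N) *\<^sub>R e) = norm (q n x - g' x e)"
        unfolding lin using e by (simp add: mult.commute del: of_nat_Suc)
    qed
    finally show ?thesis
      using LIM_zero_iff tendsto_norm_zero_iff by blast
  qed
  have bound: "norm (q n x) \<le> D x" for n x
  proof -
    define h where "h = 1 / real (Suc n)"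
    have h: "0 < h" "h \<le> 1"
      by (auto simp: h_def)
    have "norm (g (x + h *\<^sub>R e) - g (x + 0 *\<^sub>R e)) \<le> D x * norm (h - 0)"
    proof (rule differentiable_bound)
      show "((\<lambda>t. g (x + t *\<^sub>R e)) has_derivative (\<lambda>s. g' (x + t *\<^sub>R e) (s *\<^sub>R e))) (at t within {0..h})"
        for t
        by (rule has_derivative_compose[OF _ der, where f="\<lambda>t. x + t *\<^sub>R e"]) (auto intro!: derivative_eq_intros)
      fix t assume t: "t \<in> {0..h}"
      have lin: "g' (x + t *\<^sub>R e) (s *\<^sub>R e) = s *\<^sub>R g' (x + t *\<^sub>R e) e" for s
        using bounded_linear.linear[OF has_derivative_bounded_linear[OF der[of "x + t *\<^sub>R e"]]]
        by (simp add: linear_cmul)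
      define z where "z = x + t *\<^sub>R e"
      have "norm x \<le> norm z + 1"
        using norm_triangle_ineq4[of z "t *\<^sub>R e"] t h e by (simp add: z_def)
      then have "1 + norm x \<le> 2 * (1 + norm z)"
        by (smt (verit) norm_ge_zero)
      then have "(1 + norm x) ^ 8 \<le> (2 * (1 + norm z)) ^ 8"
        by (intro power_mono) auto
      then have "cmod (g' z e) * (1 + norm x) ^ 8
          \<le> cmod (g' z e) * (2 * (1 + norm z)) ^ 8"
        by (intro mult_left_mono) auto
      also have "\<dots> = 2 ^ 8 * (cmod (g' z e) * (1 + norm z) ^ 8)"
        by (simp only: power_mult_distrib mult_ac)
      also have "\<dots> \<le> 2 ^ 8 * C"
        by (intro mult_left_mono bnd) auto
      finally have "cmod (g' z e) \<le> D x"
        unfolding D_def by (simp only: pos_le_divide_eq one_plus_norm_power_pos)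
      then show "onorm (\<lambda>s. g' (x + t *\<^sub>R e) (s *\<^sub>R e)) \<le> D x"
        unfolding lin unfolding z_def[symmetric] by (intro onorm_le) (simp add: mult.commute[of "D x"] mult_left_mono)
    qed (use h in auto)
    then show ?thesis
      using h by (simp add: q_def h_def norm_mult pos_divide_le_eq mult.commute del: of_nat_Suc)
        (simp add: field_simps)
  qed
  have D_int: "integrable lborel D"
  proof -
    have "integrable lborel (\<lambda>x. complex_of_real (D x))"
    proof (rule integrable_of_bound[where \<alpha>=1 and C="2 ^ 8 * \<bar>C\<bar>"])
      fix x :: "real^4" assume x: "x \<noteq> 0"
      define q where "q = (1 + norm x) ^ 4"
      have q: "q > 0" and p8: "(1 + norm x) ^ 8 = q * q"
        by (simp_all only: q_def one_plus_norm_power_pos) (simp flip: power_add)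
      have "norm x \<le> (1 + norm x) ^ 1" by simp
      also have "\<dots> \<le> (1 + norm x) ^ 4"
        by (intro power_increasing) auto
      finally have *: "norm x \<le> (1 + norm x) ^ 4" .
      have "cmod (complex_of_real (D x)) * (1 + norm x) ^ 4 = 2 ^ 8 * \<bar>C\<bar> * (1 / (1 + norm x) ^ 4)"
        unfolding norm_of_real D_def p8 q_def[symmetric] using q by (simp add: abs_mult)
      also have "\<dots> \<le> 2 ^ 8 * \<bar>C\<bar> * (1 / norm x)"
        using x * by (intro mult_left_mono divide_left_mono mult_pos_pos) auto
      also have "\<dots> = 2 ^ 8 * \<bar>C\<bar> * norm x powr (- 1)"
        using x by (simp add: powr_minus divide_inverse)
      finally show "cmod (complex_of_real (D x)) * (1 + norm x) ^ 4 \<le> 2 ^ 8 * \<bar>C\<bar> * norm x powr (- 1)" .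
    qed (auto simp: D_def)
    then show ?thesis
      by (simp only: complex_of_real_integrable_eq)
  qed
  have g'_meas: "(\<lambda>x. g' x e) \<in> borel_measurable lborel"
    by (rule borel_measurable_LIMSEQ_metric[where f=q]) (use q_meas lim in auto)
  show "integrable lborel (\<lambda>x. g' x e)"
    by (rule integrable_dominated_convergence[where s=q and w=D])
      (use g'_meas q_meas D_int lim bound in auto)
  have conv: "(\<lambda>n. LINT x|lborel. q n x) \<longlonglongrightarrow> (LINT x|lborel. g' x e)"
    by (rule integral_dominated_convergence[where w=D])
      (use g'_meas q_meas D_int lim bound in auto)
  have "(LINT x|lborel. q n x) = 0" for n
  proof -
    define v where "v = (1 / real (Suc n)) *\<^sub>R e"
    have i: "integrable lborel (\<lambda>x. g (v + x))" "(LINT x|lborel. g (v + x)) = (LINT x|lborel. g x)"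
      using int integrable_distr_eq[of "(+) v" lborel borel g] integral_distr[of "(+) v" lborel borel g]
      by (auto simp: lborel_distr_plus)
    have "(LINT x|lborel. g (v + x) - g x) = 0"
      using i int by simp
    then show ?thesis
      unfolding q_def by (simp add: v_def add.commute del: of_nat_Suc)
  qed
  with conv show "(LINT x|lborel. g' x e) = 0"
    by (simp add: LIMSEQ_const_iff)
qed

section \<open>Fourier transforms of Schwartz functions and Gaussians\<close>

lemma schwartz_partial_deriv: "\<phi> \<in> schwartz \<Longrightarrow> partial_deriv i \<phi> \<in> schwartz"
proof -
  have "partial_derivs is (partial_deriv i \<phi>) = partial_derivs (is @ [i]) \<phi>" for "is"
    by (simp add: partial_derivs_def)
  then show "\<phi> \<in> schwartz \<Longrightarrow> partial_deriv i \<phi> \<in> schwartz"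
    unfolding schwartz_def by simp
qed

lemma schwartz_has_derivative:
  assumes "\<phi> \<in> schwartz"
  shows "(\<phi> has_derivative frechet_derivative \<phi> (at x)) (at x)"
proof -
  have "partial_derivs [] \<phi> differentiable (at x)"
    using assms unfolding schwartz_def by blast
  then show ?thesis
    by (simp add: partial_derivs_def frechet_derivative_works)
qed

lemma schwartz_continuous: "\<phi> \<in> schwartz \<Longrightarrow> continuous_on UNIV \<phi>"
  using schwartz_has_derivative has_derivative_continuous
  by (intro continuous_at_imp_continuous_on) blast

lemma schwartz_measurable: "\<phi> \<in> schwartz \<Longrightarrow> \<phi> \<in> borel_measurable borel"
  by (rule borel_measurable_continuous_onI[OF schwartz_continuous])

lemma schwartz_bdd_above:
  assumes "\<phi> \<in> schwartz"
  shows "bdd_above (range (\<lambda>x. (1 + norm x) ^ k * cmod (partial_derivs is \<phi> x)))"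
  using assms unfolding schwartz_def by (intro bounded_imp_bdd_above) blast

lemma schwartz_bound:
  assumes "\<phi> \<in> schwartz"
  obtains C where "\<And>x. cmod (\<phi> x) * (1 + norm x) ^ k \<le> C"
  using schwartz_bdd_above[OF assms, of k "[]"]
  by (auto simp: bdd_above_def partial_derivs_def mult.commute)

lemma integrable_of_decay:
  fixes f :: "real^4 \<Rightarrow> complex"
  assumes meas: "f \<in> borel_measurable borel"
    and bnd: "\<And>x. cmod (f x) * (1 + norm x) ^ 8 \<le> C"
  shows "integrable lborel f"
proof (rule integrable_of_bound[OF meas, where \<alpha>=1 and C=C])
  fix x :: "real^4" assume x: "x \<noteq> 0"
  have "norm x \<le> (1 + norm x) ^ 1" by simp
  also have "\<dots> \<le> (1 + norm x) ^ 4"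
    by (intro power_increasing) auto
  finally have "cmod (f x) * (1 + norm x) ^ 4 * norm x \<le> cmod (f x) * (1 + norm x) ^ 4 * (1 + norm x) ^ 4"
    by (intro mult_left_mono) auto
  also have "\<dots> \<le> C"
    using bnd[of x] by (simp add: mult.assoc flip: power_add)
  finally show "cmod (f x) * (1 + norm x) ^ 4 \<le> C * norm x powr - 1"
    using x by (simp add: powr_minus divide_inverse[symmetric] pos_le_divide_eq)
qed auto

lemma schwartz_integrable: "\<phi> \<in> schwartz \<Longrightarrow> integrable lborel \<phi>"
  using schwartz_bound[of \<phi> 8] integrable_of_decay[of \<phi>] schwartz_measurable by metis

text \<open>The scale \<open>\<kappa>\<close> stays free: the quaternionic transform is the case
  \<open>4 * pi\<close> evaluated at \<open>qconj y\<close>, and \<open>\<kappa> = 0\<close> gives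
  integrals without oscillation.\<close>

definition osc :: "real \<Rightarrow> quat \<Rightarrow> quat \<Rightarrow> complex" where
  "osc \<kappa> y x = exp (\<i> * of_real (\<kappa> * inner x y))"

definition ft :: "real \<Rightarrow> (quat \<Rightarrow> complex) \<Rightarrow> quat \<Rightarrow> complex" where
  "ft \<kappa> \<phi> y = (LINT x|lborel. \<phi> x * osc \<kappa> y x)"

lemma cmod_osc [simp]: "cmod (osc \<kappa> y x) = 1"
  by (simp add: osc_def)

lemma osc_measurable [measurable]:
  assumes [measurable]: "f \<in> borel_measurable M" "g \<in> borel_measurable M"
  shows "(\<lambda>x. osc \<kappa> (f x) (g x)) \<in> borel_measurable M"
  unfolding osc_def by measurable

lemma osc_has_derivative:
  "(osc \<kappa> y has_derivative (\<lambda>h. \<i> * of_real (\<kappa> * inner h y) * osc \<kappa> y x)) (at x)"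
proof -
  have "((\<lambda>x. \<i> * of_real (\<kappa> * inner x y)) has_derivative (\<lambda>h. \<i> * of_real (\<kappa> * inner h y))) (at x)"
    by (intro bounded_linear_imp_has_derivative bounded_linear_const_mult
        bounded_linear_compose[OF bounded_linear_of_real] bounded_linear_inner_left)
  from has_derivative_compose[OF this DERIV_exp[unfolded has_field_derivative_def]] show ?thesis
    unfolding osc_def by (simp add: mult.commute)
qed

text \<open>Integration by parts: the derivative of the product of \<open>\<phi>\<close> and
  \<open>osc\<close> integrates to zero.\<close>

lemma ft_partial_deriv:
  assumes \<phi>: "\<phi> \<in> schwartz"
  shows "ft \<kappa> (partial_deriv i \<phi>) y = - (\<i> * of_real (\<kappa> * y $ i)) * ft \<kappa> \<phi> y"
proof -
  let ?e = "axis i 1 :: quat"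
  define g' where "g' x h = frechet_derivative \<phi> (at x) h * osc \<kappa> y x
    + \<phi> x * (\<i> * of_real (\<kappa> * inner h y) * osc \<kappa> y x)" for x h
  have e: "inner ?e y = y $ i"
    by (simp add: inner_axis')
  have g'_e: "g' x ?e = partial_deriv i \<phi> x * osc \<kappa> y x + \<i> * of_real (\<kappa> * y $ i) * (\<phi> x * osc \<kappa> y x)" for x
    by (simp add: g'_def e partial_deriv_def)
  have der: "((\<lambda>x. \<phi> x * osc \<kappa> y x) has_derivative g' x) (at x)" for x
    unfolding g'_def
    by (rule derivative_eq_intros schwartz_has_derivative[OF \<phi>] osc_has_derivative refl)+
       (simp add: fun_eq_iff)
  note d\<phi> = schwartz_partial_deriv[OF \<phi>, of i]
  obtain C1 where C1: "\<And>x. cmod (\<phi> x) * (1 + norm x) ^ 8 \<le> C1"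
    using schwartz_bound[OF \<phi>] by blast
  obtain C2 where C2: "\<And>x. cmod (partial_deriv i \<phi> x) * (1 + norm x) ^ 8 \<le> C2"
    using schwartz_bound[OF d\<phi>] by blast
  have int: "integrable lborel (\<lambda>x. \<psi> x * osc \<kappa> y x)" if "\<psi> \<in> schwartz" for \<psi>
    by (rule Bochner_Integration.integrable_bound[OF schwartz_integrable[OF that]])
      (use schwartz_measurable[OF that] in \<open>auto simp: norm_mult\<close>)
  have "(LINT x|lborel. g' x ?e) = 0"
  proof (rule integral_directional_derivative[OF der _ _ int[OF \<phi>]])
    show "cmod (g' x ?e) * (1 + norm x) ^ 8 \<le> C2 + \<bar>\<kappa> * y $ i\<bar> * C1" for x
    proof -
      have "cmod (g' x ?e) \<le> cmod (partial_deriv i \<phi> x) + \<bar>\<kappa> * y $ i\<bar> * cmod (\<phi> x)"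
        unfolding g'_e by (rule order_trans[OF norm_triangle_ineq]) (simp add: norm_mult abs_mult)
      then have "cmod (g' x ?e) * (1 + norm x) ^ 8
          \<le> (cmod (partial_deriv i \<phi> x) + \<bar>\<kappa> * y $ i\<bar> * cmod (\<phi> x)) * (1 + norm x) ^ 8"
        by (intro mult_right_mono) auto
      also have "\<dots> = cmod (partial_deriv i \<phi> x) * (1 + norm x) ^ 8
          + \<bar>\<kappa> * y $ i\<bar> * (cmod (\<phi> x) * (1 + norm x) ^ 8)"
        by (simp add: algebra_simps)
      also have "\<dots> \<le> C2 + \<bar>\<kappa> * y $ i\<bar> * C1"
        by (intro add_mono mult_left_mono C1 C2) auto
      finally show ?thesis .
    qed
  qed simp
  then show ?thesis
    unfolding g'_e ft_def using int[OF \<phi>] int[OF d\<phi>]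
    by (simp add: add_eq_0_iff2 add_eq_0_iff)
qed

lemma ft_le:
  assumes "\<phi> \<in> schwartz"
  shows "cmod (ft \<kappa> \<phi> y) \<le> (LINT x|lborel. cmod (\<phi> x))"
proof -
  have "cmod (ft \<kappa> \<phi> y) \<le> (LINT x|lborel. cmod (\<phi> x * osc \<kappa> y x))"
    unfolding ft_def by (rule integral_norm_bound)
  then show ?thesis
    by (simp add: norm_mult)
qed

text \<open>Four derivatives in one coordinate multiply the transform by the fourth power of
  \<open>\<i> * \<kappa> * y $ i\<close>, and every transform is bounded by an L1 norm. Order four
  is the decay that \<open>integrable_hecke_rpow\<close> asks for.\<close>

lemma ft_decay:
  assumes \<phi>: "\<phi> \<in> schwartz" and \<kappa>: "\<kappa> \<noteq> 0"
  obtains C where "\<And>y. cmod (ft \<kappa> \<phi> y) * (1 + norm y) ^ 4 \<le> C"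
proof -
  have "\<exists>B. \<forall>y. (y $ i) ^ 4 * cmod (ft \<kappa> \<phi> y) \<le> B" for i
  proof -
    define D where "D = partial_deriv i"
    have S: "D \<phi> \<in> schwartz" "D (D \<phi>) \<in> schwartz" "D (D (D \<phi>)) \<in> schwartz" "D (D (D (D \<phi>))) \<in> schwartz"
      unfolding D_def using \<phi> by (auto intro: schwartz_partial_deriv)
    define B where "B = (LINT x|lborel. cmod (D (D (D (D \<phi>))) x)) / \<kappa> ^ 4"
    have "(y $ i) ^ 4 * cmod (ft \<kappa> \<phi> y) \<le> B" for y
    proof -
      have "ft \<kappa> (D (D (D (D \<phi>)))) y = (\<i> * of_real (\<kappa> * y $ i)) ^ 4 * ft \<kappa> \<phi> y"
        using S \<phi> unfolding D_def by (simp add: ft_partial_deriv power4_eq_xxxx)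
      then have "cmod (ft \<kappa> (D (D (D (D \<phi>)))) y) = (\<kappa> * y $ i) ^ 4 * cmod (ft \<kappa> \<phi> y)"
        by (simp add: norm_mult norm_power power_mult_distrib)
      then have "(\<kappa> * y $ i) ^ 4 * cmod (ft \<kappa> \<phi> y) \<le> (LINT x|lborel. cmod (D (D (D (D \<phi>))) x))"
        using ft_le[OF S(4), of \<kappa> y] by simp
      then show ?thesis
        using \<kappa> by (simp add: B_def pos_le_divide_eq power_mult_distrib zero_less_power_eq mult_ac)
    qed
    then show ?thesis by blast
  qed
  then obtain B where B: "\<And>i y. (y $ i) ^ 4 * cmod (ft \<kappa> \<phi> y) \<le> B i"
    by metis
  show ?thesis
  proof
    fix y :: quat
    \<comment> \<open>By Cauchy-Schwarz the square of a sum of four squares is at most four times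
      the sum of the fourth powers.\<close>
    have "norm y ^ 4 = (\<Sum>i\<in>UNIV. (y $ i)\<^sup>2)\<^sup>2"
      using power_mult[of "norm y" 2 2] by (simp add: norm_vec_def L2_set_def sum_nonneg)
    also have "\<dots> \<le> (\<Sum>i\<in>(UNIV::4 set). ((y $ i)\<^sup>2)\<^sup>2) * card (UNIV :: 4 set)"
      by (rule sum_squared_le_sum_of_squares)
    finally have n4: "norm y ^ 4 \<le> 4 * (\<Sum>i\<in>UNIV. (y $ i) ^ 4)"
      by (simp add: mult.commute flip: power_mult)
    have "(1 + norm y) ^ 4 \<le> (2 * max 1 (norm y)) ^ 4"
      by (intro power_mono) auto
    also have "\<dots> \<le> 16 * (1 + norm y ^ 4)"
      by (auto simp: max_def power_mult_distrib)
    finally have "cmod (ft \<kappa> \<phi> y) * (1 + norm y) ^ 4 \<le> cmod (ft \<kappa> \<phi> y) * (16 * (1 + 4 * (\<Sum>i\<in>UNIV. (y $ i) ^ 4)))"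
      using n4 by (intro mult_left_mono) auto
    also have "\<dots> = 16 * cmod (ft \<kappa> \<phi> y) + 64 * (\<Sum>i\<in>UNIV. (y $ i) ^ 4 * cmod (ft \<kappa> \<phi> y))"
      by (simp add: algebra_simps sum_distrib_left)
    also have "\<dots> \<le> 16 * (LINT x|lborel. cmod (\<phi> x)) + 64 * (\<Sum>i\<in>UNIV. B i)"
      by (intro add_mono mult_left_mono sum_mono B ft_le \<phi>) auto
    finally show "cmod (ft \<kappa> \<phi> y) * (1 + norm y) ^ 4 \<le> 16 * (LINT x|lborel. cmod (\<phi> x)) + 64 * (\<Sum>i\<in>UNIV. B i)" .
  qed
qed

section \<open>Gaussian integrals in one and four variables\<close>

definition gauss1 :: "real \<Rightarrow> real \<Rightarrow> real \<Rightarrow> complex" where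
  "gauss1 c s t = of_real (exp (- c * t\<^sup>2)) * exp (\<i> * of_real (s * t))"

text \<open>The scaling makes the Gaussian a standard normal density, so that its transform is the
  known characteristic function.\<close>

lemma gauss1_scaled:
  assumes "c > 0"
  shows "gauss1 c s (t / sqrt (2 * c)) = of_real (sqrt (2 * pi)) * (std_normal_density t *\<^sub>R iexp (s / sqrt (2 * c) * t))"
proof -
  have "- c * (t / sqrt (2 * c))\<^sup>2 = - t\<^sup>2 / 2"
    using assms by (simp add: power_divide)
  then have "gauss1 c s (t / sqrt (2 * c)) = of_real (exp (- t\<^sup>2 / 2)) * iexp (s / sqrt (2 * c) * t)"
    unfolding gauss1_def by simp
  also have "exp (- t\<^sup>2 / 2) = sqrt (2 * pi) * std_normal_density t"
    by (simp add: std_normal_density_def)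
  finally show ?thesis
    by (simp only: of_real_mult scaleR_conv_of_real mult.assoc)
qed

lemma
  assumes c: "c > 0"
  shows integrable_gauss1: "integrable lborel (gauss1 c s)"
    and integral_gauss1: "(LINT t|lborel. gauss1 c s t) = of_real (sqrt (pi / c) * exp (- s\<^sup>2 / (4 * c)))"
proof -
  define a where "a = sqrt (2 * c)"
  have a: "a > 0" "a\<^sup>2 = 2 * c"
    using c by (auto simp: a_def)
  have eq: "gauss1 c s (0 + 1 / a * t) = of_real (sqrt (2 * pi)) * (std_normal_density t *\<^sub>R iexp (s / a * t))" for t
    using gauss1_scaled[OF c, of s t] by (simp add: a_def)
  interpret N: prob_space std_normal_distribution
    by (rule prob_space_normal_density) simp
  have "integrable std_normal_distribution (\<lambda>t. iexp (s / a * t))"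
    by (rule N.integrable_const_bound[where B=1]) auto
  then have "integrable lborel (\<lambda>t. std_normal_density t *\<^sub>R iexp (s / a * t))"
    by (subst (asm) integrable_density) auto
  then have i: "integrable lborel (\<lambda>t. gauss1 c s (0 + 1 / a * t))"
    unfolding eq by (rule integrable_mult_right)
  show "integrable lborel (gauss1 c s)"
    using lborel_integrable_real_affine_iff[of "1 / a" "gauss1 c s" 0] a i by simp
  have "of_real (exp (- (s / a)\<^sup>2 / 2)) = char std_normal_distribution (s / a)"
    by (simp add: char_std_normal_distribution)
  also have "\<dots> = (LINT t|lborel. std_normal_density t *\<^sub>R iexp (s / a * t))"
    unfolding char_def by (subst integral_density) auto
  finally have 1: "(LINT t|lborel. gauss1 c s (0 + 1 / a * t)) = of_real (sqrt (2 * pi)) * of_real (exp (- (s / a)\<^sup>2 / 2))"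
    unfolding eq by (simp only: integral_mult_right_zero)
  have "(LINT t|lborel. gauss1 c s t) = \<bar>1 / a\<bar> *\<^sub>R (LINT t|lborel. gauss1 c s (0 + 1 / a * t))"
    by (rule lborel_integral_real_affine) (use a in simp)
  also have "\<dots> = of_real ((1 / a) * sqrt (2 * pi) * exp (- ((s / a)\<^sup>2 / 2)))"
    unfolding 1 using a by (simp add: scaleR_conv_of_real)
  also have "(1 / a) * sqrt (2 * pi) = sqrt (pi / c)"
    using c by (simp add: a_def real_sqrt_mult real_sqrt_divide)
  also have "- ((s / a)\<^sup>2 / 2) = - s\<^sup>2 / (4 * c)"
    using a by (simp add: power_divide)
  finally show "(LINT t|lborel. gauss1 c s t) = of_real (sqrt (pi / c) * exp (- s\<^sup>2 / (4 * c)))" .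
qed

definition gauss :: "real \<Rightarrow> quat \<Rightarrow> complex" where
  "gauss c x = of_real (exp (- c * (norm x)\<^sup>2))"

lemma gauss_measurable [measurable]: "gauss c \<in> borel_measurable borel"
  unfolding gauss_def by measurable

lemma cmod_gauss: "cmod (gauss c x) = exp (- c * (norm x)\<^sup>2)"
  by (simp add: gauss_def)

text \<open>\<open>1 + t \<le> exp t\<close> reduces the product to
  \<open>exp (m * t - c * t^2)\<close>, and completing the square bounds the exponent.\<close>

lemma gauss_bound:
  assumes "c > 0"
  shows "(1 + norm x) ^ m * exp (- c * (norm x)\<^sup>2) \<le> exp ((real m)\<^sup>2 / (4 * c))"
proof -
  have "(1 + norm x) ^ m \<le> exp (norm x) ^ m"
    by (intro power_mono exp_ge_add_one_self) auto
  also have "\<dots> = exp (real m * norm x)"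
    by (simp add: exp_of_nat_mult)
  finally have "(1 + norm x) ^ m * exp (- c * (norm x)\<^sup>2) \<le> exp (real m * norm x) * exp (- c * (norm x)\<^sup>2)"
    by (intro mult_right_mono) auto
  also have "\<dots> = exp (real m * norm x - c * (norm x)\<^sup>2)"
    by (simp flip: exp_add)
  also have "real m * norm x - c * (norm x)\<^sup>2 \<le> (real m)\<^sup>2 / (4 * c)"
  proof -
    have "(real m)\<^sup>2 / (4 * c) - (real m * norm x - c * (norm x)\<^sup>2) = (real m - 2 * c * norm x)\<^sup>2 / (4 * c)"
      using assms by (simp add: field_simps power2_eq_square)
    also have "\<dots> \<ge> 0"
      using assms by simp
    finally show ?thesis by simp
  qed
  finally show ?thesis by simp
qed

lemma integral_gauss_osc:
  assumes c: "c > 0"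
  shows "(LINT x|lborel. gauss c x * osc \<kappa> y x)
    = of_real ((pi / c)\<^sup>2 * exp (- (\<kappa>\<^sup>2 * (norm y)\<^sup>2) / (4 * c)))"
proof -
  have card: "card (Basis :: quat set) = 4"
    using DIM_cart[where 'a=real and 'b=4] by simp
  have nsq: "(norm x)\<^sup>2 = (\<Sum>b\<in>Basis. (inner x b)\<^sup>2)" for x :: quat
    unfolding power2_norm_eq_inner by (subst euclidean_inner) (simp add: power2_eq_square)
  have "gauss c x * osc \<kappa> y x = (\<Prod>b\<in>Basis. gauss1 c (\<kappa> * inner y b) (inner x b))" for x
  proof -
    have "exp (- c * (norm x)\<^sup>2) = (\<Prod>b\<in>Basis. exp (- c * (inner x b)\<^sup>2))"
      unfolding nsq by (simp add: sum_distrib_left exp_sum flip: sum_negf)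
    moreover have "exp (\<i> * of_real (\<kappa> * inner x y)) = (\<Prod>b\<in>Basis. exp (\<i> * of_real (\<kappa> * inner y b * inner x b)))"
      unfolding euclidean_inner[of x y] by (simp add: sum_distrib_left mult_ac flip: exp_sum)
    ultimately show ?thesis
      unfolding gauss_def osc_def gauss1_def by (simp only: of_real_prod prod.distrib)
  qed
  then have "(LINT x|lborel. gauss c x * osc \<kappa> y x) = (\<Prod>b\<in>Basis. LINT t|lborel. gauss1 c (\<kappa> * inner y b) t)"
    using lborel_integral_prod[of "\<lambda>b. gauss1 c (\<kappa> * inner y b)"] integrable_gauss1[OF c] by simp
  also have "\<dots> = (\<Prod>b\<in>(Basis::quat set). of_real (sqrt (pi / c) * exp (- (\<kappa> * inner y b)\<^sup>2 / (4 * c))))"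
    by (simp only: integral_gauss1[OF c])
  also have "\<dots> = of_real (sqrt (pi / c) ^ 4 * exp (\<Sum>b\<in>Basis. - (\<kappa> * inner y b)\<^sup>2 / (4 * c)))"
    by (simp add: prod.distrib card exp_sum)
  also have "sqrt (pi / c) ^ 4 = (pi / c)\<^sup>2"
    using c power_mult[of "sqrt (pi / c)" 2 2] by simp
  also have "(\<Sum>b\<in>Basis. - (\<kappa> * inner y b)\<^sup>2 / (4 * c)) = - (\<kappa>\<^sup>2 * (norm y)\<^sup>2) / (4 * c)"
    unfolding nsq by (simp add: power_mult_distrib sum_distrib_left sum_negf sum_divide_distrib)
  finally show ?thesis .
qed

section \<open>Functions satisfying Hecke's formula\<close>

text \<open>Homogeneity includes \<open>r = 0\<close>, which forces \<open>P 0 = 0\<close> for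
  \<open>n > 0\<close> and a constant \<open>P\<close> for \<open>n = 0\<close>. The
  \<open>n\<close>-th power of \<open>\<i> * \<kappa> / (2 * c)\<close> records one integration by
  parts per linear factor.\<close>

definition hecke :: "nat \<Rightarrow> (quat \<Rightarrow> complex) \<Rightarrow> bool" where
  "hecke n P \<longleftrightarrow> continuous_on UNIV P \<and> (\<forall>r\<ge>0. \<forall>x. P (r *\<^sub>R x) = of_real (r ^ n) * P x) \<and>
     (\<forall>c>0. \<forall>\<kappa> y. (LINT x|lborel. P x * (gauss c x * osc \<kappa> y x))
        = (\<i> * of_real (\<kappa> / (2 * c))) ^ n * of_real ((pi / c)\<^sup>2 * exp (- (\<kappa>\<^sup>2 * (norm y)\<^sup>2) / (4 * c))) * P y)"

lemma homogeneous_bound: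
  fixes P :: "'a::euclidean_space \<Rightarrow> complex"
  assumes cont: "continuous_on UNIV P" and hom: "\<And>r x. r \<ge> 0 \<Longrightarrow> P (r *\<^sub>R x) = of_real (r ^ n) * P x"
  obtains C where "\<And>x. cmod (P x) \<le> C * norm x ^ n"
proof -
  have "compact (P ` sphere 0 1)"
    by (intro compact_continuous_image continuous_on_subset[OF cont]) auto
  then obtain C where C: "\<And>x. norm x = 1 \<Longrightarrow> cmod (P x) \<le> C"
    using compact_imp_bounded by (force simp: bounded_iff)
  show ?thesis
  proof
    fix x :: 'a
    obtain u :: 'a where u: "norm u = 1" "x = norm x *\<^sub>R u"
    proof (cases "x = 0")
      case True
      obtain b :: 'a where "b \<in> Basis"
        using nonempty_Basis by blast
      then show ?thesis
        using True that[of b] by simp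
    next
      case False
      then show ?thesis
        using that[of "x /\<^sub>R norm x"] by simp
    qed
    have "cmod (P x) = norm x ^ n * cmod (P u)"
      by (subst u(2), subst hom) (simp_all add: norm_mult norm_power)
    also have "\<dots> \<le> norm x ^ n * C"
      by (intro mult_left_mono C u) auto
    finally show "cmod (P x) \<le> C * norm x ^ n"
      by (simp add: mult.commute)
  qed
qed

lemma hecke_bound:
  assumes "hecke n P"
  obtains C where "\<And>x. cmod (P x) \<le> C * norm x ^ n"
  using assms homogeneous_bound[of P n] unfolding hecke_def by metis

lemma hecke_measurable: "hecke n P \<Longrightarrow> P \<in> borel_measurable borel"
  unfolding hecke_def by (auto intro: borel_measurable_continuous_onI)

lemma integrable_mult_gauss_osc:
  assumes meas: "P \<in> borel_measurable borel" and bnd: "\<And>x. cmod (P x) \<le> C * (1 + norm x) ^ n" and c: "c > 0"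
  shows "integrable lborel (\<lambda>x. P x * (gauss c x * osc \<kappa> y x))"
proof (rule integrable_of_decay)
  fix x :: quat
  have C: "C \<ge> 0"
    using bnd[of 0] order_trans[OF norm_ge_zero] by simp
  have "cmod (P x * (gauss c x * osc \<kappa> y x)) * (1 + norm x) ^ 8
      \<le> C * (1 + norm x) ^ n * exp (- c * (norm x)\<^sup>2) * (1 + norm x) ^ 8"
    unfolding norm_mult cmod_gauss cmod_osc mult_1_right by (intro mult_right_mono bnd) auto
  also have "\<dots> = C * ((1 + norm x) ^ (n + 8) * exp (- c * (norm x)\<^sup>2))"
    by (simp add: power_add mult_ac)
  also have "\<dots> \<le> C * exp ((real (n + 8))\<^sup>2 / (4 * c))"
    using C by (intro mult_left_mono gauss_bound c)
  finally show "cmod (P x * (gauss c x * osc \<kappa> y x)) * (1 + norm x) ^ 8 \<le> C * exp ((real (n + 8))\<^sup>2 / (4 * c))" .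
qed (use meas in measurable)

lemma hecke_integrable:
  assumes "hecke n P" "c > 0"
  shows "integrable lborel (\<lambda>x. P x * (gauss c x * osc \<kappa> y x))"
proof -
  obtain C where C: "\<And>x. cmod (P x) \<le> C * norm x ^ n"
    using hecke_bound[OF assms(1)] by blast
  have "cmod (P x) \<le> \<bar>C\<bar> * (1 + norm x) ^ n" for x
    by (rule order_trans[OF C]) (intro mult_mono power_mono; simp)
  then show ?thesis
    by (intro integrable_mult_gauss_osc[OF hecke_measurable[OF assms(1)]] assms(2))
qed

lemma hecke_lincomb:
  assumes "hecke n P" "hecke n Q"
  shows "hecke n (\<lambda>x. a * P x + b * Q x)"
proof -
  have "(LINT x|lborel. (a * P x + b * Q x) * (gauss c x * osc \<kappa> y x))
      = a * (LINT x|lborel. P x * (gauss c x * osc \<kappa> y x)) + b * (LINT x|lborel. Q x * (gauss c x * osc \<kappa> y x))"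
    if "c > 0" for c \<kappa> y
    using hecke_integrable[OF assms(1) that, of \<kappa> y] hecke_integrable[OF assms(2) that, of \<kappa> y]
    by (simp add: distrib_right mult.assoc)
  with assms show ?thesis
    unfolding hecke_def by (auto intro!: continuous_intros simp: algebra_simps)
qed

lemma hecke_zero: "hecke n (\<lambda>x. 0)"
  unfolding hecke_def by simp

lemma hecke_sum:
  assumes "\<And>i. i \<in> I \<Longrightarrow> hecke n (P i)"
  shows "hecke n (\<lambda>x. \<Sum>i\<in>I. c i * P i x)"
  using assms
proof (induction I rule: infinite_finite_induct)
  case (insert i I)
  then show ?case
    using hecke_lincomb[of n "P i" "\<lambda>x. \<Sum>i\<in>I. c i * P i x" "c i" 1] by simp
qed (simp_all add: hecke_zero)

text \<open>Lebesgue measure and the Gaussian are invariant under \<open>T\<close>, and the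
  frequency \<open>y\<close> simply moves to \<open>T y\<close>.\<close>

lemma hecke_orthogonal:
  assumes P: "hecke n P" and T: "orthogonal_transformation T"
  shows "hecke n (\<lambda>x. P (T x))"
proof -
  have lin: "linear T"
    using T by (rule orthogonal_transformation_linear)
  have contT: "continuous_on S T" for S
    using lin by (simp add: linear_continuous_on linear_conv_bounded_linear)
  have "(LINT x|lborel. P (T x) * (gauss c x * osc \<kappa> y x)) = (LINT x|lborel. P x * (gauss c x * osc \<kappa> (T y) x))" for c \<kappa> y
  proof -
    have "gauss c x * osc \<kappa> y x = gauss c (T x) * osc \<kappa> (T y) (T x)" for x
      using T by (simp add: gauss_def osc_def orthogonal_transformation_norm orthogonal_transformation_def)
    then show ?thesis
      using lborel_integral_orthogonal(1)[OF T, of "\<lambda>x. P x * (gauss c x * osc \<kappa> (T y) x)"] hecke_measurable[OF P]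
      by simp
  qed
  note TP = this
  have nT: "norm (T y) = norm y" for y
    using T by (simp add: orthogonal_transformation_norm)
  have P': "continuous_on UNIV P" "\<And>r x. r \<ge> 0 \<Longrightarrow> P (r *\<^sub>R x) = of_real (r ^ n) * P x"
    "\<And>c \<kappa> y. c > 0 \<Longrightarrow> (LINT x|lborel. P x * (gauss c x * osc \<kappa> y x))
      = (\<i> * of_real (\<kappa> / (2 * c))) ^ n * of_real ((pi / c)\<^sup>2 * exp (- (\<kappa>\<^sup>2 * (norm y)\<^sup>2) / (4 * c))) * P y"
    using P unfolding hecke_def by blast+
  show ?thesis
    unfolding hecke_def
  proof (intro conjI allI impI)
    show "continuous_on UNIV (\<lambda>x. P (T x))"
      by (rule continuous_on_compose2[OF P'(1) contT]) simp
  next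
    fix r :: real and x
    assume "r \<ge> 0"
    then show "P (T (r *\<^sub>R x)) = of_real (r ^ n) * P (T x)"
      unfolding linear_cmul[OF lin] by (rule P'(2))
  next
    fix c \<kappa> :: real and y
    assume "c > 0"
    from P'(3)[OF this, of \<kappa> "T y"]
    show "(LINT x|lborel. P (T x) * (gauss c x * osc \<kappa> y x))
        = (\<i> * of_real (\<kappa> / (2 * c))) ^ n * of_real ((pi / c)\<^sup>2 * exp (- (\<kappa>\<^sup>2 * (norm y)\<^sup>2) / (4 * c))) * P (T y)"
      by (simp only: TP nT)
  qed
qed

section \<open>Hecke's formula for the monomials in \<open>qa\<close> and \<open>qb\<close>\<close>

text \<open>If \<open>x = \<alpha> + \<beta> j\<close>, then \<open>qa x = \<alpha>\<close> and \<open>qb x = cnj \<beta>\<close>. With this choice left translation by a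
  quaternion acts linearly on the pair \<open>(qa, qb)\<close>.\<close>

definition qa :: "quat \<Rightarrow> complex" where "qa x = Complex (x $ 1) (x $ 2)"
definition qb :: "quat \<Rightarrow> complex" where "qb x = Complex (x $ 3) (- (x $ 4))"

lemma bounded_linear_qa: "bounded_linear qa" and bounded_linear_qb: "bounded_linear qb"
  by (auto intro!: linearI simp: qa_def qb_def complex_eq_iff linear_conv_bounded_linear[symmetric])

lemma quat_norm_sq: "(norm x)\<^sup>2 = (x $ 1)\<^sup>2 + (x $ 2)\<^sup>2 + (x $ 3)\<^sup>2 + (x $ 4)\<^sup>2" for x :: quat
  by (simp add: norm_vec_def L2_set_def sum_4)

lemma quat_norm_qa_qb: "(norm x)\<^sup>2 = (cmod (qa x))\<^sup>2 + (cmod (qb x))\<^sup>2"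
  by (simp add: quat_norm_sq qa_def qb_def cmod_power2)

lemma cmod_qa_le: "cmod (qa x) \<le> norm x" and cmod_qb_le: "cmod (qb x) \<le> norm x"
  by (rule power2_le_imp_le; simp add: quat_norm_qa_qb)+

lemma continuous_qa [continuous_intros]: "continuous_on S f \<Longrightarrow> continuous_on S (\<lambda>x. qa (f x))"
  and continuous_qb [continuous_intros]: "continuous_on S f \<Longrightarrow> continuous_on S (\<lambda>x. qb (f x))"
  using bounded_linear.continuous_on[OF bounded_linear_qa] bounded_linear.continuous_on[OF bounded_linear_qb] by auto

lemma qa_axis: "qa (axis 1 1) = 1" "qa (axis 2 1) = \<i>" "qa (axis 3 1) = 0" "qa (axis 4 1) = 0"
  and qb_axis: "qb (axis 1 1) = 0" "qb (axis 2 1) = 0" "qb (axis 3 1) = 1" "qb (axis 4 1) = - \<i>"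
  by (auto simp: qa_def qb_def axis_def complex_eq_iff)

text \<open>The integrand is the \<open>i\<close>-th partial derivative of
  \<open>P x * (gauss c x * osc \<kappa> y x)\<close>; polynomial growth of \<open>P\<close> and its
  derivative against the Gaussian gives the required decay.\<close>

lemma integral_gauss_derivative:
  assumes der: "\<And>x. (P has_derivative P' x) (at x)"
    and bndP: "\<And>x. cmod (P x) \<le> K * (1 + norm x) ^ n"
    and bndP': "\<And>x. cmod (P' x (axis i 1)) \<le> K * (1 + norm x) ^ n"
    and c: "c > 0"
  shows "integrable lborel (\<lambda>x. (P' x (axis i 1) + P x * (of_real (- 2 * c * x $ i) + \<i> * of_real (\<kappa> * y $ i))) * (gauss c x * osc \<kappa> y x))"
    (is "integrable _ ?g")
    and "(LINT x|lborel. (P' x (axis i 1) + P x * (of_real (- 2 * c * x $ i) + \<i> * of_real (\<kappa> * y $ i))) * (gauss c x * osc \<kappa> y x)) = 0"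
proof -
  let ?e = "axis i 1 :: quat"
  define g' where "g' x h = P' x h * (gauss c x * osc \<kappa> y x)
    + P x * ((of_real (- 2 * c * inner x h) + \<i> * of_real (\<kappa> * inner h y)) * (gauss c x * osc \<kappa> y x))" for x h
  have eq: "g' x ?e = ?g x" for x
    by (simp add: g'_def inner_axis inner_axis' algebra_simps)
  have gauss': "(gauss c has_derivative (\<lambda>h. of_real (- 2 * c * inner x h) * gauss c x)) (at x)" for x
  proof -
    have "((\<lambda>x::quat. exp (- c * inner x x)) has_derivative (\<lambda>h. exp (- c * inner x x) * (- c * (inner x h + inner h x)))) (at x)"
      by (auto intro!: derivative_eq_intros)
    from has_derivative_of_real[OF this] show ?thesis
      unfolding gauss_def power2_norm_eq_inner
      by (rule has_derivative_eq_rhs) (simp add: inner_commute fun_eq_iff)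
  qed
  have E': "((\<lambda>x. gauss c x * osc \<kappa> y x) has_derivative
      (\<lambda>h. (of_real (- 2 * c * inner x h) + \<i> * of_real (\<kappa> * inner h y)) * (gauss c x * osc \<kappa> y x))) (at x)" for x
    by (rule has_derivative_eq_rhs[OF has_derivative_mult[OF gauss' osc_has_derivative]])
       (simp add: fun_eq_iff algebra_simps)
  have der': "((\<lambda>x. P x * (gauss c x * osc \<kappa> y x)) has_derivative g' x) (at x)" for x
    unfolding g'_def
    by (rule has_derivative_eq_rhs[OF has_derivative_mult[OF der E']]) (simp add: fun_eq_iff)
  have cont: "continuous_on UNIV P"
    using der has_derivative_continuous by (intro continuous_at_imp_continuous_on) blast
  have K: "K \<ge> 0"
    using bndP[of 0] order_trans[OF norm_ge_zero] by simp
  define L where "L = K * (1 + (2 * c + \<bar>\<kappa> * y $ i\<bar>))"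
  have L: "L \<ge> 0"
    unfolding L_def using K c by (intro mult_nonneg_nonneg add_nonneg_nonneg) auto
  have bnd: "cmod (g' x ?e) * (1 + norm x) ^ 8 \<le> L * exp ((real (n + 1 + 8))\<^sup>2 / (4 * c))" for x
  proof -
    have "cmod (of_real (- 2 * c * x $ i) + \<i> * of_real (\<kappa> * y $ i)) \<le> 2 * c * \<bar>x $ i\<bar> + \<bar>\<kappa> * y $ i\<bar>"
      using c by (intro order_trans[OF norm_triangle_ineq]) (simp add: norm_mult abs_mult)
    also have "\<dots> \<le> 2 * c * (1 + norm x) + \<bar>\<kappa> * y $ i\<bar> * (1 + norm x)"
      using c component_le_norm_cart[of x i]
      by (intro add_mono mult_left_mono) (auto simp: mult_le_cancel_left1)
    finally have 1: "cmod (of_real (- 2 * c * x $ i) + \<i> * of_real (\<kappa> * y $ i)) \<le> (2 * c + \<bar>\<kappa> * y $ i\<bar>) * (1 + norm x)"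
      by (simp add: distrib_right)
    have "K * (1 + norm x) ^ n * 1 \<le> K * (1 + norm x) ^ n * (1 + norm x)"
      using K by (intro mult_left_mono) auto
    then have 2: "cmod (P' x ?e) \<le> K * (1 + norm x) ^ (n + 1)"
      using bndP'[of x] by (simp add: mult_ac)
    have "cmod (P' x ?e + P x * (of_real (- 2 * c * x $ i) + \<i> * of_real (\<kappa> * y $ i)))
       \<le> cmod (P' x ?e) + cmod (P x) * cmod (of_real (- 2 * c * x $ i) + \<i> * of_real (\<kappa> * y $ i))"
      by (intro order_trans[OF norm_triangle_ineq]) (simp add: norm_mult)
    also have "\<dots> \<le> K * (1 + norm x) ^ (n + 1) + (K * (1 + norm x) ^ n) * ((2 * c + \<bar>\<kappa> * y $ i\<bar>) * (1 + norm x))"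
      using K by (intro add_mono mult_mono 1 2 bndP mult_nonneg_nonneg) auto
    also have "\<dots> = L * (1 + norm x) ^ (n + 1)"
      unfolding L_def by (simp add: algebra_simps)
    finally have 3: "cmod (P' x ?e + P x * (of_real (- 2 * c * x $ i) + \<i> * of_real (\<kappa> * y $ i))) \<le> L * (1 + norm x) ^ (n + 1)" .
    have "cmod (g' x ?e) * (1 + norm x) ^ 8
       \<le> L * (1 + norm x) ^ (n + 1) * exp (- c * (norm x)\<^sup>2) * (1 + norm x) ^ 8"
      unfolding eq norm_mult[of _ "gauss c x * osc \<kappa> y x"] norm_mult[of "gauss c x"] cmod_gauss cmod_osc mult_1_right
      by (intro mult_right_mono 3) auto
    also have "\<dots> = L * ((1 + norm x) ^ (n + 1 + 8) * exp (- c * (norm x)\<^sup>2))"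
      by (simp only: power_add mult_ac)
    also have "\<dots> \<le> L * exp ((real (n + 1 + 8))\<^sup>2 / (4 * c))"
      by (intro mult_left_mono gauss_bound c L)
    finally show ?thesis .
  qed
  have i: "integrable lborel (\<lambda>x. P x * (gauss c x * osc \<kappa> y x))"
    by (rule integrable_mult_gauss_osc[OF borel_measurable_continuous_onI[OF cont] bndP c])
  show "integrable lborel ?g"
    using integrable_directional_derivative[OF der' bnd _ i] unfolding eq by simp
  show "integral\<^sup>L lborel ?g = 0"
    using integral_directional_derivative[OF der' bnd _ i] unfolding eq by simp
qed

text \<open>For two partial derivatives combined along a complex direction \<open>(1, d)\<close>:
  the first hypothesis says that this direction annihilates \<open>P\<close>, and what survives is
  multiplication by the linear form \<open>w\<close>.\<close>

lemma lincomb_factor: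
  fixes P :: complex
  assumes "p1 + d * p2 = 0" "u1 + d * u2 = w"
  shows "(p1 + P * u1) * E + d * ((p2 + P * u2) * E) = P * w * E"
proof -
  have "(p1 + P * u1) * E + d * ((p2 + P * u2) * E) = ((p1 + d * p2) + P * (u1 + d * u2)) * E"
    by (simp add: algebra_simps)
  with assms show ?thesis
    by simp
qed

lemma two_parameter_recurrence:
  fixes J :: "nat \<Rightarrow> nat \<Rightarrow> complex"
  assumes "J 0 0 = G" and a: "\<And>j k. J (Suc j) k = M * a * J j k" and b: "\<And>j k. J j (Suc k) = M * b * J j k"
  shows "J j k = M ^ (j + k) * G * (a ^ j * b ^ k)"
proof (induction j)
  case 0
  show ?case
    by (induction k) (simp_all add: assms)
next
  case (Suc j)
  then show ?case
    by (simp add: a)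
qed

lemma solve_recurrence:
  fixes X :: complex
  assumes "c \<noteq> 0" "0 = - (2 * of_real c) * X + \<i> * of_real \<kappa> * q * Y"
  shows "X = \<i> * of_real (\<kappa> / (2 * c)) * q * Y"
proof -
  have "2 * of_real c * X = \<i> * of_real \<kappa> * q * Y"
    using assms(2) by simp
  with assms(1) show ?thesis
    by (simp add: field_simps)
qed

lemma factor_out:
  fixes u :: complex
  shows "u * v * (- m * q + t) * E = - m * (q * u * v * E) + t * (u * v * E)"
    and "u * v * (- m * q + t) * E = - m * (u * (q * v) * E) + t * (u * v * E)"
  by (simp_all add: algebra_simps)

lemma leibniz_lincomb:
  fixes u :: complex
  shows "(m * (a * u) * v + u' * (n * (b * v'))) + d * (m * (a' * u) * v + u' * (n * (b' * v')))
    = m * ((a + d * a') * u) * v + u' * (n * ((b + d * b') * v'))"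
  by (simp add: algebra_simps)

text \<open>The base case is the plain Gaussian integral; each of two isotropic directions gives a
  recurrence that raises one exponent.\<close>

lemma hecke_monomial: "hecke (j + k) (\<lambda>x. qa x ^ j * qb x ^ k)"
proof -
  let ?P = "\<lambda>j k x. qa x ^ j * qb x ^ k"
  \<comment> \<open>The truncated \<open>j - 1\<close> at \<open>j = 0\<close> is harmless because
    of the factor \<open>of_nat j\<close>.\<close>
  define P' where "P' j k x h = of_nat j * (qa h * qa x ^ (j - 1)) * qb x ^ k + qa x ^ j * (of_nat k * (qb h * qb x ^ (k - 1)))"
    for j k x h
  have der: "(?P j k has_derivative P' j k x) (at x)" for j k x
    unfolding P'_def
    using bounded_linear_imp_has_derivative[OF bounded_linear_qa] bounded_linear_imp_has_derivative[OF bounded_linear_qb]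
    by (auto intro!: derivative_eq_intros simp: fun_eq_iff algebra_simps)
  have pw: "cmod (qa x) ^ j \<le> (1 + norm x) ^ j" "cmod (qb x) ^ j \<le> (1 + norm x) ^ j" for j x
    using cmod_qa_le[of x] cmod_qb_le[of x] by (auto intro!: power_mono)
  have bnd: "cmod (?P j k x) \<le> (1 + norm x) ^ (j + k)" for j k x
    unfolding norm_mult norm_power power_add by (intro mult_mono pw) auto
  have bnd': "cmod (P' j k x (axis i 1)) \<le> (real j + real k) * (1 + norm x) ^ (j + k)" for i j k x
  proof -
    have 1: "cmod (qa (axis i 1)) \<le> 1" "cmod (qb (axis i 1)) \<le> 1"
      using cmod_qa_le[of "axis i 1"] cmod_qb_le[of "axis i 1"] by auto
    have pw': "cmod (qa x) ^ (j - 1) \<le> (1 + norm x) ^ j" "cmod (qb x) ^ (j - 1) \<le> (1 + norm x) ^ j" for j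
      by (rule order_trans[OF pw(1)] order_trans[OF pw(2)]; intro power_increasing; simp)+
    have "cmod (P' j k x (axis i 1)) \<le> real j * (1 * (1 + norm x) ^ j) * (1 + norm x) ^ k
        + (1 + norm x) ^ j * (real k * (1 * (1 + norm x) ^ k))"
      unfolding P'_def by (rule order_trans[OF norm_triangle_ineq], unfold norm_mult norm_power norm_of_nat)
        (intro add_mono mult_mono pw pw' 1; simp)
    then show ?thesis
      by (simp add: power_add algebra_simps)
  qed
  have step: "(LINT x|lborel. ?P (Suc j) k x * (gauss c x * osc \<kappa> y x))
        = \<i> * of_real (\<kappa> / (2 * c)) * qa y * (LINT x|lborel. ?P j k x * (gauss c x * osc \<kappa> y x))"
    (is ?A)
    and step': "(LINT x|lborel. ?P j (Suc k) x * (gauss c x * osc \<kappa> y x))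
        = \<i> * of_real (\<kappa> / (2 * c)) * qb y * (LINT x|lborel. ?P j k x * (gauss c x * osc \<kappa> y x))"
    (is ?B)
    if c: "c > 0" for c \<kappa> y j k
  proof -
    let ?K = "1 + real j + real k"
    have K: "cmod (?P j k x) \<le> ?K * (1 + norm x) ^ (j + k)" for x
      using order_trans[OF bnd[of x j k], of "?K * (1 + norm x) ^ (j + k)"] mult_right_mono[of 1 ?K "(1 + norm x) ^ (j + k)"] by simp
    have K': "cmod (P' j k x (axis i 1)) \<le> ?K * (1 + norm x) ^ (j + k)" for i x
      by (rule order_trans[OF bnd']) (intro mult_right_mono; simp)
    let ?g = "\<lambda>i x. (P' j k x (axis i 1) + ?P j k x * (of_real (- 2 * c * x $ i) + \<i> * of_real (\<kappa> * y $ i))) * (gauss c x * osc \<kappa> y x)"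
    have g: "integrable lborel (?g i)" "integral\<^sup>L lborel (?g i) = 0" for i
      using integral_gauss_derivative[OF der K K' c, of i \<kappa> y] by auto
    have int: "integrable lborel (\<lambda>x. ?P j k x * (gauss c x * osc \<kappa> y x))" for j k
      by (rule integrable_mult_gauss_osc[where C=1 and n="j + k"])
        (use c bnd in \<open>auto intro!: borel_measurable_continuous_onI continuous_intros\<close>)
    let ?E = "\<lambda>x. gauss c x * osc \<kappa> y x"
    \<comment> \<open>The direction \<open>axis 1 1 + \<i> * axis 2 1\<close> annihilates both forms
      (on \<open>qa\<close> because \<open>1 + \<i> * \<i> = 0\<close>), while its pairing with
      \<open>x\<close> is \<open>qa x\<close>: the Gaussian supplies the new factor.\<close>
    have A: "?g 1 x + \<i> * ?g 2 x = - (2 * of_real c) * (?P (Suc j) k x * ?E x) + \<i> * of_real \<kappa> * qa y * (?P j k x * ?E x)" for x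
    proof -
      have "P' j k x (axis 1 1) + \<i> * P' j k x (axis 2 1)
        = of_nat j * ((qa (axis 1 1) + \<i> * qa (axis 2 1)) * qa x ^ (j - 1)) * qb x ^ k
          + qa x ^ j * (of_nat k * ((qb (axis 1 1) + \<i> * qb (axis 2 1)) * qb x ^ (k - 1)))"
        unfolding P'_def by (rule leibniz_lincomb)
      also have "\<dots> = 0"
        by (simp add: qa_axis qb_axis)
      finally have "P' j k x (axis 1 1) + \<i> * P' j k x (axis 2 1) = 0" .
      moreover have "(of_real (- 2 * c * x $ 1) + \<i> * of_real (\<kappa> * y $ 1)) + \<i> * (of_real (- 2 * c * x $ 2) + \<i> * of_real (\<kappa> * y $ 2))
        = - (2 * of_real c) * qa x + \<i> * of_real \<kappa> * qa y"
        by (simp add: qa_def complex_eq_iff)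
      ultimately have "?g 1 x + \<i> * ?g 2 x = ?P j k x * (- (2 * of_real c) * qa x + \<i> * of_real \<kappa> * qa y) * ?E x"
        by (rule lincomb_factor)
      then show ?thesis
        by (simp only: power_Suc factor_out(1))
    qed
    \<comment> \<open>The sign of \<open>\<i>\<close> changes because \<open>qb\<close> carries the
      fourth coordinate with a minus sign.\<close>
    have B: "?g 3 x + (- \<i>) * ?g 4 x = - (2 * of_real c) * (?P j (Suc k) x * ?E x) + \<i> * of_real \<kappa> * qb y * (?P j k x * ?E x)" for x
    proof -
      have "P' j k x (axis 3 1) + (- \<i>) * P' j k x (axis 4 1)
        = of_nat j * ((qa (axis 3 1) + (- \<i>) * qa (axis 4 1)) * qa x ^ (j - 1)) * qb x ^ k
          + qa x ^ j * (of_nat k * ((qb (axis 3 1) + (- \<i>) * qb (axis 4 1)) * qb x ^ (k - 1)))"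
        unfolding P'_def by (rule leibniz_lincomb)
      also have "\<dots> = 0"
        by (simp add: qa_axis qb_axis)
      finally have "P' j k x (axis 3 1) + (- \<i>) * P' j k x (axis 4 1) = 0" .
      moreover have "(of_real (- 2 * c * x $ 3) + \<i> * of_real (\<kappa> * y $ 3)) + (- \<i>) * (of_real (- 2 * c * x $ 4) + \<i> * of_real (\<kappa> * y $ 4))
        = - (2 * of_real c) * qb x + \<i> * of_real \<kappa> * qb y"
        by (simp add: qb_def complex_eq_iff)
      ultimately have "?g 3 x + (- \<i>) * ?g 4 x = ?P j k x * (- (2 * of_real c) * qb x + \<i> * of_real \<kappa> * qb y) * ?E x"
        by (rule lincomb_factor)
      then show ?thesis
        by (simp only: power_Suc factor_out(2))
    qed
    have "0 = (LINT x|lborel. ?g 1 x + \<i> * ?g 2 x)"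
      using g by simp
    also have "\<dots> = - (2 * of_real c) * (LINT x|lborel. ?P (Suc j) k x * ?E x) + \<i> * of_real \<kappa> * qa y * (LINT x|lborel. ?P j k x * ?E x)"
      unfolding A using int[of "Suc j" k] int[of j k] by simp
    finally show ?A
      using c by (intro solve_recurrence) auto
    have "0 = (LINT x|lborel. ?g 3 x + (- \<i>) * ?g 4 x)"
      using g by simp
    also have "\<dots> = - (2 * of_real c) * (LINT x|lborel. ?P j (Suc k) x * ?E x) + \<i> * of_real \<kappa> * qb y * (LINT x|lborel. ?P j k x * ?E x)"
      unfolding B using int[of j "Suc k"] int[of j k] by simp
    finally show ?B
      using c by (intro solve_recurrence) auto
  qed
  have "(LINT x|lborel. ?P j k x * (gauss c x * osc \<kappa> y x))
      = (\<i> * of_real (\<kappa> / (2 * c))) ^ (j + k) * of_real ((pi / c)\<^sup>2 * exp (- (\<kappa>\<^sup>2 * (norm y)\<^sup>2) / (4 * c))) * ?P j k y"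
    if c: "c > 0" for c \<kappa> y
    using step[OF c] step'[OF c]
    by (intro two_parameter_recurrence[where J="\<lambda>j k. LINT x|lborel. ?P j k x * (gauss c x * osc \<kappa> y x)"])
      (simp_all only: power_0 mult_1_left integral_gauss_osc[OF c])
  then have int: "\<forall>c>0. \<forall>\<kappa> y. (LINT x|lborel. ?P j k x * (gauss c x * osc \<kappa> y x))
      = (\<i> * of_real (\<kappa> / (2 * c))) ^ (j + k) * of_real ((pi / c)\<^sup>2 * exp (- (\<kappa>\<^sup>2 * (norm y)\<^sup>2) / (4 * c))) * ?P j k y"
    by blast
  have "continuous_on UNIV (?P j k)"
    by (intro continuous_intros)
  moreover have "?P j k (r *\<^sub>R x) = of_real (r ^ (j + k)) * ?P j k x" for r x
  proof -
    have "qa (r *\<^sub>R x) = of_real r * qa x" "qb (r *\<^sub>R x) = of_real r * qb x"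
      by (simp_all add: qa_def qb_def complex_eq_iff)
    then show ?thesis
      by (simp add: power_mult_distrib power_add mult_ac)
  qed
  ultimately show ?thesis
    unfolding hecke_def using int by blast
qed

section \<open>Haar measure on the unit quaternions\<close>

lemma qmul_nth [simp]:
  "(x \<star> y) $ 1 = x$1 * y$1 - x$2 * y$2 - x$3 * y$3 - x$4 * y$4"
  "(x \<star> y) $ 2 = x$1 * y$2 + x$2 * y$1 + x$3 * y$4 - x$4 * y$3"
  "(x \<star> y) $ 3 = x$1 * y$3 - x$2 * y$4 + x$3 * y$1 + x$4 * y$2"
  "(x \<star> y) $ 4 = x$1 * y$4 + x$2 * y$3 - x$3 * y$2 + x$4 * y$1"
  by (simp_all add: qmul_def)

lemma qconj_nth [simp]: "qconj x $ 1 = x $ 1" "qconj x $ 2 = - x $ 2" "qconj x $ 3 = - x $ 3" "qconj x $ 4 = - x $ 4"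
  by (simp_all add: qconj_def)

lemma qone_nth [simp]: "qone $ 1 = 1" "qone $ 2 = 0" "qone $ 3 = 0" "qone $ 4 = 0"
  by (simp_all add: qone_def)

lemma quat_eq_iff: "x = y \<longleftrightarrow> x$1 = y$1 \<and> x$2 = y$2 \<and> x$3 = y$3 \<and> x$4 = y$4" for x y :: quat
  by (simp add: Finite_Cartesian_Product.vec_eq_iff forall_4)

lemma qmul_assoc: "x \<star> y \<star> z = x \<star> (y \<star> z)"
  by (simp add: quat_eq_iff algebra_simps)

lemma qmul_qone [simp]: "x \<star> qone = x" "qone \<star> x = x"
  by (simp_all add: quat_eq_iff)

lemma qconj_qmul: "qconj (x \<star> y) = qconj y \<star> qconj x"
  by (simp add: quat_eq_iff algebra_simps)

lemma qconj_qconj [simp]: "qconj (qconj x) = x"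
  by (simp add: quat_eq_iff)

lemma norm_qconj [simp]: "norm (qconj x) = norm x"
proof -
  have "(norm (qconj x))\<^sup>2 = (norm x)\<^sup>2"
    by (simp add: quat_norm_sq)
  then show ?thesis by simp
qed

lemma norm_qmul: "norm (x \<star> y) = norm x * norm y"
proof -
  have "(norm (x \<star> y))\<^sup>2 = (norm x * norm y)\<^sup>2"
    unfolding power_mult_distrib quat_norm_sq qmul_nth by (simp add: power2_eq_square algebra_simps)
  then show ?thesis by simp
qed

lemma mem_G0_iff: "g \<in> G0 \<longleftrightarrow> norm g = 1"
  by (simp add: G0_def qnrm_eq_norm abs_square_eq_1)

lemma G0_closed [simp, intro]:
  "g \<in> G0 \<Longrightarrow> h \<in> G0 \<Longrightarrow> g \<star> h \<in> G0" "g \<in> G0 \<Longrightarrow> qconj g \<in> G0" "qone \<in> G0"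
proof -
  have "(norm qone)\<^sup>2 = 1"
    unfolding quat_norm_sq by simp
  then show "qone \<in> G0"
    by (simp add: G0_def qnrm_eq_norm)
qed (simp_all add: mem_G0_iff norm_qmul)

lemma qmul_qconj_G0 [simp]: "g \<in> G0 \<Longrightarrow> g \<star> qconj g = qone" "g \<in> G0 \<Longrightarrow> qconj g \<star> g = qone"
proof -
  show *: "g \<star> qconj g = qone" if "g \<in> G0" for g
    using that unfolding qmul_qconj by (simp add: G0_def)
  show "qconj g \<star> g = qone" if "g \<in> G0"
    using *[of "qconj g"] that by simp
qed

lemma qmul_cancel_G0 [simp]:
  "g \<in> G0 \<Longrightarrow> qconj g \<star> (g \<star> x) = x" "g \<in> G0 \<Longrightarrow> g \<star> (qconj g \<star> x) = x"
  by (simp_all flip: qmul_assoc)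

lemma bounded_bilinear_qmul: "bounded_bilinear (\<star>)"
proof
  show "\<exists>K. \<forall>a b. norm (a \<star> b) \<le> norm a * norm b * K"
    by (rule exI[of _ 1]) (simp add: norm_qmul)
qed (simp_all add: quat_eq_iff algebra_simps)

lemma continuous_qmul [continuous_intros]:
  "continuous_on S f \<Longrightarrow> continuous_on S g \<Longrightarrow> continuous_on S (\<lambda>x. f x \<star> g x)"
  by (rule bounded_bilinear.continuous_on[OF bounded_bilinear_qmul])

lemma bounded_linear_qconj: "bounded_linear qconj"
  by (auto intro!: linearI simp: quat_eq_iff linear_conv_bounded_linear[symmetric])

lemma continuous_qconj [continuous_intros]:
  "continuous_on S f \<Longrightarrow> continuous_on S (\<lambda>x. qconj (f x))"
  by (rule bounded_linear.continuous_on[OF bounded_linear_qconj])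

lemma orthogonal_qmul_left: "g \<in> G0 \<Longrightarrow> orthogonal_transformation (\<lambda>x. g \<star> x)"
  and orthogonal_qmul_right: "g \<in> G0 \<Longrightarrow> orthogonal_transformation (\<lambda>x. x \<star> g)"
  and orthogonal_qconj: "orthogonal_transformation qconj"
  using bounded_bilinear.bounded_linear_right[OF bounded_bilinear_qmul, of g]
    bounded_bilinear.bounded_linear_left[OF bounded_bilinear_qmul, of g] bounded_linear_qconj
  by (auto simp: orthogonal_transformation mem_G0_iff norm_qmul linear_conv_bounded_linear)

text \<open>For unit \<open>g\<close> this is the action of an SU(2) matrix on the column with
  entries \<open>qa x\<close> and \<open>qb x\<close>.\<close>

lemma qa_qmul: "qa (g \<star> x) = qa g * qa x - cnj (qb g) * qb x"
  and qb_qmul: "qb (g \<star> x) = qb g * qa x + cnj (qa g) * qb x"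
  and qa_qconj: "qa (qconj x) = cnj (qa x)"
  and qb_qconj: "qb (qconj x) = - qb x"
  and qa_qone: "qa qone = 1" and qb_qone: "qb qone = 0"
  by (simp_all add: qa_def qb_def complex_eq_iff algebra_simps)

text \<open>Unnormalised: the mass of a set is the Lebesgue volume of the cone over it in the unit
  ball, so invariance under orthogonal maps is inherited from Lebesgue measure. The origin is
  removed because \<open>sgn 0 = 0\<close> lies outside \<open>G0\<close>.\<close>

definition haar :: "quat measure" where
  "haar = distr (restrict_space lborel (ball 0 1 - {0})) (restrict_space borel G0) sgn"

lemma sgn_measurable_G0: "sgn \<in> measurable (restrict_space lborel (ball 0 1 - {0})) (restrict_space borel G0)"
proof (rule measurable_restrict_space2)
  show "sgn \<in> space (restrict_space lborel (ball 0 1 - {0})) \<rightarrow> G0"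
    by (auto simp: space_restrict_space mem_G0_iff norm_sgn)
  have "(\<lambda>x::quat. x /\<^sub>R norm x) \<in> borel_measurable lborel"
    by measurable
  then show "sgn \<in> borel_measurable (restrict_space lborel (ball (0::quat) 1 - {0}))"
    unfolding sgn_div_norm by (rule measurable_restrict_space1)
qed

lemma space_haar [simp]: "space haar = G0"
  by (simp add: haar_def space_restrict_space)

lemma sets_haar: "sets haar = sets (restrict_space borel G0)"
  by (simp add: haar_def)

interpretation haar: finite_measure haar
proof -
  have "emeasure lborel (ball (0::quat) 1 - {0}) \<noteq> \<infinity>"
    using emeasure_lborel_ball_finite[of "0::quat" 1] emeasure_mono[of "ball (0::quat) 1 - {0}" "ball 0 1" lborel]
    by (auto simp: top_unique less_top)
  then have "finite_measure (restrict_space lborel (ball (0::quat) 1 - {0}))"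
    by (intro finite_measureI) (simp add: space_restrict_space emeasure_restrict_space)
  then show "finite_measure haar"
    unfolding haar_def by (rule finite_measure.finite_measure_distr) (rule sgn_measurable_G0)
qed

lemma emeasure_haar:
  assumes "A \<in> sets haar"
  shows "{x \<in> ball 0 1 - {0}. sgn x \<in> A} \<in> sets borel"
    and "emeasure haar A = emeasure lborel {x \<in> ball 0 1 - {0}. sgn x \<in> A}"
proof -
  let ?R = "restrict_space lborel (ball (0::quat) 1 - {0})"
  have A: "A \<in> sets (restrict_space borel G0)"
    using assms by (simp add: sets_haar)
  have eq: "sgn -` A \<inter> space ?R = {x \<in> ball 0 1 - {0}. sgn x \<in> A}"
    by (auto simp: space_restrict_space)
  have "{x \<in> ball 0 1 - {0}. sgn x \<in> A} \<in> sets ?R"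
    using measurable_sets[OF sgn_measurable_G0 A] unfolding eq .
  then show "{x \<in> ball 0 1 - {0}. sgn x \<in> A} \<in> sets borel"
    by (subst (asm) sets_restrict_space_iff) auto
  show "emeasure haar A = emeasure lborel {x \<in> ball 0 1 - {0}. sgn x \<in> A}"
    unfolding haar_def
    by (subst emeasure_distr[OF sgn_measurable_G0 A], unfold eq) (auto intro!: emeasure_restrict_space)
qed

lemma haar_distr_orthogonal:
  assumes T: "orthogonal_transformation T"
  shows "distr haar haar T = haar" and "T \<in> measurable haar haar"
proof -
  have lin: "linear T"
    using T by (rule orthogonal_transformation_linear)
  have nT: "norm (T x) = norm x" for x
    using T by (simp add: orthogonal_transformation)
  have meas: "T \<in> borel_measurable borel"
    using lin by (intro borel_measurable_continuous_onI) (simp add: linear_continuous_on linear_conv_bounded_linear)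
  have "T \<in> measurable (restrict_space borel G0) (restrict_space borel G0)"
    by (rule measurable_restrict_space3[OF meas]) (auto simp: mem_G0_iff nT)
  then show T_meas: "T \<in> measurable haar haar"
    by (simp add: measurable_def sets_haar space_restrict_space)
  have sgnT: "sgn (T x) = T (sgn x)" for x
    by (simp add: sgn_div_norm nT linear_cmul[OF lin])
  show "distr haar haar T = haar"
  proof (rule measure_eqI)
    fix A assume "A \<in> sets (distr haar haar T)"
    then have A: "A \<in> sets haar" by simp
    have B: "T -` A \<inter> space haar \<in> sets haar"
      using T_meas A by (rule measurable_sets)
    have "emeasure (distr haar haar T) A = emeasure lborel {x \<in> ball 0 1 - {0}. sgn x \<in> T -` A \<inter> space haar}"
      using emeasure_haar(2)[OF B] by (simp add: emeasure_distr[OF T_meas A])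
    \<comment> \<open>\<open>sgn\<close> commutes with the linear isometry \<open>T\<close>, so the
      cone over a preimage is the preimage of the cone.\<close>
    also have "{x \<in> ball 0 1 - {0}. sgn x \<in> T -` A \<inter> space haar} = T -` {x \<in> ball 0 1 - {0}. sgn x \<in> A} \<inter> space lborel"
      using nT by (auto simp: mem_G0_iff norm_sgn sgnT) (metis norm_eq_zero)+
    also have "emeasure lborel \<dots> = emeasure (distr lborel borel T) {x \<in> ball 0 1 - {0}. sgn x \<in> A}"
      using meas emeasure_haar(1)[OF A] by (subst emeasure_distr) auto
    also have "\<dots> = emeasure haar A"
      unfolding lborel_distr_orthogonal[OF T] emeasure_haar(2)[OF A] ..
    finally show "emeasure (distr haar haar T) A = emeasure haar A" .
  qed simp
qed

lemma continuous_on_G0_measurable: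
  fixes f :: "quat \<Rightarrow> 'b::{topological_space}"
  shows "continuous_on G0 f \<Longrightarrow> f \<in> borel_measurable haar"
  using borel_measurable_continuous_on_restrict[of G0 f] measurable_cong_sets[OF sets_haar refl] by metis

lemma compact_G0: "compact G0"
proof -
  have "G0 = sphere 0 1"
    by (auto simp: mem_G0_iff)
  then show ?thesis
    using compact_sphere[of "0::quat" 1] by simp
qed

lemma haar_integrable:
  fixes f :: "quat \<Rightarrow> 'b::{banach,second_countable_topology}"
  assumes f: "continuous_on G0 f"
  shows "integrable haar f"
proof -
  have "bounded (f ` G0)"
    by (intro compact_imp_bounded compact_continuous_image f compact_G0)
  then obtain B where "\<And>g. g \<in> G0 \<Longrightarrow> norm (f g) \<le> B"
    by (auto simp: bounded_iff)
  then show ?thesis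
    by (intro haar.integrable_const_bound[where B=B] continuous_on_G0_measurable f AE_I2) simp
qed

lemma haar_integral_orthogonal:
  fixes f :: "quat \<Rightarrow> 'b::{banach,second_countable_topology}"
  assumes T: "orthogonal_transformation T" and f: "continuous_on G0 f"
  shows "(LINT g|haar. f (T g)) = (LINT g|haar. f g)"
  using integral_distr[OF haar_distr_orthogonal(2)[OF T] continuous_on_G0_measurable[OF f]]
  by (simp add: haar_distr_orthogonal(1)[OF T])

lemmas haar_left_invariant = haar_integral_orthogonal[OF orthogonal_qmul_left]
  and haar_right_invariant = haar_integral_orthogonal[OF orthogonal_qmul_right]

text \<open>If the integral vanished, the cone over the set where \<open>f\<close> is positive would
  be a null set, although it is open and contains half of \<open>h\<close>.\<close>

lemma haar_integral_pos:
  fixes f :: "quat \<Rightarrow> real"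
  assumes cont: "continuous_on G0 f" and nonneg: "\<And>g. g \<in> G0 \<Longrightarrow> f g \<ge> 0"
    and h: "h \<in> G0" "f h > 0"
  shows "(LINT g|haar. f g) > 0"
proof -
  let ?B = "ball (0::quat) 1 - {0}"
  have int: "integrable haar f"
    using cont by (rule haar_integrable)
  have "(LINT g|haar. f g) \<noteq> 0"
  proof
    assume "(LINT g|haar. f g) = 0"
    moreover have "AE g in haar. 0 \<le> f g"
      by (rule AE_I2) (simp add: nonneg)
    ultimately have "AE g in haar. f g = 0"
      using integral_nonneg_eq_0_iff_AE[OF int] by blast
    then have ae: "AE g in haar. \<not> 0 < f g"
      by eventually_elim simp
    have S: "{g \<in> space haar. 0 < f g} \<in> sets haar"
      using continuous_on_G0_measurable[OF cont] by measurable
    have "emeasure haar {g \<in> space haar. 0 < f g} = 0"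
      using ae S by (subst (asm) AE_iff_measurable[OF S]) auto
    then have 0: "emeasure lborel {x \<in> ?B. sgn x \<in> {g \<in> G0. 0 < f g}} = 0"
      using emeasure_haar(2)[OF S] by simp
    have "continuous_on ?B (\<lambda>x. f (sgn x))"
      by (rule continuous_on_compose2[OF cont]) (auto intro!: continuous_on_sgn simp: mem_G0_iff norm_sgn split: if_splits)
    then have "open ((\<lambda>x. f (sgn x)) -` {0<..} \<inter> ?B)"
      by (subst (asm) continuous_on_open_vimage) (auto simp: open_Diff)
    also have "(\<lambda>x. f (sgn x)) -` {0<..} \<inter> ?B = {x \<in> ?B. sgn x \<in> {g \<in> G0. 0 < f g}}"
      by (auto simp: mem_G0_iff norm_sgn)
    finally have op: "open {x \<in> ?B. sgn x \<in> {g \<in> G0. 0 < f g}}" .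
    have "(1/2) *\<^sub>R h \<in> {x \<in> ?B. sgn x \<in> {g \<in> G0. 0 < f g}}"
      using h by (auto simp: mem_G0_iff sgn_div_norm)
    moreover have "{x \<in> ?B. sgn x \<in> {g \<in> G0. 0 < f g}} \<in> null_sets lborel"
      using 0 op by (auto simp: null_sets_def)
    then have "negligible {x \<in> ?B. sgn x \<in> {g \<in> G0. 0 < f g}}"
      by (simp add: negligible_iff_null_sets null_sets_completionI)
    ultimately show False
      using open_not_negligible[OF op] by blast
  qed
  moreover have "(LINT g|haar. f g) \<ge> 0"
    by (intro integral_nonneg_AE AE_I2) (simp add: nonneg)
  ultimately show ?thesis by simp
qed

lemma haar_Fubini:
  fixes f :: "quat \<Rightarrow> quat \<Rightarrow> complex"
  assumes cont: "continuous_on (G0 \<times> G0) (\<lambda>(g, h). f g h)"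
  shows "(LINT g|haar. LINT h|haar. f g h) = (LINT h|haar. LINT g|haar. f g h)"
proof -
  interpret P: pair_sigma_finite haar haar ..
  have "bounded ((\<lambda>(g, h). f g h) ` (G0 \<times> G0))"
    by (intro compact_imp_bounded compact_continuous_image cont compact_Times compact_G0)
  then obtain B where B: "\<And>g h. g \<in> G0 \<Longrightarrow> h \<in> G0 \<Longrightarrow> cmod (f g h) \<le> B"
    by (fastforce simp: bounded_iff)
  have id: "(\<lambda>g. g) \<in> borel_measurable haar"
    by (rule continuous_on_G0_measurable) (rule continuous_on_id)
  \<comment> \<open>Continuity gives measurability for the Borel structure of the product space; the
    identity map carries it over to the product of the two measures.\<close>
  have "(\<lambda>p. (fst p, snd p)) \<in> borel_measurable (haar \<Otimes>\<^sub>M haar)"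
    by (intro borel_measurable_Pair measurable_compose[OF measurable_fst id] measurable_compose[OF measurable_snd id])
  then have "(\<lambda>p. p) \<in> measurable (haar \<Otimes>\<^sub>M haar) (restrict_space borel (G0 \<times> G0))"
    by (intro measurable_restrict_space2) (auto simp: space_pair_measure)
  from measurable_compose[OF this borel_measurable_continuous_on_restrict[OF cont]]
  have "(\<lambda>(g, h). f g h) \<in> borel_measurable (haar \<Otimes>\<^sub>M haar)" .
  moreover have "finite_measure (haar \<Otimes>\<^sub>M haar)"
    by (rule finite_measure_pair_measure) unfold_locales
  ultimately have "integrable (haar \<Otimes>\<^sub>M haar) (\<lambda>(g, h). f g h)"
    by (intro finite_measure.integrable_const_bound[where B=B] AE_I2) (auto simp: space_pair_measure B)
  from P.Fubini_integral[OF this] show ?thesis by simp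
qed

section \<open>Irreducible representations of the unit quaternions\<close>

definition qtorus :: "real \<Rightarrow> quat" where
  "qtorus u = vector [u, sqrt (1 - u\<^sup>2), 0, 0]"

text \<open>For unit \<open>k\<close> this is the second coordinate of
  \<open>k \<star> i \<star> qconj k\<close>, where \<open>i\<close> is the second basis
  quaternion.\<close>

definition qpm :: "quat \<Rightarrow> real" where
  "qpm k = (k $ 1)\<^sup>2 + (k $ 2)\<^sup>2 - (k $ 3)\<^sup>2 - (k $ 4)\<^sup>2"

lemma mem_G0_sq: "g \<in> G0 \<longleftrightarrow> (g $ 1)\<^sup>2 + (g $ 2)\<^sup>2 + (g $ 3)\<^sup>2 + (g $ 4)\<^sup>2 = 1"
  using quat_norm_sq[of g] by (simp add: mem_G0_iff) (metis norm_ge_zero one_power2 power2_eq_iff_nonneg zero_le_one)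

lemma G0_real_part_le: "g \<in> G0 \<Longrightarrow> \<bar>g $ 1\<bar> \<le> 1"
  using component_le_norm_cart[of g 1] by (simp add: mem_G0_iff)

lemma qtorus_in_G0: "\<bar>u\<bar> \<le> 1 \<Longrightarrow> qtorus u \<in> G0"
  by (simp add: mem_G0_sq qtorus_def abs_square_le_1)

text \<open>Let \<open>v\<close> be the imaginary part of \<open>g\<close> and \<open>r\<close> its
  length. Both \<open>v\<close> and \<open>r * i\<close> have square \<open>- r^2\<close>, so
  \<open>k = v + r * i\<close> satisfies \<open>k \<star> v = (r * i) \<star> k\<close>, and it only
  remains to normalise \<open>k\<close>.\<close>

lemma conjugate_to_qtorus:
  assumes g: "g \<in> G0"
  obtains k where "k \<in> G0" "g = qconj k \<star> qtorus (g $ 1) \<star> k"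
proof -
  define r where "r = sqrt (1 - (g $ 1)\<^sup>2)"
  have "1 - (g $ 1)\<^sup>2 = (g $ 2)\<^sup>2 + (g $ 3)\<^sup>2 + (g $ 4)\<^sup>2"
    using g by (simp add: mem_G0_sq)
  then have r: "r\<^sup>2 = (g $ 2)\<^sup>2 + (g $ 3)\<^sup>2 + (g $ 4)\<^sup>2"
    by (simp add: r_def)
  have qt: "qtorus (g $ 1) = vector [g $ 1, r, 0, 0]"
    by (simp add: qtorus_def r_def)
  have "\<exists>k. k \<noteq> 0 \<and> k \<star> g = qtorus (g $ 1) \<star> k"
  proof (cases "g $ 2 = - r")
    \<comment> \<open>Here \<open>v = - r * i\<close> and the general witness is zero; the third
      basis quaternion anticommutes with \<open>i\<close> and flips the sign instead.\<close>
    case True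
    then have "(g $ 3)\<^sup>2 + (g $ 4)\<^sup>2 = 0"
      using r by simp
    then have z: "g $ 3 = 0" "g $ 4 = 0"
      by (auto simp: sum_power2_eq_zero_iff)
    show ?thesis
    proof (intro exI conjI)
      show "vector [0, 0, 1, 0] \<noteq> (0 :: quat)"
        by (simp add: quat_eq_iff)
      show "vector [0, 0, 1, 0] \<star> g = qtorus (g $ 1) \<star> vector [0, 0, 1, 0]"
        using True z by (simp add: quat_eq_iff qt)
    qed
  next
    case False
    show ?thesis
    proof (intro exI conjI)
      show "vector [0, g $ 2 + r, g $ 3, g $ 4] \<noteq> (0 :: quat)"
        using False by (simp add: quat_eq_iff)
      show "vector [0, g $ 2 + r, g $ 3, g $ 4] \<star> g = qtorus (g $ 1) \<star> vector [0, g $ 2 + r, g $ 3, g $ 4]"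
        using r by (simp add: quat_eq_iff qt power2_eq_square algebra_simps)
    qed
  qed
  then obtain k where k: "k \<noteq> 0" "k \<star> g = qtorus (g $ 1) \<star> k"
    by blast
  define k' where "k' = k /\<^sub>R norm k"
  have k': "k' \<in> G0" "k' \<star> g = qtorus (g $ 1) \<star> k'"
    using k by (simp_all add: k'_def mem_G0_iff bounded_bilinear.scaleR_left[OF bounded_bilinear_qmul]
        bounded_bilinear.scaleR_right[OF bounded_bilinear_qmul])
  show ?thesis
  proof (rule that[OF k'(1)])
    have "g = qconj k' \<star> (k' \<star> g)"
      using k'(1) by simp
    then show "g = qconj k' \<star> qtorus (g $ 1) \<star> k'"
      unfolding k'(2) by (simp add: qmul_assoc)
  qed
qed

lemma qa_conjugate_qtorus:
  assumes "k \<in> G0"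
  shows "qa (k \<star> qtorus u \<star> qconj k) = Complex u (sqrt (1 - u\<^sup>2) * qpm k)"
proof -
  have "(k $ 1)\<^sup>2 + (k $ 2)\<^sup>2 + (k $ 3)\<^sup>2 + (k $ 4)\<^sup>2 = 1"
    using assms by (simp add: mem_G0_sq)
  then have "u * ((k $ 1)\<^sup>2 + (k $ 2)\<^sup>2 + (k $ 3)\<^sup>2 + (k $ 4)\<^sup>2) = u"
    by simp
  then show ?thesis
    by (simp add: qa_def qtorus_def qpm_def complex_eq_iff power2_eq_square algebra_simps)
qed

lemma continuous_qpm [continuous_intros]: "continuous_on S qpm"
  unfolding qpm_def by (intro continuous_intros)

text \<open>Right multiplication by the third basis quaternion changes the sign of
  \<open>qpm\<close>.\<close>

lemma qpm_moment_odd: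
  assumes "odd j"
  shows "(LINT k|haar. qpm k ^ j) = 0"
proof -
  let ?J = "vector [0, 0, 1, 0] :: quat"
  have J: "?J \<in> G0"
    by (simp add: mem_G0_sq)
  have "(LINT k|haar. qpm k ^ j) = (LINT k|haar. qpm (k \<star> ?J) ^ j)"
    by (rule haar_right_invariant[OF J, symmetric]) (intro continuous_intros)
  also have "(\<lambda>k. qpm (k \<star> ?J) ^ j) = (\<lambda>k. - (qpm k ^ j))"
  proof
    fix k
    have "qpm (k \<star> ?J) = - qpm k"
      by (simp add: qpm_def)
    then show "qpm (k \<star> ?J) ^ j = - (qpm k ^ j)"
      using assms by simp
  qed
  finally show ?thesis by simp
qed

lemma qpm_moment_even: "even j \<Longrightarrow> (LINT k|haar. qpm k ^ j) \<ge> 0"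
  by (intro integral_nonneg_AE AE_I2) (rule zero_le_even_power)

lemma qpm_moment_0: "(LINT k|haar. qpm k ^ 0) > 0"
  by (rule haar_integral_pos[of _ qone]) (auto intro!: continuous_intros)

text \<open>The binomial expansion of \<open>(u - \<i> * s * qpm k) ^ n\<close> averaged over
  \<open>k\<close>, where \<open>s^2 = 1 - u^2\<close>: odd moments vanish, and
  \<open>[:1, 0, -1:]\<close> stands for \<open>1 - u^2\<close>.\<close>

definition zonal_poly :: "nat \<Rightarrow> complex poly" where
  "zonal_poly n = (\<Sum>j\<le>n. if even j then
     Polynomial.smult (of_nat (n choose j) * (-1) ^ (j div 2) * of_real (LINT k|haar. qpm k ^ j))
       (monom 1 (n - j) * [:1, 0, -1:] ^ (j div 2)) else 0)"

lemma degree_zonal_poly: "degree (zonal_poly n) \<le> n"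
  unfolding zonal_poly_def
proof (rule degree_sum_le)
  fix j assume "j \<in> {..n}"
  then have j: "j \<le> n" by simp
  have "degree (monom (1::complex) (n - j) * [:1, 0, -1:] ^ (j div 2)) \<le> n" if "even j"
  proof -
    have "degree (monom (1::complex) (n - j) * [:1, 0, -1:] ^ (j div 2))
        \<le> degree (monom (1::complex) (n - j)) + degree ([:1, 0, -1:] ^ (j div 2) :: complex poly)"
      by (rule degree_mult_le)
    also have "\<dots> \<le> (n - j) + 2 * (j div 2)"
      using degree_power_le[of "[:1, 0, -1:] :: complex poly" "j div 2"]
      by (intro add_mono degree_monom_le) auto
    finally show ?thesis
      using j that by simp
  qed
  then show "degree (if even j then
     Polynomial.smult (of_nat (n choose j) * (-1) ^ (j div 2) * of_real (LINT k|haar. qpm k ^ j))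
       (monom 1 (n - j) * [:1, 0, -1::complex:] ^ (j div 2)) else 0) \<le> n"
    using degree_smult_le order_trans by auto
qed simp

text \<open>The sign \<open>(-1) ^ (j div 2)\<close> cancels against the leading coefficient of
  \<open>(1 - u^2) ^ (j div 2)\<close>. The top coefficient is thus a sum of nonnegative even
  moments, and its term \<open>j = 0\<close> is the positive total mass.\<close>

lemma coeff_zonal_poly: "coeff (zonal_poly n) n \<noteq> 0"
proof -
  have c: "coeff (monom (1::complex) (n - j) * [:1, 0, -1:] ^ (j div 2)) n = (-1) ^ (j div 2)"
    if "j \<le> n" "even j" for j
  proof -
    have "coeff ([:1, 0, -1:] ^ (j div 2) :: complex poly) (2 * (j div 2)) = (-1) ^ (j div 2)"
    proof -
      have "degree ([:1, 0, -1:] ^ (j div 2) :: complex poly) = 2 * (j div 2)"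
        by (subst degree_power_eq) auto
      then show ?thesis
        using lead_coeff_power[of "[:1, 0, -1:] :: complex poly" "j div 2"] by simp
    qed
    with that show ?thesis
      by (simp add: coeff_monom_mult)
  qed
  define t where "t j = (if even j then real (n choose j) * (LINT k|haar. qpm k ^ j) else 0)" for j
  have "coeff (zonal_poly n) n = (\<Sum>j\<le>n. of_real (t j))"
    unfolding zonal_poly_def coeff_sum
  proof (rule sum.cong[OF refl])
    fix j assume "j \<in> {..n}"
    then show "coeff (if even j then
       Polynomial.smult (of_nat (n choose j) * (-1) ^ (j div 2) * of_real (LINT k|haar. qpm k ^ j))
         (monom 1 (n - j) * [:1, 0, -1::complex:] ^ (j div 2)) else 0) n = of_real (t j)"
      by (simp add: t_def c power_mult_distrib[symmetric] mult.assoc mult.left_commute)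
  qed
  moreover have "(\<Sum>j\<le>n. t j) > 0"
  proof (rule sum_pos2[where i=0])
    show "0 < t 0"
      using qpm_moment_0 by (simp add: t_def)
    show "0 \<le> t j" for j
      using qpm_moment_even by (simp add: t_def)
  qed auto
  ultimately show ?thesis
    by (metis less_irrefl of_real_eq_0_iff of_real_sum)
qed

text \<open>Right invariance absorbs the conjugator of \<open>g\<close> and leaves the torus element
  with the same real part, where the integrand is a power of a binomial in
  \<open>qpm k\<close>.\<close>

lemma integral_conjugate_qa:
  assumes g: "g \<in> G0"
  shows "(LINT k|haar. cnj (qa (k \<star> g \<star> qconj k)) ^ n) = poly (zonal_poly n) (of_real (g $ 1))"
proof -
  define u where "u = g $ 1"
  define s where "s = sqrt (1 - u\<^sup>2)"
  have u: "\<bar>u\<bar> \<le> 1"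
    using g unfolding u_def by (rule G0_real_part_le)
  then have s2: "s\<^sup>2 = 1 - u\<^sup>2"
    by (simp add: s_def abs_square_le_1)
  obtain k0 where k0: "k0 \<in> G0" "g = qconj k0 \<star> qtorus u \<star> k0"
    using conjugate_to_qtorus[OF g] unfolding u_def by metis
  have "(LINT k|haar. cnj (qa (k \<star> g \<star> qconj k)) ^ n)
      = (LINT k|haar. cnj (qa ((k \<star> qconj k0) \<star> qtorus u \<star> qconj (k \<star> qconj k0))) ^ n)"
    by (simp add: k0(2) qconj_qmul qmul_assoc)
  also have "\<dots> = (LINT k|haar. cnj (qa (k \<star> qtorus u \<star> qconj k)) ^ n)"
    using k0(1) by (intro haar_right_invariant continuous_intros) auto
  also have "\<dots> = (LINT k|haar. (\<Sum>j\<le>n. of_nat (n choose j) * (- \<i> * of_real (s * qpm k)) ^ j * of_real u ^ (n - j)))"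
  proof (rule Bochner_Integration.integral_cong[OF refl])
    fix k assume "k \<in> space haar"
    then have "cnj (qa (k \<star> qtorus u \<star> qconj k)) = - \<i> * of_real (s * qpm k) + of_real u"
      by (simp add: qa_conjugate_qtorus s_def complex_eq_iff)
    then show "cnj (qa (k \<star> qtorus u \<star> qconj k)) ^ n = (\<Sum>j\<le>n. of_nat (n choose j) * (- \<i> * of_real (s * qpm k)) ^ j * of_real u ^ (n - j))"
      by (simp only: binomial_ring)
  qed
  also have "\<dots> = (\<Sum>j\<le>n. LINT k|haar. of_nat (n choose j) * (- \<i> * of_real (s * qpm k)) ^ j * of_real u ^ (n - j))"
    by (intro Bochner_Integration.integral_sum haar_integrable continuous_intros)
  also have "\<dots> = (\<Sum>j\<le>n. of_nat (n choose j) * (- \<i> * of_real s) ^ j * of_real u ^ (n - j) * of_real (LINT k|haar. qpm k ^ j))"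
  proof (rule sum.cong[OF refl])
    fix j
    have "(\<lambda>k. of_nat (n choose j) * (- \<i> * of_real (s * qpm k)) ^ j * of_real u ^ (n - j))
      = (\<lambda>k. (of_nat (n choose j) * (- \<i> * of_real s) ^ j * of_real u ^ (n - j)) * of_real (qpm k ^ j))"
    proof
      fix k
      have "(- \<i> * of_real (s * qpm k)) ^ j = ((- \<i> * of_real s) * of_real (qpm k)) ^ j"
        by (simp add: mult.assoc)
      also have "\<dots> = (- \<i> * of_real s) ^ j * of_real (qpm k ^ j)"
        by (simp only: power_mult_distrib of_real_power)
      finally show "of_nat (n choose j) * (- \<i> * of_real (s * qpm k)) ^ j * of_real u ^ (n - j)
        = (of_nat (n choose j) * (- \<i> * of_real s) ^ j * of_real u ^ (n - j)) * of_real (qpm k ^ j)"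
        by (simp only: mult_ac)
    qed
    then show "(LINT k|haar. of_nat (n choose j) * (- \<i> * of_real (s * qpm k)) ^ j * of_real u ^ (n - j))
      = of_nat (n choose j) * (- \<i> * of_real s) ^ j * of_real u ^ (n - j) * of_real (LINT k|haar. qpm k ^ j)"
      by (simp only: integral_mult_right_zero integral_complex_of_real)
  qed
  also have "\<dots> = poly (zonal_poly n) (of_real u)"
    unfolding zonal_poly_def poly_sum
  proof (rule sum.cong[OF refl])
    fix j assume "j \<in> {..n}"
    show "of_nat (n choose j) * (- \<i> * of_real s) ^ j * of_real u ^ (n - j) * of_real (LINT k|haar. qpm k ^ j)
      = poly (if even j then
       Polynomial.smult (of_nat (n choose j) * (-1) ^ (j div 2) * of_real (LINT k|haar. qpm k ^ j))
         (monom 1 (n - j) * [:1, 0, -1:] ^ (j div 2)) else 0) (of_real u)"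
    proof (cases "even j")
      case True
      then obtain l where l: "j = 2 * l" by (elim evenE)
      have "(- \<i> * of_real s) ^ j = ((- \<i> * of_real s)\<^sup>2) ^ l"
        by (simp add: l power_mult)
      also have "(- \<i> * of_real s)\<^sup>2 = - of_real (s\<^sup>2)"
        by (simp add: power_mult_distrib)
      also have "\<dots> = (-1) * (1 - (of_real u)\<^sup>2)"
        by (simp add: s2)
      also have "\<dots> ^ l = (-1) ^ l * (1 - (of_real u)\<^sup>2) ^ l"
        by (rule power_mult_distrib)
      finally show ?thesis
        by (simp add: l poly_monom power2_eq_square mult_ac)
    qed (simp add: qpm_moment_odd)
  qed
  finally show ?thesis
    by (simp add: u_def)
qed

text \<open>Averaging \<open>cnj (qa g) ^ n\<close> over conjugacy classes gives a polynomial of degree exactly \<open>n\<close> in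
  the real part of \<open>g\<close>, so these functions detect every continuous class function.\<close>

lemma class_function_detected:
  fixes \<theta> :: "quat \<Rightarrow> complex"
  assumes cont: "continuous_on G0 \<theta>"
    and cls: "\<And>g k. g \<in> G0 \<Longrightarrow> k \<in> G0 \<Longrightarrow> \<theta> (k \<star> g \<star> qconj k) = \<theta> g"
    and nz: "\<theta> qone \<noteq> 0"
  shows "\<exists>n. (LINT g|haar. cnj (qa g) ^ n * \<theta> g) \<noteq> 0"
proof (rule ccontr)
  assume "\<nexists>n. (LINT g|haar. cnj (qa g) ^ n * \<theta> g) \<noteq> 0"
  then have zero: "(LINT g|haar. cnj (qa g) ^ n * \<theta> g) = 0" for n
    by blast
  \<comment> \<open>After Fubini, invariance of \<open>\<theta>\<close> and of the measure under
    conjugation by \<open>k\<close> reduces each inner integral to one that vanishes by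
    assumption.\<close>
  have Z: "(LINT g|haar. \<theta> g * poly (zonal_poly n) (of_real (g $ 1))) = 0" for n
  proof -
    have "(LINT g|haar. \<theta> g * poly (zonal_poly n) (of_real (g $ 1)))
        = (LINT g|haar. LINT k|haar. cnj (qa (k \<star> g \<star> qconj k)) ^ n * \<theta> g)"
      by (intro Bochner_Integration.integral_cong[OF refl])
        (subst integral_mult_left_zero, simp add: integral_conjugate_qa mult.commute)
    also have "\<dots> = (LINT k|haar. LINT g|haar. cnj (qa (k \<star> g \<star> qconj k)) ^ n * \<theta> g)"
    proof (rule haar_Fubini)
      have "continuous_on (G0 \<times> G0) (\<lambda>x. \<theta> (fst x))"
        by (rule continuous_on_compose2[OF cont]) (auto intro!: continuous_intros)
      then show "continuous_on (G0 \<times> G0) (\<lambda>(g, k). cnj (qa (k \<star> g \<star> qconj k)) ^ n * \<theta> g)"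
        unfolding case_prod_beta by (intro continuous_intros)
    qed
    also have "\<dots> = (LINT k|haar. (0::complex))"
    proof (rule Bochner_Integration.integral_cong[OF refl])
      fix k assume "k \<in> space haar"
      then have k: "k \<in> G0" "qconj k \<in> G0" by auto
      let ?f = "\<lambda>g. cnj (qa g) ^ n * \<theta> g"
      have cf: "continuous_on G0 ?f"
        by (intro continuous_intros cont)
      have "(LINT g|haar. cnj (qa (k \<star> g \<star> qconj k)) ^ n * \<theta> g) = (LINT g|haar. ?f (k \<star> g \<star> qconj k))"
        by (intro Bochner_Integration.integral_cong[OF refl]) (simp add: cls k)
      also have "\<dots> = (LINT g|haar. ?f (g \<star> qconj k))"
        by (rule haar_left_invariant[OF k(1), of "\<lambda>g. ?f (g \<star> qconj k)"])
          (intro continuous_on_compose2[OF cf] continuous_intros; use k in auto)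
      also have "\<dots> = (LINT g|haar. ?f g)"
        by (rule haar_right_invariant[OF k(2) cf])
      finally show "(LINT g|haar. cnj (qa (k \<star> g \<star> qconj k)) ^ n * \<theta> g) = 0"
        by (simp add: zero)
    qed
    finally show ?thesis by simp
  qed
  have int: "integrable haar (\<lambda>g. \<theta> g * of_real (g $ 1) ^ i)" for i
    by (intro haar_integrable continuous_intros cont)
  \<comment> \<open>The zonal polynomials have exact degree \<open>n\<close>, so the system for the
    moments is triangular.\<close>
  have M: "(LINT g|haar. \<theta> g * of_real (g $ 1) ^ n) = 0" for n
  proof (induction n rule: less_induct)
    case (less n)
    have "poly (zonal_poly n) x = (\<Sum>i\<le>n. coeff (zonal_poly n) i * x ^ i)" for x
      unfolding poly_altdef using degree_zonal_poly[of n]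
      by (intro sum.mono_neutral_left) (auto simp: coeff_eq_0)
    then have "(LINT g|haar. \<theta> g * poly (zonal_poly n) (of_real (g $ 1)))
       = (LINT g|haar. (\<Sum>i\<le>n. coeff (zonal_poly n) i * (\<theta> g * of_real (g $ 1) ^ i)))"
      by (simp add: sum_distrib_left mult_ac)
    also have "\<dots> = (\<Sum>i\<le>n. coeff (zonal_poly n) i * (LINT g|haar. \<theta> g * of_real (g $ 1) ^ i))"
      by (subst Bochner_Integration.integral_sum) (auto intro!: integrable_mult_right int)
    also have "\<dots> = (\<Sum>i\<in>{n}. coeff (zonal_poly n) i * (LINT g|haar. \<theta> g * of_real (g $ 1) ^ i))"
      by (rule sum.mono_neutral_right) (auto simp: less)
    finally show ?case
      using Z[of n] coeff_zonal_poly[of n] by simp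
  qed
  \<comment> \<open>A class function depends on the real part alone, which makes Weierstrass
    approximation in one variable applicable.\<close>
  have \<theta>_torus: "\<theta> g = \<theta> (qtorus (g $ 1))" if g: "g \<in> G0" for g
  proof -
    obtain k where k: "k \<in> G0" "g = qconj k \<star> qtorus (g $ 1) \<star> k"
      using conjugate_to_qtorus[OF g] by metis
    have "\<theta> (qconj k \<star> qtorus (g $ 1) \<star> qconj (qconj k)) = \<theta> (qtorus (g $ 1))"
      using k(1) qtorus_in_G0 G0_real_part_le g by (intro cls) auto
    with k(2) show ?thesis by simp
  qed
  have pos: "(LINT g|haar. (cmod (\<theta> g))\<^sup>2) > 0"
    by (rule haar_integral_pos[of _ qone]) (use nz in \<open>auto intro!: continuous_intros cont\<close>)
  define S where "S = (LINT g|haar. cmod (\<theta> g))"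
  have S: "S \<ge> 0"
    unfolding S_def by (intro integral_nonneg_AE AE_I2) simp
  \<comment> \<open>Makes the final bound \<open>e * (S + 1)\<close> equal to half of the squared
    norm, which is the contradiction; the \<open>+ 1\<close> keeps the denominator positive.\<close>
  define e where "e = (LINT g|haar. (cmod (\<theta> g))\<^sup>2) / (S + 1) / 2"
  have e: "e > 0"
    using pos S by (simp add: e_def)
  have contu: "continuous_on {-1..1} (\<lambda>u. cnj (\<theta> (qtorus u)))"
  proof -
    have "qtorus = (\<lambda>u. u *\<^sub>R axis 1 1 + sqrt (1 - u\<^sup>2) *\<^sub>R axis 2 1)"
      by (simp add: qtorus_def quat_eq_iff axis_def fun_eq_iff)
    moreover have "continuous_on {-1..1} (\<lambda>u::real. u *\<^sub>R axis 1 1 + sqrt (1 - u\<^sup>2) *\<^sub>R axis 2 1 :: quat)"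
      by (intro continuous_intros)
    ultimately have "continuous_on {-1..1} qtorus"
      by metis
    then show ?thesis
      by (intro continuous_intros continuous_on_compose2[OF cont]) (auto intro!: qtorus_in_G0)
  qed
  obtain q where q: "polynomial_function q" "\<And>u. u \<in> {-1..1} \<Longrightarrow> cmod (cnj (\<theta> (qtorus u)) - q u) < e"
    using Stone_Weierstrass_polynomial_function[OF _ contu e] by auto
  have "real_polynomial_function (Re \<circ> q)" "real_polynomial_function (Im \<circ> q)"
    using q(1) bounded_linear_Re bounded_linear_Im unfolding polynomial_function_def by blast+
  then obtain a n b m where "Re \<circ> q = (\<lambda>x. \<Sum>i\<le>n. a i * x ^ i)" "Im \<circ> q = (\<lambda>x. \<Sum>i\<le>m. b i * x ^ i)"
    unfolding real_polynomial_function_iff_sum by metis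
  then have q_eq: "q x = (\<Sum>i\<le>n. of_real (a i) * of_real x ^ i) + \<i> * (\<Sum>i\<le>m. of_real (b i) * of_real x ^ i)" for x
    by (simp add: complex_eq_iff fun_eq_iff)
  have "\<theta> g * q (g $ 1) = (\<Sum>i\<le>n. of_real (a i) * (\<theta> g * of_real (g $ 1) ^ i))
       + \<i> * (\<Sum>i\<le>m. of_real (b i) * (\<theta> g * of_real (g $ 1) ^ i))" for g
    unfolding q_eq by (simp add: distrib_left sum_distrib_left mult_ac)
  then have q0: "(LINT g|haar. \<theta> g * q (g $ 1)) = 0" "integrable haar (\<lambda>g. \<theta> g * q (g $ 1))"
    using int M by (simp_all add: Bochner_Integration.integral_sum)
  have i2: "integrable haar (\<lambda>g. \<theta> g * cnj (\<theta> g))"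
    by (intro haar_integrable continuous_intros cont)
  have "complex_of_real (LINT g|haar. (cmod (\<theta> g))\<^sup>2) = (LINT g|haar. \<theta> g * cnj (\<theta> g))"
    by (simp only: complex_norm_square integral_complex_of_real[symmetric])
  also have "\<dots> = (LINT g|haar. \<theta> g * cnj (\<theta> g) - \<theta> g * q (g $ 1))"
    using q0 i2 by simp
  finally have "(LINT g|haar. (cmod (\<theta> g))\<^sup>2) = cmod (LINT g|haar. \<theta> g * cnj (\<theta> g) - \<theta> g * q (g $ 1))"
    using pos norm_of_real[where 'a=complex, of "LINT g|haar. (cmod (\<theta> g))\<^sup>2"] by simp
  also have "\<dots> \<le> (LINT g|haar. e * cmod (\<theta> g))"
  proof (rule Bochner_Integration.integral_norm_bound_integral)
    fix g assume "g \<in> space haar"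
    then have g: "g \<in> G0" by simp
    then have "g $ 1 \<in> {-1..1}"
      using G0_real_part_le[OF g] by auto
    then have "cmod (cnj (\<theta> g) - q (g $ 1)) \<le> e"
      using q(2)[of "g $ 1"] \<theta>_torus[OF g] by simp
    from mult_left_mono[OF this norm_ge_zero[of "\<theta> g"]]
    show "cmod (\<theta> g * cnj (\<theta> g) - \<theta> g * q (g $ 1)) \<le> e * cmod (\<theta> g)"
      by (simp add: norm_mult mult.commute[of e] flip: right_diff_distrib)
  qed (use i2 q0 in \<open>auto intro!: haar_integrable continuous_intros cont\<close>)
  also have "\<dots> = e * S"
    by (simp add: S_def)
  also have "\<dots> \<le> e * (S + 1)"
    using e by simp
  also have "\<dots> = (LINT g|haar. (cmod (\<theta> g))\<^sup>2) / 2"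
  proof -
    have "a / t / 2 * t = a / 2" if "t \<noteq> 0" for a t :: real
      using that by simp
    moreover have "S + 1 \<noteq> 0"
      using S by simp
    ultimately show ?thesis
      unfolding e_def by blast
  qed
  also have "\<dots> < (LINT g|haar. (cmod (\<theta> g))\<^sup>2)"
    using pos by simp
  finally show False by simp
qed

section \<open>Polynomials in \<open>qa\<close> and \<open>qb\<close> under left translation\<close>

definition qmonom :: "nat \<Rightarrow> nat \<Rightarrow> quat \<Rightarrow> complex" where
  "qmonom n j x = qa x ^ j * qb x ^ (n - j)"

lemma hecke_qmonom: "j \<le> n \<Longrightarrow> hecke n (qmonom n j)"
  using hecke_monomial[of j "n - j"] by (simp add: qmonom_def[abs_def])

text \<open>Unit quaternions with \<open>qa h = r * t\<close> and \<open>qb h = r\<close>, for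
  arbitrary complex \<open>t\<close>, turn the relation into a polynomial identity in
  \<open>t\<close>.\<close>

lemma qmonom_independent:
  assumes zero: "\<And>h. h \<in> G0 \<Longrightarrow> (\<Sum>j\<le>n. c j * qmonom n j h) = 0" and j: "j \<le> n"
  shows "c j = 0"
proof -
  have "(\<Sum>j\<le>n. c j * t ^ j) = 0" for t
  proof -
    define r where "r = 1 / sqrt (1 + (cmod t)\<^sup>2)"
    have pos: "1 + (cmod t)\<^sup>2 > 0"
      by (simp add: add_pos_nonneg)
    then have r: "r > 0" "r\<^sup>2 * (1 + (cmod t)\<^sup>2) = 1"
      by (simp_all add: r_def power_divide)
    define h :: quat where "h = r *\<^sub>R vector [Re t, Im t, 1, 0]"
    have qa: "qa h = of_real r * t" and qb: "qb h = of_real r"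
      by (simp_all add: qa_def qb_def h_def complex_eq_iff)
    have "(norm h)\<^sup>2 = 1"
      unfolding quat_norm_qa_qb qa qb using r by (simp add: norm_mult power_mult_distrib algebra_simps)
    then have h: "h \<in> G0"
      by (simp add: mem_G0_iff abs_square_eq_1)
    have "(\<Sum>j\<le>n. c j * qmonom n j h) = (\<Sum>j\<le>n. of_real r ^ n * (c j * t ^ j))"
    proof (rule sum.cong[OF refl])
      fix j assume "j \<in> {..n}"
      then have "(of_real r :: complex) ^ n = of_real r ^ j * of_real r ^ (n - j)"
        by (simp flip: power_add)
      then show "c j * qmonom n j h = of_real r ^ n * (c j * t ^ j)"
        by (simp add: qmonom_def qa qb power_mult_distrib)
    qed
    with zero[OF h] have "of_real r ^ n * (\<Sum>j\<le>n. c j * t ^ j) = 0"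
      by (simp add: sum_distrib_left)
    then show ?thesis
      using r(1) by simp
  qed
  then show ?thesis
    using polyfun_eq_0[of c n] j by blast
qed

text \<open>A geometric sum: the bounds give \<open>\<bar>l - j\<bar> < Suc n\<close>, so the ratio
  equals 1 only for \<open>l = j\<close>.\<close>

lemma sum_roots_of_unity:
  assumes "l \<le> n" "j \<le> n"
  shows "(\<Sum>k<Suc n. cis (2 * pi * (real l - real j) / real (Suc n)) ^ k) = (if l = j then of_nat (Suc n) else 0)"
proof (cases "l = j")
  case False
  let ?x = "2 * pi * (real l - real j) / real (Suc n)"
  have "cis ?x \<noteq> 1"
  proof
    assume "cis ?x = 1"
    then have "cos ?x = 1"
      by (metis cis.simps(1) one_complex.simps(1))
    then obtain m :: int where "?x = of_int m * 2 * pi"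
      using cos_one_2pi_int by blast
    then have "2 * pi * (real l - real j) = 2 * pi * (of_int m * real (Suc n))"
      by (simp add: field_simps)
    then have "real l - real j = of_int m * real (Suc n)"
      by (simp only: mult_cancel_left) simp
    then have "real_of_int (int l - int j) = real_of_int (m * int (Suc n))"
      by simp
    then have eq: "int l - int j = m * int (Suc n)"
      by (simp only: of_int_eq_iff)
    have "\<bar>int l - int j\<bar> < int (Suc n)"
      using assms by simp
    then have "\<bar>m\<bar> * int (Suc n) < 1 * int (Suc n)"
      unfolding eq abs_mult by simp
    then have "m = 0"
      by (simp only: mult_less_cancel_right) simp
    with eq False show False by simp
  qed
  moreover have "cis ?x ^ Suc n = 1"
  proof -
    have "cis ?x ^ Suc n = cis (real (Suc n) * ?x)"
      by (rule Complex.DeMoivre)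
    also have "real (Suc n) * ?x = 2 * pi * of_int (int l - int j)"
      by simp
    finally show ?thesis
      by (simp only: cis_multiple_2pi Ints_of_int)
  qed
  ultimately show ?thesis
    using False geometric_sum[of "cis ?x" "Suc n"] by (simp only: if_False) simp
qed simp

text \<open>Averaging left translates over diagonal elements, with \<open>qa\<close> running through roots of unity, isolates
  a single monomial.\<close>

lemma qmonom_extract:
  fixes S :: "(quat \<Rightarrow> complex) \<Rightarrow> bool"
  assumes add: "\<And>f f'. S f \<Longrightarrow> S f' \<Longrightarrow> S (\<lambda>h. f h + f' h)"
    and smult: "\<And>f a. S f \<Longrightarrow> S (\<lambda>h. a * f h)"
    and trans: "\<And>f g. S f \<Longrightarrow> g \<in> G0 \<Longrightarrow> S (\<lambda>h. f (g \<star> h))"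
    and S: "S (\<lambda>h. \<Sum>l\<le>n. c l * qmonom n l h)" and j: "j \<le> n"
  shows "S (\<lambda>h. c j * qmonom n j h)"
proof -
  \<comment> \<open>Half of the angle one expects, because translation by \<open>t k\<close> turns
    \<open>qmonom n l\<close> by the phase \<open>(2 * l - n) * \<omega> k\<close>, in which
    \<open>l\<close> is doubled. The weights \<open>a k\<close> below make the phase vanish at
    \<open>l = j\<close>.\<close>
  define \<omega> where "\<omega> k = pi * real k / real (Suc n)" for k
  define t :: "nat \<Rightarrow> quat" where "t k = vector [cos (\<omega> k), sin (\<omega> k), 0, 0]" for k
  have t: "qa (t k) = cis (\<omega> k)" "qb (t k) = 0" "t k \<in> G0" for k
    by (simp_all add: t_def qa_def qb_def complex_eq_iff mem_G0_sq)
  let ?f = "\<lambda>h. \<Sum>l\<le>n. c l * qmonom n l h"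
  define a where "a k = cis ((real n - 2 * real j) * \<omega> k)" for k
  have sumS: "S (\<lambda>h. \<Sum>k<m. a k * ?f (t k \<star> h))" for m
  proof (induction m)
    case 0
    show ?case
      using smult[OF S, of 0] by simp
  next
    case (Suc m)
    from add[OF Suc smult[OF trans[OF S t(3)], of "a m" m]] show ?case
      by simp
  qed
  have "(\<Sum>k<Suc n. a k * ?f (t k \<star> h)) = of_nat (Suc n) * (c j * qmonom n j h)" for h
  proof -
    have "(\<Sum>k<Suc n. a k * ?f (t k \<star> h))
        = (\<Sum>k<Suc n. \<Sum>l\<le>n. c l * qmonom n l h * cis (2 * pi * (real l - real j) / real (Suc n)) ^ k)"
    proof (rule sum.cong[OF refl])
      fix k
      show "a k * ?f (t k \<star> h) = (\<Sum>l\<le>n. c l * qmonom n l h * cis (2 * pi * (real l - real j) / real (Suc n)) ^ k)"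
        unfolding sum_distrib_left
      proof (rule sum.cong[OF refl])
        fix l assume "l \<in> {..n}"
        then have l: "real (n - l) = real n - real l" by (simp add: of_nat_diff)
        have "qmonom n l (t k \<star> h) = cis (real l * \<omega> k) * cis (- real (n - l) * \<omega> k) * qmonom n l h"
          by (simp add: qmonom_def qa_qmul qb_qmul t power_mult_distrib Complex.DeMoivre cis_cnj)
        then have "a k * qmonom n l (t k \<star> h)
            = cis ((real n - 2 * real j) * \<omega> k + real l * \<omega> k + - real (n - l) * \<omega> k) * qmonom n l h"
          by (simp only: a_def cis_mult mult.assoc add.assoc) (simp only: cis_mult add.assoc flip: mult.assoc)
        also have "(real n - 2 * real j) * \<omega> k + real l * \<omega> k + - real (n - l) * \<omega> k
            = real k * (2 * pi * (real l - real j) / real (Suc n))"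
          unfolding l \<omega>_def by (simp add: field_simps del: of_nat_Suc)
        finally have eq: "a k * qmonom n l (t k \<star> h)
            = cis (real k * (2 * pi * (real l - real j) / real (Suc n))) * qmonom n l h" .
        have "a k * (c l * qmonom n l (t k \<star> h)) = c l * (a k * qmonom n l (t k \<star> h))"
          by (rule mult.left_commute)
        then show "a k * (c l * qmonom n l (t k \<star> h))
            = c l * qmonom n l h * cis (2 * pi * (real l - real j) / real (Suc n)) ^ k"
          unfolding eq Complex.DeMoivre by (simp only: mult_ac)
      qed
    qed
    also have "\<dots> = (\<Sum>l\<le>n. \<Sum>k<Suc n. c l * qmonom n l h * cis (2 * pi * (real l - real j) / real (Suc n)) ^ k)"
      by (rule sum.swap)
    also have "\<dots> = (\<Sum>l\<le>n. c l * qmonom n l h * (if l = j then of_nat (Suc n) else 0))"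
      unfolding sum_distrib_left[symmetric] using j by (intro sum.cong refl) (subst sum_roots_of_unity; simp)
    also have "\<dots> = of_nat (Suc n) * (c j * qmonom n j h)"
      using j by (simp add: if_distrib cong: if_cong)
    finally show ?thesis .
  qed
  with sumS[of "Suc n"] have "S (\<lambda>h. of_nat (Suc n) * (c j * qmonom n j h))"
    by simp
  from smult[OF this, of "1 / of_nat (Suc n)"] show ?thesis
    by (simp del: of_nat_Suc)
qed

text \<open>A nonzero value at \<open>qone\<close> is a nonzero coefficient of
  \<open>qa ^ n\<close>, which can be isolated. A rotation sends this monomial to a multiple of
  \<open>(qa + qb) ^ n\<close>, whose coefficients are all nonzero, so every monomial can be
  isolated in turn. This plays the part of irreducibility of the polynomial space.\<close>

lemma qmonom_generated:
  fixes S :: "(quat \<Rightarrow> complex) \<Rightarrow> bool"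
  assumes add: "\<And>f f'. S f \<Longrightarrow> S f' \<Longrightarrow> S (\<lambda>h. f h + f' h)"
    and smult: "\<And>f a. S f \<Longrightarrow> S (\<lambda>h. a * f h)"
    and trans: "\<And>f g. S f \<Longrightarrow> g \<in> G0 \<Longrightarrow> S (\<lambda>h. f (g \<star> h))"
    and S: "S (\<lambda>h. \<Sum>l\<le>n. c l * qmonom n l h)"
    and nz: "(\<Sum>l\<le>n. c l * qmonom n l qone) \<noteq> 0" and j: "j \<le> n"
  shows "S (qmonom n j)"
proof -
  have "(\<Sum>l\<le>n. c l * qmonom n l qone) = (\<Sum>l\<in>{n}. c l * qmonom n l qone)"
    by (rule sum.mono_neutral_right) (auto simp: qmonom_def qa_qone qb_qone)
  then have cn: "c n \<noteq> 0"
    using nz by (auto simp: qmonom_def)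
  have "S (\<lambda>h. c n * qmonom n n h)"
    by (rule qmonom_extract[OF add smult trans S]) auto
  from smult[OF this, of "1 / c n"] have top: "S (qmonom n n)"
    using cn by simp
  \<comment> \<open>The rotation by 45 degrees that mixes \<open>qa\<close> and \<open>qb\<close>
    with equal weights.\<close>
  define g0 :: quat where "g0 = vector [1 / sqrt 2, 0, - (1 / sqrt 2), 0]"
  have g0: "g0 \<in> G0"
    by (simp add: g0_def mem_G0_sq power_divide)
  have qa: "qa (g0 \<star> h) = of_real (1 / sqrt 2) * (qa h + qb h)" for h
    unfolding qa_qmul by (simp add: g0_def qa_def qb_def complex_eq_iff algebra_simps)
  have "of_real (sqrt 2) ^ n * qmonom n n (g0 \<star> h) = (\<Sum>l\<le>n. of_nat (n choose l) * qmonom n l h)" for h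
  proof -
    have "of_real (sqrt 2) ^ n * qmonom n n (g0 \<star> h) = (of_real (sqrt 2) * (of_real (1 / sqrt 2) * (qa h + qb h))) ^ n"
      by (simp only: qmonom_def qa power_mult_distrib diff_self_eq_0 power_0 mult_1_right)
    also have "of_real (sqrt 2) * (of_real (1 / sqrt 2) * (qa h + qb h)) = qa h + qb h"
      by (simp flip: of_real_mult mult.assoc)
    also have "(qa h + qb h) ^ n = (\<Sum>l\<le>n. of_nat (n choose l) * qmonom n l h)"
      unfolding binomial_ring qmonom_def by (simp add: mult.assoc)
    finally show ?thesis .
  qed
  with smult[OF trans[OF top g0], of "of_real (sqrt 2) ^ n"]
  have "S (\<lambda>h. \<Sum>l\<le>n. of_nat (n choose l) * qmonom n l h)"
    by simp
  with add smult trans have "S (\<lambda>h. of_nat (n choose j) * qmonom n j h)"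
    using j by (rule qmonom_extract[where S=S and n=n and c="\<lambda>l. of_nat (n choose l)"])
  from smult[OF this, of "1 / of_nat (n choose j)"] show ?thesis
    using j by simp
qed

section \<open>Matrix coefficients of an irreducible representation\<close>

locale su2_irrep =
  fixes d :: nat and \<pi> :: "quat \<Rightarrow> complex mat"
  assumes irrep: "irreducible_representation d \<pi>"
begin

lemma d_pos: "d > 0"
  and rep_carrier [simp, intro]: "g \<in> G0 \<Longrightarrow> \<pi> g \<in> carrier_mat d d"
  and rep_one: "\<pi> qone = 1\<^sub>m d"
  and rep_mult: "g \<in> G0 \<Longrightarrow> h \<in> G0 \<Longrightarrow> \<pi> (g \<star> h) = \<pi> g * \<pi> h"
  and rep_continuous: "i < d \<Longrightarrow> j < d \<Longrightarrow> continuous_on G0 (\<lambda>g. \<pi> g $$ (i, j))"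
  using irrep unfolding irreducible_representation_def is_representation_def by auto

lemma rep_dim [simp]: "g \<in> G0 \<Longrightarrow> dim_row (\<pi> g) = d" "g \<in> G0 \<Longrightarrow> dim_col (\<pi> g) = d"
  using carrier_matD[OF rep_carrier] by auto

lemma rep_mult_index:
  assumes "g \<in> G0" "h \<in> G0" "i < d" "k < d"
  shows "\<pi> (g \<star> h) $$ (i, k) = (\<Sum>j<d. \<pi> g $$ (i, j) * \<pi> h $$ (j, k))"
  using assms by (simp add: rep_mult scalar_prod_def atLeast0LessThan)

lemma matrix_coeff_dot:
  assumes "w \<in> carrier_vec d" "g \<in> G0"
  shows "matrix_coeff \<pi> w v g = (\<Sum>i<d. vec_index w i * vec_index (\<pi> g *\<^sub>v v) i)"
  using assms by (simp add: matrix_coeff_def scalar_prod_def atLeast0LessThan)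

lemma mult_mat_vec_index:
  assumes "v \<in> carrier_vec d" "g \<in> G0" "i < d"
  shows "vec_index (\<pi> g *\<^sub>v v) i = (\<Sum>j<d. \<pi> g $$ (i, j) * vec_index v j)"
  using assms by (simp add: scalar_prod_def atLeast0LessThan)

lemma matrix_coeff_sum:
  assumes "w \<in> carrier_vec d" "v \<in> carrier_vec d" "g \<in> G0"
  shows "matrix_coeff \<pi> w v g = (\<Sum>i<d. \<Sum>j<d. vec_index w i * (\<pi> g $$ (i, j) * vec_index v j))"
  unfolding matrix_coeff_dot[OF assms(1,3)] sum_distrib_left[symmetric]
  by (intro sum.cong refl) (subst mult_mat_vec_index; use assms in auto)

lemma matrix_coeff_unit:
  assumes "w \<in> carrier_vec d" "k < d" "g \<in> G0"
  shows "matrix_coeff \<pi> w (unit_vec d k) g = (\<Sum>i<d. vec_index w i * \<pi> g $$ (i, k))"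
  using assms by (simp add: matrix_coeff_sum if_distrib cong: if_cong)

lemma matrix_coeff_continuous:
  assumes "w \<in> carrier_vec d" "v \<in> carrier_vec d"
  shows "continuous_on G0 (matrix_coeff \<pi> w v)"
proof -
  have "continuous_on G0 (\<lambda>g. \<Sum>i<d. \<Sum>j<d. vec_index w i * (\<pi> g $$ (i, j) * vec_index v j))"
    by (intro continuous_intros rep_continuous) auto
  then show ?thesis
    using assms by (subst continuous_on_cong[OF refl matrix_coeff_sum])
qed

lemma matrix_coeff_right:
  assumes "v \<in> carrier_vec d" "g \<in> G0" "h \<in> G0"
  shows "matrix_coeff \<pi> w v (g \<star> h) = matrix_coeff \<pi> w (\<pi> h *\<^sub>v v) g"
  using assms assoc_mult_mat_vec[OF rep_carrier[OF assms(2)] rep_carrier[OF assms(3)] assms(1)]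
  by (simp add: matrix_coeff_def rep_mult)

text \<open>The row vector \<open>w\<close> times \<open>\<pi> h\<close>, that is, the dual action;
  \<open>scalar_prod\<close> is bilinear, so no conjugates appear.\<close>

definition left_act :: "quat \<Rightarrow> complex Matrix.vec \<Rightarrow> complex Matrix.vec" where
  "left_act h w = Matrix.vec d (\<lambda>j. \<Sum>i<d. vec_index w i * \<pi> h $$ (i, j))"

lemma left_act_carrier [simp, intro]: "left_act h w \<in> carrier_vec d"
  by (simp add: left_act_def)

lemma matrix_coeff_left:
  assumes w: "w \<in> carrier_vec d" and v: "v \<in> carrier_vec d" and g: "g \<in> G0" and h: "h \<in> G0"
  shows "matrix_coeff \<pi> w v (h \<star> g) = matrix_coeff \<pi> (left_act h w) v g"
proof -
  define y where "y = \<pi> g *\<^sub>v v"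
  have y: "y \<in> carrier_vec d"
    using mult_mat_vec_carrier[OF rep_carrier[OF g] v] by (simp add: y_def)
  have "matrix_coeff \<pi> w v (h \<star> g) = matrix_coeff \<pi> w y h"
    unfolding y_def by (rule matrix_coeff_right[OF v h g])
  also have "\<dots> = (\<Sum>i<d. \<Sum>j<d. vec_index w i * (\<pi> h $$ (i, j) * vec_index y j))"
    by (rule matrix_coeff_sum[OF w y h])
  also have "\<dots> = (\<Sum>j<d. \<Sum>i<d. vec_index w i * (\<pi> h $$ (i, j) * vec_index y j))"
    by (rule sum.swap)
  also have "\<dots> = (\<Sum>j<d. vec_index (left_act h w) j * vec_index y j)"
    by (simp add: left_act_def sum_distrib_right mult.assoc)
  also have "\<dots> = matrix_coeff \<pi> (left_act h w) v g"
    unfolding y_def by (rule matrix_coeff_dot[symmetric]) (use g in auto)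
  finally show ?thesis .
qed

text \<open>Irreducibility expressed by closure properties, so that the vector space structures in
  its definition are unfolded only once.\<close>

lemma invariant_subspace_eq:
  assumes sub: "U \<subseteq> carrier_vec d"
    and add: "\<And>u u'. u \<in> U \<Longrightarrow> u' \<in> U \<Longrightarrow> u + u' \<in> U"
    and smult: "\<And>c u. u \<in> U \<Longrightarrow> c \<cdot>\<^sub>v u \<in> U"
    and inv: "\<And>g u. g \<in> G0 \<Longrightarrow> u \<in> U \<Longrightarrow> \<pi> g *\<^sub>v u \<in> U"
    and v: "v \<in> U" "v \<noteq> 0\<^sub>v d"
  shows "U = carrier_vec d"
proof -
  have "0 \<cdot>\<^sub>v v = 0\<^sub>v d"
    using v(1) sub by (intro eq_vecI) auto
  then have "0\<^sub>v d \<in> U"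
    using smult[OF v(1), of 0] by simp
  then have "VectorSpace.subspace class_ring U (module_vec TYPE(complex) d)"
    using sub add smult
    by (auto simp: subspace_def submodule_def vec_vs vec_module module_vec_simps class_ring_simps)
  then have "U = {0\<^sub>v d} \<or> U = carrier_vec d"
    using irrep inv unfolding irreducible_representation_def by blast
  with v show ?thesis by auto
qed

lemma matrix_coeff_add_right:
  assumes "u \<in> carrier_vec d" "u' \<in> carrier_vec d" "w \<in> carrier_vec d" "g \<in> G0"
  shows "matrix_coeff \<pi> w (u + u') g = matrix_coeff \<pi> w u g + matrix_coeff \<pi> w u' g"
  using assms by (simp add: matrix_coeff_sum sum.distrib distrib_left)

lemma matrix_coeff_smult_right:
  assumes "u \<in> carrier_vec d" "w \<in> carrier_vec d" "g \<in> G0"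
  shows "matrix_coeff \<pi> w (c \<cdot>\<^sub>v u) g = c * matrix_coeff \<pi> w u g"
  using assms by (simp add: matrix_coeff_sum sum_distrib_left mult_ac)

text \<open>The vectors whose coefficients against \<open>w\<close> vanish form an invariant
  subspace containing \<open>v\<close>, hence everything; at \<open>qone\<close> the unit vectors
  then read off the entries of \<open>w\<close>. So \<open>w\<close> is determined by its
  coefficient function against \<open>v\<close>.\<close>

lemma coeff_zero_imp_zero:
  assumes v: "v \<in> carrier_vec d" "v \<noteq> 0\<^sub>v d" and w: "w \<in> carrier_vec d"
    and zero: "\<And>g. g \<in> G0 \<Longrightarrow> matrix_coeff \<pi> w v g = 0"
  shows "w = 0\<^sub>v d"
proof -
  let ?U = "{u \<in> carrier_vec d. \<forall>g\<in>G0. matrix_coeff \<pi> w u g = 0}"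
  have "?U = carrier_vec d"
  proof (rule invariant_subspace_eq)
    show "\<pi> g *\<^sub>v u \<in> ?U" if "g \<in> G0" "u \<in> ?U" for g u
      using that mult_mat_vec_carrier[OF rep_carrier[OF that(1)]]
      by (auto simp flip: matrix_coeff_right)
    show "u + u' \<in> ?U" if "u \<in> ?U" "u' \<in> ?U" for u u'
      using that w by (auto simp: matrix_coeff_add_right)
    show "c \<cdot>\<^sub>v u \<in> ?U" if "u \<in> ?U" for c u
      using that w by (auto simp: matrix_coeff_smult_right)
  qed (use v zero in auto)
  then have *: "matrix_coeff \<pi> w u qone = 0" if "u \<in> carrier_vec d" for u
    using that by blast
  show ?thesis
  proof (rule eq_vecI)
    fix k assume "k < dim_vec (0\<^sub>v d :: complex Matrix.vec)"
    then have k: "k < d" by simp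
    have "vec_index w k = (\<Sum>i<d. vec_index w i * \<pi> qone $$ (i, k))"
      using k by (simp add: rep_one if_distrib cong: if_cong)
    also have "\<dots> = 0"
      using *[of "unit_vec d k"] matrix_coeff_unit[OF w k, of qone] by simp
    finally show "vec_index w k = vec_index (0\<^sub>v d) k"
      using k by simp
  qed (use w in auto)
qed

definition character :: "quat \<Rightarrow> complex" where
  "character g = (\<Sum>i<d. \<pi> g $$ (i, i))"

lemma character_commute:
  assumes "g \<in> G0" "h \<in> G0"
  shows "character (g \<star> h) = character (h \<star> g)"
proof -
  have "character (g \<star> h) = (\<Sum>i<d. \<Sum>j<d. \<pi> g $$ (i, j) * \<pi> h $$ (j, i))"
    using assms by (simp add: character_def rep_mult_index)
  also have "\<dots> = (\<Sum>j<d. \<Sum>i<d. \<pi> h $$ (j, i) * \<pi> g $$ (i, j))"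
    by (subst sum.swap) (simp add: mult.commute)
  also have "\<dots> = character (h \<star> g)"
    using assms by (simp add: character_def rep_mult_index)
  finally show ?thesis .
qed

text \<open>The character is a class function with value \<open>d\<close> at \<open>qone\<close>,
  hence detected by some power, and a nonzero trace has a nonzero diagonal term.\<close>

lemma ex_weight:
  obtains n i where "i < d" "(LINT g|haar. cnj (qa g) ^ n * \<pi> g $$ (i, i)) \<noteq> 0"
proof -
  have "\<exists>n. (LINT g|haar. cnj (qa g) ^ n * character g) \<noteq> 0"
  proof (rule class_function_detected)
    show "continuous_on G0 character"
      unfolding character_def by (intro continuous_intros rep_continuous) auto
    show "character (k \<star> g \<star> qconj k) = character g" if "g \<in> G0" "k \<in> G0" for g k
      using that character_commute[of "k \<star> g" "qconj k"] by simp
    show "character qone \<noteq> 0"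
      using d_pos by (simp add: character_def rep_one)
  qed
  then obtain n where n: "(LINT g|haar. cnj (qa g) ^ n * character g) \<noteq> 0"
    by blast
  have "(LINT g|haar. cnj (qa g) ^ n * character g) = (\<Sum>i<d. LINT g|haar. cnj (qa g) ^ n * \<pi> g $$ (i, i))"
    unfolding character_def sum_distrib_left
    by (intro Bochner_Integration.integral_sum haar_integrable continuous_intros rep_continuous) auto
  with n obtain i where "i < d" "(LINT g|haar. cnj (qa g) ^ n * \<pi> g $$ (i, i)) \<noteq> 0"
    by (metis (no_types, lifting) lessThan_iff sum.neutral)
  then show ?thesis
    using that by blast
qed

text \<open>Applying \<open>\<integral> cnj (qa g) ^ n * \<pi> g\<close> to a unit vector yields a highest weight vector \<open>v\<close>; its matrix
  coefficients are homogeneous polynomials of degree \<open>n\<close> in \<open>(qa, qb)\<close>.\<close>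

lemma highest_weight_vector:
  "\<exists>n v b. v \<in> carrier_vec d \<and> v \<noteq> 0\<^sub>v d \<and> (\<forall>w\<in>carrier_vec d. \<forall>h\<in>G0.
      matrix_coeff \<pi> w v h = (\<Sum>j\<le>n. (\<Sum>i<d. vec_index w i * b i j) * qmonom n j h))"
proof -
  obtain n i0 where i0: "i0 < d" "(LINT g|haar. cnj (qa g) ^ n * \<pi> g $$ (i0, i0)) \<noteq> 0"
    by (rule ex_weight)
  define v where "v = Matrix.vec d (\<lambda>k. LINT g|haar. cnj (qa g) ^ n * \<pi> g $$ (k, i0))"
  \<comment> \<open>Coefficients left by expanding
    \<open>(qa h * cnj (qa g) + qb h * cnj (qb g)) ^ n\<close> under the integral over
    \<open>g\<close>.\<close>
  define b where "b i j = of_nat (n choose j) * (LINT g|haar. cnj (qa g) ^ j * cnj (qb g) ^ (n - j) * \<pi> g $$ (i, i0))" for i j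
  have v: "v \<in> carrier_vec d"
    by (simp add: v_def)
  have "vec_index v i0 \<noteq> 0"
    using i0 by (simp add: v_def)
  then have v0: "v \<noteq> 0\<^sub>v d"
    using i0(1) by auto
  have "matrix_coeff \<pi> w v h = (\<Sum>j\<le>n. (\<Sum>i<d. vec_index w i * b i j) * qmonom n j h)"
    if w: "w \<in> carrier_vec d" and h: "h \<in> G0" for w h
  proof -
    let ?m = "matrix_coeff \<pi> w (unit_vec d i0)"
    have m_cont: "continuous_on G0 ?m"
      by (rule matrix_coeff_continuous[OF w]) simp
    have "matrix_coeff \<pi> w v h = (\<Sum>i<d. \<Sum>k<d. LINT g|haar. vec_index w i * \<pi> h $$ (i, k) * (cnj (qa g) ^ n * \<pi> g $$ (k, i0)))"
      unfolding matrix_coeff_sum[OF w v h] by (simp add: v_def mult.assoc)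
    also have "\<dots> = (LINT g|haar. (\<Sum>i<d. \<Sum>k<d. vec_index w i * \<pi> h $$ (i, k) * (cnj (qa g) ^ n * \<pi> g $$ (k, i0))))"
      by (subst Bochner_Integration.integral_sum,
          (intro haar_integrable continuous_intros rep_continuous; use i0 in simp),
          intro sum.cong refl Bochner_Integration.integral_sum[symmetric]
            haar_integrable continuous_intros rep_continuous; use i0 in simp)
    also have "\<dots> = (LINT g|haar. cnj (qa g) ^ n * ?m (h \<star> g))"
    proof (rule Bochner_Integration.integral_cong[OF refl])
      fix g assume "g \<in> space haar"
      then have g: "g \<in> G0" by simp
      have "?m (h \<star> g) = (\<Sum>i<d. vec_index w i * (\<Sum>k<d. \<pi> h $$ (i, k) * \<pi> g $$ (k, i0)))"
        using matrix_coeff_unit[OF w i0(1) G0_closed(1)[OF h g]] rep_mult_index[OF h g _ i0(1)] by simp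
      then show "(\<Sum>i<d. \<Sum>k<d. vec_index w i * \<pi> h $$ (i, k) * (cnj (qa g) ^ n * \<pi> g $$ (k, i0))) = cnj (qa g) ^ n * ?m (h \<star> g)"
        by (simp add: sum_distrib_left mult_ac)
    qed
    \<comment> \<open>Left invariance moves the dependence on \<open>h\<close> from the
      representation into the polynomial factor.\<close>
    also have "\<dots> = (LINT g|haar. cnj (qa (qconj h \<star> (h \<star> g))) ^ n * ?m (h \<star> g))"
      using h by simp
    also have "\<dots> = (LINT g|haar. cnj (qa (qconj h \<star> g)) ^ n * ?m g)"
      by (rule haar_left_invariant[OF h, of "\<lambda>g. cnj (qa (qconj h \<star> g)) ^ n * ?m g"])
        (intro continuous_intros m_cont)
    also have "\<dots> = (LINT g|haar. (\<Sum>j\<le>n. \<Sum>i<d. (of_nat (n choose j) * vec_index w i * qmonom n j h) *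
        (cnj (qa g) ^ j * cnj (qb g) ^ (n - j) * \<pi> g $$ (i, i0))))"
    proof (rule Bochner_Integration.integral_cong[OF refl])
      fix g assume "g \<in> space haar"
      then have g: "g \<in> G0" by simp
      have "cnj (qa (qconj h \<star> g)) = qa h * cnj (qa g) + qb h * cnj (qb g)"
        by (simp add: qa_qmul qa_qconj qb_qconj)
      then have "cnj (qa (qconj h \<star> g)) ^ n
          = (\<Sum>j\<le>n. of_nat (n choose j) * (qa h * cnj (qa g)) ^ j * (qb h * cnj (qb g)) ^ (n - j))"
        by (simp only: binomial_ring)
      also have "\<dots> = (\<Sum>j\<le>n. of_nat (n choose j) * qmonom n j h * (cnj (qa g) ^ j * cnj (qb g) ^ (n - j)))"
        by (simp only: qmonom_def power_mult_distrib mult_ac)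
      finally have eq: "cnj (qa (qconj h \<star> g)) ^ n
          = (\<Sum>j\<le>n. of_nat (n choose j) * qmonom n j h * (cnj (qa g) ^ j * cnj (qb g) ^ (n - j)))" .
      show "cnj (qa (qconj h \<star> g)) ^ n * ?m g = (\<Sum>j\<le>n. \<Sum>i<d. (of_nat (n choose j) * vec_index w i * qmonom n j h) *
        (cnj (qa g) ^ j * cnj (qb g) ^ (n - j) * \<pi> g $$ (i, i0)))"
        unfolding eq matrix_coeff_unit[OF w i0(1) g] sum_product
        by (intro sum.cong refl) (simp only: mult_ac)
    qed
    also have "\<dots> = (\<Sum>j\<le>n. \<Sum>i<d. (of_nat (n choose j) * vec_index w i * qmonom n j h) *
        (LINT g|haar. cnj (qa g) ^ j * cnj (qb g) ^ (n - j) * \<pi> g $$ (i, i0)))"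
      by (subst Bochner_Integration.integral_sum,
          (intro haar_integrable continuous_intros rep_continuous; use i0 in simp),
          intro sum.cong refl, subst Bochner_Integration.integral_sum,
          (intro haar_integrable continuous_intros rep_continuous; use i0 in simp), simp)
    also have "\<dots> = (\<Sum>j\<le>n. (\<Sum>i<d. vec_index w i * b i j) * qmonom n j h)"
      unfolding sum_distrib_right b_def by (simp only: mult_ac)
    finally show ?thesis .
  qed
  with v v0 show ?thesis by blast
qed

text \<open>The matrix \<open>b\<close> sends \<open>w\<close> to its coordinates in the monomials,
  and vectors \<open>W j\<close> represent the monomials. Independence of the monomials makes one
  composition the identity of size \<open>n + 1\<close>, \<open>coeff_zero_imp_zero\<close> makes
  the other the identity of size \<open>d\<close>, and both have the same trace. Only diagonal
  entries are computed.\<close>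

lemma dimension_and_coefficients:
  assumes v: "v \<in> carrier_vec d" "v \<noteq> 0\<^sub>v d"
    and b: "\<And>w h. w \<in> carrier_vec d \<Longrightarrow> h \<in> G0 \<Longrightarrow>
      matrix_coeff \<pi> w v h = (\<Sum>j\<le>n. (\<Sum>i<d. vec_index w i * b i j) * qmonom n j h)"
  shows "d = n + 1"
proof -
  let ?B = "\<lambda>w j. \<Sum>i<d. vec_index w i * b i j"
  define S where "S f \<longleftrightarrow> (\<exists>w\<in>carrier_vec d. \<forall>h\<in>G0. f h = matrix_coeff \<pi> w v h)" for f
  have "\<exists>W\<in>carrier_vec d. \<forall>h\<in>G0. qmonom n j h = matrix_coeff \<pi> W v h" if j: "j \<le> n" for j
  proof -
    obtain k where k: "k < d" "vec_index v k \<noteq> 0"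
    proof (rule ccontr)
      assume "\<not> thesis"
      then have "\<And>k. k < d \<Longrightarrow> vec_index v k = 0"
        using that by blast
      then have "v = 0\<^sub>v d"
        using v(1) by (intro eq_vecI) auto
      with v(2) show False ..
    qed
    let ?w = "unit_vec d k :: complex Matrix.vec"
    have "S (qmonom n j)"
    proof (rule qmonom_generated[OF _ _ _ _ _ j])
      show "S (\<lambda>h. f h + f' h)" if "S f" "S f'" for f f'
      proof -
        obtain w w' where "w \<in> carrier_vec d" "w' \<in> carrier_vec d"
          "\<forall>h\<in>G0. f h = matrix_coeff \<pi> w v h" "\<forall>h\<in>G0. f' h = matrix_coeff \<pi> w' v h"
          using \<open>S f\<close> \<open>S f'\<close> unfolding S_def by blast
        then show ?thesis
          unfolding S_def by (intro bexI[of _ "w + w'"]) (simp_all add: matrix_coeff_dot sum.distrib distrib_right)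
      qed
      show "S (\<lambda>h. a * f h)" if "S f" for f a
      proof -
        obtain w where "w \<in> carrier_vec d" "\<forall>h\<in>G0. f h = matrix_coeff \<pi> w v h"
          using \<open>S f\<close> unfolding S_def by blast
        then show ?thesis
          unfolding S_def by (intro bexI[of _ "a \<cdot>\<^sub>v w"]) (simp_all add: matrix_coeff_dot sum_distrib_left mult.assoc)
      qed
      show "S (\<lambda>h. f (g \<star> h))" if "S f" "g \<in> G0" for f g
      proof -
        obtain w where "w \<in> carrier_vec d" "\<forall>h\<in>G0. f h = matrix_coeff \<pi> w v h"
          using \<open>S f\<close> unfolding S_def by blast
        then show ?thesis
          unfolding S_def using that(2) v(1) by (intro bexI[of _ "left_act g w"]) (simp_all add: matrix_coeff_left)
      qed
      show "S (\<lambda>h. \<Sum>l\<le>n. ?B ?w l * qmonom n l h)"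
        unfolding S_def by (intro bexI[of _ ?w]) (simp_all add: b)
      have "(\<Sum>l\<le>n. ?B ?w l * qmonom n l qone) = matrix_coeff \<pi> ?w v qone"
        by (simp add: b)
      also have "\<dots> = vec_index v k"
        using v(1) k(1) by (simp add: matrix_coeff_def rep_one)
      finally show "(\<Sum>l\<le>n. ?B ?w l * qmonom n l qone) \<noteq> 0"
        using k(2) by simp
    qed
    then show ?thesis
      unfolding S_def .
  qed
  then obtain W where W: "\<And>j. j \<le> n \<Longrightarrow> W j \<in> carrier_vec d"
    "\<And>j h. j \<le> n \<Longrightarrow> h \<in> G0 \<Longrightarrow> qmonom n j h = matrix_coeff \<pi> (W j) v h"
    by metis
  have BW: "?B (W j) j = 1" if j: "j \<le> n" for j
  proof -
    have "(\<Sum>k\<le>n. (?B (W j) k - (if k = j then 1 else 0)) * qmonom n k h) = 0" if h: "h \<in> G0" for h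
    proof -
      have "(\<Sum>k\<le>n. (?B (W j) k - (if k = j then 1 else 0)) * qmonom n k h)
          = matrix_coeff \<pi> (W j) v h - qmonom n j h"
        using j by (simp add: b[OF W(1)[OF j] h] left_diff_distrib sum_subtractf if_distrib[of "\<lambda>x. x * _"] cong: if_cong)
      then show ?thesis
        using W(2)[OF j h] by simp
    qed
    from qmonom_independent[OF this j] show ?thesis by simp
  qed
  have "(\<Sum>j\<le>n. b i j * vec_index (W j) i) = 1" if i: "i < d" for i
  proof -
    let ?w = "unit_vec d i :: complex Matrix.vec"
    have Bw: "?B ?w j = b i j" for j
      using i by (simp add: if_distrib[of "\<lambda>x. x * _"] cong: if_cong)
    \<comment> \<open>The unit vector minus its reconstruction from the \<open>W j\<close>; its
      coefficient function vanishes, so it is zero.\<close>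
    define w' where "w' = Matrix.vec d (\<lambda>k. vec_index ?w k - (\<Sum>j\<le>n. b i j * vec_index (W j) k))"
    have "matrix_coeff \<pi> w' v h = 0" if h: "h \<in> G0" for h
    proof -
      let ?y = "\<pi> h *\<^sub>v v"
      have "matrix_coeff \<pi> w' v h = (\<Sum>k<d. vec_index ?w k * vec_index ?y k)
          - (\<Sum>k<d. \<Sum>j\<le>n. b i j * (vec_index (W j) k * vec_index ?y k))"
        using h by (subst matrix_coeff_dot)
          (simp_all add: w'_def left_diff_distrib sum_subtractf sum_distrib_right mult.assoc)
      also have "(\<Sum>k<d. \<Sum>j\<le>n. b i j * (vec_index (W j) k * vec_index ?y k)) = (\<Sum>j\<le>n. b i j * matrix_coeff \<pi> (W j) v h)"
        using W(1) h by (subst sum.swap) (simp add: matrix_coeff_dot sum_distrib_left)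
      also have "\<dots> = (\<Sum>j\<le>n. ?B ?w j * qmonom n j h)"
        unfolding Bw using W(2) h by simp
      also have "\<dots> = matrix_coeff \<pi> ?w v h"
        using h by (simp add: b)
      also have "(\<Sum>k<d. vec_index ?w k * vec_index ?y k) = matrix_coeff \<pi> ?w v h"
        using h by (subst matrix_coeff_dot) simp_all
      finally show ?thesis by simp
    qed
    then have "w' = 0\<^sub>v d"
      by (intro coeff_zero_imp_zero[OF v]) (simp_all add: w'_def)
    then have "vec_index w' i = 0"
      using i by simp
    then show ?thesis
      using i by (simp add: w'_def)
  qed
  \<comment> \<open>The trace of a product of two matrices, read in both orders.\<close>
  then have "complex_of_nat d = (\<Sum>i<d. \<Sum>j\<le>n. b i j * vec_index (W j) i)"
    by simp
  also have "\<dots> = (\<Sum>j\<le>n. ?B (W j) j)"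
    by (subst sum.swap) (simp add: mult.commute)
  also have "\<dots> = of_nat (n + 1)"
    using BW by simp
  finally show ?thesis
    by (simp only: of_nat_eq_iff)
qed

text \<open>For fixed \<open>w\<close> the good vectors form an invariant subspace, since applying
  \<open>\<pi> g\<close> to the vector right-translates the coefficient, an orthogonal change of
  variable. The highest weight vector shows that it is nonzero.\<close>

lemma matrix_coeff_hecke:
  assumes w: "w \<in> carrier_vec d" and u: "u \<in> carrier_vec d"
  shows "\<exists>P. hecke (d - 1) P \<and> (\<forall>g\<in>G0. matrix_coeff \<pi> w u g = P g)"
proof -
  obtain n v b where v: "v \<in> carrier_vec d" "v \<noteq> 0\<^sub>v d" and
    b: "\<And>w h. w \<in> carrier_vec d \<Longrightarrow> h \<in> G0 \<Longrightarrow>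
      matrix_coeff \<pi> w v h = (\<Sum>j\<le>n. (\<Sum>i<d. vec_index w i * b i j) * qmonom n j h)"
    using highest_weight_vector by blast
  have d: "d - 1 = n"
    using dimension_and_coefficients[OF v b] by simp
  let ?U = "{u \<in> carrier_vec d. \<exists>P. hecke n P \<and> (\<forall>g\<in>G0. matrix_coeff \<pi> w u g = P g)}"
  have "?U = carrier_vec d"
  proof (rule invariant_subspace_eq)
    show "\<pi> g *\<^sub>v u \<in> ?U" if g: "g \<in> G0" and u: "u \<in> ?U" for g u
    proof -
      obtain P where P: "hecke n P" "\<And>h. h \<in> G0 \<Longrightarrow> matrix_coeff \<pi> w u h = P h"
        using u by blast
      have "hecke n (\<lambda>x. P (x \<star> g))"
        by (rule hecke_orthogonal[OF P(1) orthogonal_qmul_right[OF g]])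
      moreover have "matrix_coeff \<pi> w (\<pi> g *\<^sub>v u) h = P (h \<star> g)" if h: "h \<in> G0" for h
        using matrix_coeff_right[OF _ h g, of u w] P(2)[of "h \<star> g"] u g h by simp
      ultimately show ?thesis
        using mult_mat_vec_carrier[OF rep_carrier[OF g]] u by blast
    qed
    show "u + u' \<in> ?U" if u: "u \<in> ?U" and u': "u' \<in> ?U" for u u'
    proof -
      obtain P P' where P: "hecke n P" "\<And>h. h \<in> G0 \<Longrightarrow> matrix_coeff \<pi> w u h = P h"
        and P': "hecke n P'" "\<And>h. h \<in> G0 \<Longrightarrow> matrix_coeff \<pi> w u' h = P' h"
        using u u' by blast
      have "hecke n (\<lambda>x. P x + P' x)"
        using hecke_lincomb[OF P(1) P'(1), of 1 1] by simp
      then show ?thesis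
        using u u' w P(2) P'(2) by (auto simp: matrix_coeff_add_right)
    qed
    show "c \<cdot>\<^sub>v u \<in> ?U" if u: "u \<in> ?U" for c u
    proof -
      obtain P where P: "hecke n P" "\<And>h. h \<in> G0 \<Longrightarrow> matrix_coeff \<pi> w u h = P h"
        using u by blast
      have "hecke n (\<lambda>x. c * P x)"
        using hecke_lincomb[OF P(1) P(1), of c 0] by simp
      then show ?thesis
        using u w P(2) by (auto simp: matrix_coeff_smult_right)
    qed
    have "hecke n (\<lambda>x. \<Sum>j\<le>n. (\<Sum>i<d. vec_index w i * b i j) * qmonom n j x)"
      by (rule hecke_sum) (simp add: hecke_qmonom)
    then show "v \<in> ?U"
      using v b[OF w] by blast
  qed (use v in auto)
  then show ?thesis
    using u unfolding d by blast
qed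

end

lemma coeff_space_hecke:
  assumes "F \<in> coeff_space N"
  obtains P where "hecke N P" "\<And>g. g \<in> G0 \<Longrightarrow> F g = P g"
proof -
  obtain \<pi> m c w v where irrep: "irreducible_representation (N + 1) \<pi>"
    and wv: "\<And>l. l < (m::nat) \<Longrightarrow> w l \<in> carrier_vec (N + 1) \<and> v l \<in> carrier_vec (N + 1)"
    and F: "\<And>g. g \<in> G0 \<Longrightarrow> F g = (\<Sum>l<m. c l * matrix_coeff \<pi> (w l) (v l) g)"
    using assms unfolding coeff_space_def by blast
  interpret su2_irrep "N + 1" \<pi>
    by standard (rule irrep)
  have "\<exists>P. hecke N P \<and> (\<forall>g\<in>G0. matrix_coeff \<pi> (w l) (v l) g = P g)" if "l < m" for l
    using matrix_coeff_hecke[of "w l" "v l"] wv[OF that] by simp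
  then obtain P where P: "\<And>l. l < m \<Longrightarrow> hecke N (P l)"
    "\<And>l g. l < m \<Longrightarrow> g \<in> G0 \<Longrightarrow> matrix_coeff \<pi> (w l) (v l) g = P l g"
    by metis
  show ?thesis
  proof
    show "hecke N (\<lambda>x. \<Sum>l<m. c l * P l x)"
      by (rule hecke_sum) (simp add: P)
    show "F g = (\<Sum>l<m. c l * P l g)" if "g \<in> G0" for g
      using that by (simp add: F P)
  qed
qed

section \<open>The functional equation\<close>

text \<open>The Mellin kernel in the variable \<open>u = ln t\<close>, in which \<open>t \<mapsto> 1 / t\<close> becomes a reflection.\<close>

definition mellin :: "complex \<Rightarrow> real \<Rightarrow> real \<Rightarrow> complex" where
  "mellin z r u = exp (z * of_real u) * of_real (exp (- r * exp u))"

lemma mellin_measurable [measurable]: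
  assumes [measurable]: "f \<in> borel_measurable M" "g \<in> borel_measurable M"
  shows "(\<lambda>x. mellin z (f x) (g x)) \<in> borel_measurable M"
  unfolding mellin_def by measurable

lemma cmod_mellin: "cmod (mellin z r u) = exp (Re z * u) * exp (- r * exp u)"
  by (simp add: mellin_def norm_mult)

text \<open>Euler's integral after the substitution \<open>t = exp u\<close>.\<close>

lemma mellin_Gamma_1:
  assumes z: "Re z > 0"
  shows "integrable lborel (mellin z 1)" and "(LINT u|lborel. mellin z 1 u) = Gamma z"
proof -
  let ?f = "\<lambda>t. complex_of_real t powr (z - 1) / of_real (exp t)"
  have range: "range (exp :: real \<Rightarrow> real) = {0<..}"
    by (auto simp: image_iff intro: exp_ln[symmetric])
  have eq: "\<bar>exp u\<bar> *\<^sub>R ?f (exp u) = mellin z 1 u" for u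
  proof -
    have "complex_of_real (exp u) powr (z - 1) = exp ((z - 1) * of_real u)"
      by (simp add: powr_def Ln_of_real)
    then have "\<bar>exp u\<bar> *\<^sub>R ?f (exp u) = exp (of_real u) * exp ((z - 1) * of_real u) / of_real (exp (exp u))"
      by (simp add: scaleR_conv_of_real exp_of_real)
    also have "exp (of_real u) * exp ((z - 1) * of_real u) = exp (z * of_real u)"
      by (simp add: algebra_simps flip: exp_add)
    finally show ?thesis
      by (simp add: mellin_def exp_minus divide_inverse)
  qed
  have "?f absolutely_integrable_on range exp" "integral (range exp) ?f = Gamma z"
    unfolding range using absolutely_integrable_Gamma_integral'[OF z] integral_unique[OF Gamma_integral_complex'[OF z]]
    by auto
  then have "(\<lambda>u. \<bar>exp u\<bar> *\<^sub>R ?f (exp u)) absolutely_integrable_on UNIV \<and>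
      integral UNIV (\<lambda>u. \<bar>exp u\<bar> *\<^sub>R ?f (exp u)) = Gamma z"
    by (subst has_absolute_integral_change_of_variables_real) (auto intro!: derivative_eq_intros simp: inj_on_def)
  then have *: "mellin z 1 absolutely_integrable_on UNIV" "integral UNIV (mellin z 1) = Gamma z"
    unfolding eq by (simp_all cong: integral_cong)
  have "integrable lebesgue (mellin z 1)"
    using *(1) by (simp add: set_integrable_def)
  then show int: "integrable lborel (mellin z 1)"
    by (subst (asm) integrable_completion) simp_all
  show "(LINT u|lborel. mellin z 1 u) = Gamma z"
    using integral_lborel[OF int] *(2) by simp
qed

lemma
  assumes z: "Re z > 0" and r: "r > 0"
  shows integrable_mellin: "integrable lborel (mellin z r)"
    and integral_mellin: "(LINT u|lborel. mellin z r u) = Gamma z * of_real r powr (- z)"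
    and integral_cmod_mellin: "(LINT u|lborel. cmod (mellin z r u)) = Gamma (Re z) * r powr (- Re z)"
proof -
  \<comment> \<open>Scaling \<open>t\<close> by \<open>r\<close> is the shift of \<open>u\<close> by
    \<open>ln r\<close>. Stated for general \<open>z\<close> because the integral of the modulus is
    the case \<open>of_real (Re z)\<close>.\<close>
  have shift: "integrable lborel (mellin z r) \<and> (LINT u|lborel. mellin z r u) = Gamma z * of_real r powr (- z)"
    if z: "Re z > 0" for z
  proof -
    have eq: "mellin z r u = of_real r powr (- z) * mellin z 1 (ln r + 1 * u)" for u
    proof -
      have "of_real r powr (- z) = exp (- z * of_real (ln r))"
        using r by (simp add: powr_def Ln_of_real)
      then have "of_real r powr (- z) * exp (z * of_real (ln r + 1 * u)) = exp (z * of_real u)"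
        by (simp add: algebra_simps flip: exp_add)
      moreover have "exp (ln r + 1 * u) = r * exp u"
        using r by (simp add: exp_add)
      ultimately show ?thesis
        unfolding mellin_def by (simp only: mult.assoc[symmetric] mult_1_left mult_minus_left)
    qed
    have "(LINT u|lborel. mellin z 1 (ln r + 1 * u)) = Gamma z"
      using lborel_integral_real_affine[of 1 "mellin z 1" "ln r"] mellin_Gamma_1(2)[OF z] by simp
    moreover have "integrable lborel (\<lambda>u. mellin z 1 (ln r + 1 * u))"
      using lborel_integrable_real_affine_iff[of 1 "mellin z 1" "ln r"] mellin_Gamma_1(1)[OF z] by simp
    ultimately show ?thesis
      unfolding eq[abs_def] by (simp add: eq mult.commute)
  qed
  show "integrable lborel (mellin z r)" "(LINT u|lborel. mellin z r u) = Gamma z * of_real r powr (- z)"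
    using shift[OF z] by auto
  have "of_real (LINT u|lborel. cmod (mellin z r u)) = (LINT u|lborel. mellin (of_real (Re z)) r u)"
    unfolding integral_complex_of_real[symmetric]
    by (intro Bochner_Integration.integral_cong refl) (simp add: cmod_mellin, simp add: mellin_def flip: exp_of_real)
  also have "\<dots> = of_real (Gamma (Re z) * r powr (- Re z))"
    using shift[of "of_real (Re z)"] z r by (simp add: Gamma_complex_of_real powr_of_real[symmetric])
  finally show "(LINT u|lborel. cmod (mellin z r u)) = Gamma (Re z) * r powr (- Re z)"
    by (simp only: of_real_eq_iff)
qed

definition rpow :: "complex \<Rightarrow> quat \<Rightarrow> complex" where
  "rpow a x = of_real (norm x) powr a"

lemma rpow_eq: "rpow a x = (if x = 0 then 0 else exp (a * of_real (ln (norm x))))"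
  by (simp add: rpow_def powr_def Ln_of_real)

lemma rpow_measurable [measurable]: "rpow a \<in> borel_measurable borel"
  unfolding rpow_eq[abs_def] by measurable

lemma cmod_rpow: "cmod (rpow a x) = norm x powr Re a"
  by (simp add: rpow_eq powr_def)

text \<open>Fubini: integrating the modulus over \<open>u\<close> first again yields a Gamma value
  times a power of the norm, so joint integrability reduces to the hypothesis
  \<open>int\<close>.\<close>

lemma mellin_swap:
  fixes K :: "quat \<Rightarrow> complex"
  assumes K [measurable]: "K \<in> borel_measurable borel" and z: "Re z > 0" and a: "a > 0"
    and int: "integrable lborel (\<lambda>x. K x * rpow (- 2 * z) x)"
  shows "(LINT u|lborel. LINT x|lborel. K x * mellin z (a * (norm x)\<^sup>2) u)
    = Gamma z * of_real a powr (- z) * (LINT x|lborel. K x * rpow (- 2 * z) x)"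
proof -
  let ?k = "\<lambda>x u. K x * mellin z (a * (norm x)\<^sup>2) u"
  have pos: "a * (norm x)\<^sup>2 > 0" if "x \<noteq> 0" for x :: quat
    using a that by simp
  have nz: "AE x::quat in lborel. x \<noteq> 0"
    by (rule AE_lborel_singleton)
  have inner: "(LINT u|lborel. ?k x u) = Gamma z * of_real a powr (- z) * (K x * rpow (- 2 * z) x)" if x: "x \<noteq> 0" for x
  proof -
    have "of_real (a * (norm x)\<^sup>2) powr (- z) = of_real a powr (- z) * rpow (- 2 * z) x"
    proof -
      have "of_real (a * (norm x)\<^sup>2) powr (- z) = exp (- z * of_real (ln a + 2 * ln (norm x)))"
        using pos[OF x] a x by (simp add: powr_def Ln_of_real ln_mult ln_realpow del: of_real_mult)
      also have "\<dots> = exp (- z * of_real (ln a)) * exp (- 2 * z * of_real (ln (norm x)))"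
        by (simp add: algebra_simps flip: exp_add)
      finally show ?thesis
        using a x by (simp add: powr_def Ln_of_real rpow_eq)
    qed
    then show ?thesis
      using integral_mellin[OF z pos[OF x]] by simp
  qed
  have norm_inner: "(LINT u|lborel. norm (?k x u)) = Gamma (Re z) * a powr (- Re z) * cmod (K x * rpow (- 2 * z) x)" if x: "x \<noteq> 0" for x
  proof -
    have "(a * (norm x)\<^sup>2) powr (- Re z) = a powr (- Re z) * norm x powr (- 2 * Re z)"
      using a x by (simp add: powr_mult powr_powr flip: powr_numeral)
    then show ?thesis
      using integral_cmod_mellin[OF z pos[OF x]] by (simp add: norm_mult cmod_rpow)
  qed
  have "integrable (lborel \<Otimes>\<^sub>M lborel) (\<lambda>(x, u). ?k x u)"
  proof (rule lborel_pair.Fubini_integrable)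
    show "(\<lambda>(x, u). ?k x u) \<in> borel_measurable (lborel \<Otimes>\<^sub>M lborel)"
      by measurable
    have "integrable lborel (\<lambda>x. Gamma (Re z) * a powr (- Re z) * cmod (K x * rpow (- 2 * z) x))"
      using int by (intro integrable_mult_right integrable_norm)
    then show "integrable lborel (\<lambda>x. LINT u|lborel. norm (case (x, u) of (x, u) \<Rightarrow> ?k x u))"
    proof (rule integrable_cong_AE_imp)
      show "AE x in lborel. Gamma (Re z) * a powr (- Re z) * cmod (K x * rpow (- 2 * z) x)
          = (LINT u|lborel. norm (case (x, u) of (x, u) \<Rightarrow> ?k x u))"
        unfolding case_prod_conv using nz by eventually_elim (rule norm_inner[symmetric])
    qed measurable
    show "AE x in lborel. integrable lborel (\<lambda>u. case (x, u) of (x, u) \<Rightarrow> ?k x u)"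
      using nz by eventually_elim (simp add: integrable_mellin[OF z pos])
  qed
  then have "(LINT u|lborel. LINT x|lborel. ?k x u) = (LINT x|lborel. LINT u|lborel. ?k x u)"
    by (rule lborel_pair.Fubini_integral)
  also have "\<dots> = (LINT x|lborel. Gamma z * of_real a powr (- z) * (K x * rpow (- 2 * z) x))"
  proof (rule integral_cong_AE)
    show "AE x in lborel. (LINT u|lborel. ?k x u) = Gamma z * of_real a powr (- z) * (K x * rpow (- 2 * z) x)"
      using nz by eventually_elim (rule inner)
  qed measurable
  finally show ?thesis
    by simp
qed

lemma osc_commute: "osc \<kappa> y x = osc \<kappa> x y"
  by (simp add: osc_def inner_commute)

lemma ft_measurable [measurable]:
  assumes [measurable]: "\<phi> \<in> borel_measurable borel"
  shows "ft \<kappa> \<phi> \<in> borel_measurable borel"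
  unfolding ft_def by measurable

text \<open>The multiplication formula: Fubini moves the transform from \<open>\<phi>\<close> to the
  product of \<open>P\<close> and the Gaussian, where Hecke's formula applies.\<close>

lemma hecke_gauss_ft:
  assumes P: "hecke n P" and \<phi>: "\<phi> \<in> schwartz" and c: "c > 0"
  shows "(LINT y|lborel. P y * gauss c y * ft \<kappa> \<phi> y)
    = (\<i> * of_real (\<kappa> / (2 * c))) ^ n * of_real ((pi / c)\<^sup>2)
      * (LINT x|lborel. \<phi> x * P x * of_real (exp (- (\<kappa>\<^sup>2 * (norm x)\<^sup>2) / (4 * c))))"
proof -
  note [measurable] = hecke_measurable[OF P] schwartz_measurable[OF \<phi>]
  let ?k = "\<lambda>y x. P y * gauss c y * (\<phi> x * osc \<kappa> y x)"
  have iP: "integrable lborel (\<lambda>y. P y * gauss c y)"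
    using hecke_integrable[OF P c, of 0 0] by (simp add: osc_def)
  have i\<phi>: "integrable lborel \<phi>"
    by (rule schwartz_integrable[OF \<phi>])
  have i\<phi>o: "integrable lborel (\<lambda>x. \<phi> x * osc \<kappa> y x)" for y
    by (rule Bochner_Integration.integrable_bound[OF i\<phi>]) (auto simp: norm_mult)
  have "integrable (lborel \<Otimes>\<^sub>M lborel) (\<lambda>(y, x). ?k y x)"
  proof (rule lborel_pair.Fubini_integrable)
    show "(\<lambda>(y, x). ?k y x) \<in> borel_measurable (lborel \<Otimes>\<^sub>M lborel)"
      by measurable
    show "integrable lborel (\<lambda>y. LINT x|lborel. norm (case (y, x) of (y, x) \<Rightarrow> ?k y x))"
      using integrable_norm[OF iP] by (simp add: norm_mult)
    show "AE y in lborel. integrable lborel (\<lambda>x. case (y, x) of (y, x) \<Rightarrow> ?k y x)"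
      using i\<phi>o by (intro AE_I2) simp
  qed
  then have "(LINT x|lborel. LINT y|lborel. ?k y x) = (LINT y|lborel. LINT x|lborel. ?k y x)"
    by (rule lborel_pair.Fubini_integral)
  moreover have "(LINT x|lborel. ?k y x) = P y * gauss c y * ft \<kappa> \<phi> y" for y
    unfolding ft_def by (simp only: integral_mult_right_zero)
  moreover have "(LINT y|lborel. ?k y x)
     = (\<i> * of_real (\<kappa> / (2 * c))) ^ n * of_real ((pi / c)\<^sup>2) * (\<phi> x * P x * of_real (exp (- (\<kappa>\<^sup>2 * (norm x)\<^sup>2) / (4 * c))))" for x
  proof -
    have "(LINT y|lborel. ?k y x) = \<phi> x * (LINT y|lborel. P y * (gauss c y * osc \<kappa> x y))"
    proof -
      have "?k y x = \<phi> x * (P y * (gauss c y * osc \<kappa> x y))" for y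
        unfolding osc_commute[of \<kappa> y x] by (simp only: mult_ac)
      then show ?thesis
        by (simp only: integral_mult_right_zero)
    qed
    also have "(LINT y|lborel. P y * (gauss c y * osc \<kappa> x y))
      = (\<i> * of_real (\<kappa> / (2 * c))) ^ n * of_real ((pi / c)\<^sup>2 * exp (- (\<kappa>\<^sup>2 * (norm x)\<^sup>2) / (4 * c))) * P x"
      using P c unfolding hecke_def by blast
    finally show ?thesis
      by (simp only: of_real_mult mult_ac)
  qed
  ultimately show ?thesis
    by (simp only: integral_mult_right_zero)
qed

lemma hecke_rpow_bound:
  assumes P: "hecke n P"
  obtains C where "C \<ge> 0" "\<And>x a. x \<noteq> 0 \<Longrightarrow> cmod (P x * rpow a x) \<le> C * norm x powr (real n + Re a)"
proof -
  obtain C where C: "\<And>x. cmod (P x) \<le> C * norm x ^ n"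
    using hecke_bound[OF P] by blast
  show ?thesis
  proof
    fix x :: quat and a assume x: "x \<noteq> 0"
    have "cmod (P x) \<le> \<bar>C\<bar> * norm x ^ n"
      by (rule order_trans[OF C]) (intro mult_right_mono; simp)
    then have "cmod (P x * rpow a x) \<le> \<bar>C\<bar> * norm x ^ n * norm x powr Re a"
      unfolding norm_mult cmod_rpow by (rule mult_right_mono) simp
    then show "cmod (P x * rpow a x) \<le> \<bar>C\<bar> * norm x powr (real n + Re a)"
      using x by (simp add: powr_add powr_realpow mult.assoc)
  qed simp
qed

lemma integrable_hecke_rpow:
  assumes P: "hecke n P" and [measurable]: "\<psi> \<in> borel_measurable borel"
    and bnd: "\<And>x. cmod (\<psi> x) * (1 + norm x) ^ 4 \<le> D"
    and a: "- 4 < real n + Re a" "real n + Re a < 0"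
  shows "integrable lborel (\<lambda>x. P x * \<psi> x * rpow a x)"
proof -
  obtain C where C: "C \<ge> 0" "\<And>x a. x \<noteq> 0 \<Longrightarrow> cmod (P x * rpow a x) \<le> C * norm x powr (real n + Re a)"
    using hecke_rpow_bound[OF P] by blast
  note [measurable] = hecke_measurable[OF P]
  show ?thesis
  proof (rule integrable_of_bound[where \<alpha>="- (real n + Re a)" and C="C * D"])
    fix x :: quat assume x: "x \<noteq> 0"
    have "cmod (P x * \<psi> x * rpow a x) * (1 + norm x) ^ 4 = cmod (P x * rpow a x) * (cmod (\<psi> x) * (1 + norm x) ^ 4)"
      by (simp add: norm_mult)
    also have "\<dots> \<le> (C * norm x powr (real n + Re a)) * D"
      using C(1) by (intro mult_mono C(2)[OF x] bnd) auto
    finally show "cmod (P x * \<psi> x * rpow a x) * (1 + norm x) ^ 4 \<le> C * D * norm x powr - (- (real n + Re a))"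
      by (simp only: minus_minus mult_ac)
  qed (use a in auto)
qed

text \<open>The choice of exponents: \<open>z + w = n + 2\<close> is the power of
  \<open>1 / c\<close> produced by Hecke's formula, and \<open>n - 2 * z = 4 * s - 4\<close>,
  \<open>n - 2 * w = - 4 * s\<close> are the degrees of the two distributions.\<close>

lemma local_functional_equation:
  assumes P: "hecke n P" and \<phi>: "\<phi> \<in> schwartz" and s: "0 < Re s" "Re s < 1" and \<kappa>: "\<kappa> \<noteq> 0"
  defines "z \<equiv> of_nat n / 2 + 2 - 2 * s" and "w \<equiv> of_nat n / 2 + 2 * s"
  shows "Gamma z * (LINT y|lborel. P y * ft \<kappa> \<phi> y * rpow (- 2 * z) y)
    = (\<i> * of_real (\<kappa> / 2)) ^ n * of_real (pi\<^sup>2) * Gamma w * of_real (\<kappa>\<^sup>2 / 4) powr (- w)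
      * (LINT x|lborel. P x * \<phi> x * rpow (- 2 * w) x)"
proof -
  have Re: "Re z = real n / 2 + 2 - 2 * Re s" "Re w = real n / 2 + 2 * Re s"
    by (simp_all add: z_def w_def)
  then have pos: "Re z > 0" "Re w > 0"
    using s by (simp_all add: add_nonneg_pos)
  note [measurable] = hecke_measurable[OF P] schwartz_measurable[OF \<phi>]
  obtain D where D: "\<And>y. cmod (ft \<kappa> \<phi> y) * (1 + norm y) ^ 4 \<le> D"
    using ft_decay[OF \<phi> \<kappa>] by blast
  obtain D' where D': "\<And>y. cmod (\<phi> y) * (1 + norm y) ^ 4 \<le> D'"
    using schwartz_bound[OF \<phi>] by blast
  have i1: "integrable lborel (\<lambda>y. P y * ft \<kappa> \<phi> y * rpow (- 2 * z) y)"
    by (rule integrable_hecke_rpow[OF P _ D]) (use Re s in simp_all)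
  have i2: "integrable lborel (\<lambda>x. P x * \<phi> x * rpow (- 2 * w) x)"
    by (rule integrable_hecke_rpow[OF P _ D']) (use Re s in simp_all)
  have m1: "(\<lambda>y. P y * ft \<kappa> \<phi> y) \<in> borel_measurable borel"
    by (intro borel_measurable_times ft_measurable) measurable
  have m2: "(\<lambda>x. P x * \<phi> x) \<in> borel_measurable borel"
    by measurable
  have one: "(1::real) > 0"
    by simp
  have a: "\<kappa>\<^sup>2 / 4 > 0"
    using \<kappa> by simp
  let ?A = "(\<i> * of_real (\<kappa> / 2)) ^ n * of_real (pi\<^sup>2)"
  let ?G = "\<lambda>u. LINT x|lborel. P x * \<phi> x * mellin w (\<kappa>\<^sup>2 / 4 * (norm x)\<^sup>2) u"
  \<comment> \<open>The transform inverts the Gaussian parameter \<open>c = exp u\<close>, which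
    reflects \<open>u\<close>; and \<open>c\<close> to the power \<open>z - (n + 2)\<close> is
    \<open>c\<close> to the power \<open>- w\<close>.\<close>
  have inner: "(LINT y|lborel. P y * ft \<kappa> \<phi> y * mellin z (1 * (norm y)\<^sup>2) u) = ?A * ?G (- u)" for u
  proof -
    define c where "c = exp u"
    have c: "c > 0" by (simp add: c_def)
    have "(LINT y|lborel. P y * ft \<kappa> \<phi> y * mellin z (1 * (norm y)\<^sup>2) u)
        = (LINT y|lborel. exp (z * of_real u) * (P y * gauss c y * ft \<kappa> \<phi> y))"
      by (intro Bochner_Integration.integral_cong refl) (simp add: mellin_def gauss_def c_def mult_ac)
    also have "\<dots> = exp (z * of_real u) * ((\<i> * of_real (\<kappa> / (2 * c))) ^ n * of_real ((pi / c)\<^sup>2)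
      * (LINT x|lborel. \<phi> x * P x * of_real (exp (- (\<kappa>\<^sup>2 * (norm x)\<^sup>2) / (4 * c)))))"
      by (simp only: integral_mult_right_zero hecke_gauss_ft[OF P \<phi> c])
    also have "exp (z * of_real u) * ((\<i> * of_real (\<kappa> / (2 * c))) ^ n * of_real ((pi / c)\<^sup>2)
      * (LINT x|lborel. \<phi> x * P x * of_real (exp (- (\<kappa>\<^sup>2 * (norm x)\<^sup>2) / (4 * c)))))
      = ?A * (exp (- w * of_real u) * (LINT x|lborel. \<phi> x * P x * of_real (exp (- (\<kappa>\<^sup>2 * (norm x)\<^sup>2) / (4 * c)))))"
    proof -
      have 1: "\<i> * of_real (\<kappa> / (2 * c)) = \<i> * of_real (\<kappa> / 2) * of_real (inverse c)"
      proof -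
        have "\<kappa> / (2 * c) = \<kappa> / 2 * inverse c"
          using c by (simp add: field_simps)
        then show ?thesis
          by (simp only: of_real_mult mult.assoc)
      qed
      have 2: "(pi / c)\<^sup>2 = pi\<^sup>2 * (inverse c)\<^sup>2"
        by (simp only: divide_inverse power_mult_distrib)
      have e1: "(\<i> * of_real (\<kappa> / (2 * c))) ^ n * of_real ((pi / c)\<^sup>2) = ?A * of_real (inverse c ^ (n + 2))"
        unfolding 1 2 power_mult_distrib power_add of_real_mult of_real_power by (simp only: mult_ac)
      have e2: "complex_of_real (inverse c ^ (n + 2)) = exp (- (of_nat n + 2) * of_real u)"
      proof -
        have "inverse c ^ (n + 2) = exp (of_nat (n + 2) * - u)"
          unfolding exp_of_nat_mult by (simp add: c_def exp_minus)
        then show ?thesis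
          by (simp add: exp_of_real[symmetric] algebra_simps)
      qed
      have e3: "exp (z * of_real u) * exp (- (of_nat n + 2) * of_real u) = exp (- w * of_real u)"
      proof -
        have "z + - (of_nat n + 2) = - w"
          by (simp add: z_def w_def field_simps)
        then show ?thesis
          unfolding exp_add[symmetric] distrib_right[symmetric] by (rule arg_cong[where f="\<lambda>t. exp (t * of_real u)"])
      qed
      show ?thesis
        unfolding e1 e2 e3[symmetric] by (simp only: mult_ac)
    qed
    also have "exp (- w * of_real u) * (LINT x|lborel. \<phi> x * P x * of_real (exp (- (\<kappa>\<^sup>2 * (norm x)\<^sup>2) / (4 * c)))) = ?G (- u)"
      unfolding integral_mult_right_zero[symmetric]
      by (intro Bochner_Integration.integral_cong refl) (simp add: mellin_def c_def exp_minus field_simps)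
    finally show ?thesis .
  qed
  have "Gamma z * (LINT y|lborel. P y * ft \<kappa> \<phi> y * rpow (- 2 * z) y)
      = (LINT u|lborel. LINT y|lborel. P y * ft \<kappa> \<phi> y * mellin z (1 * (norm y)\<^sup>2) u)"
    by (simp only: mellin_swap[OF m1 pos(1) one i1] of_real_1 powr_one_eq_one mult_1_right)
  also have "\<dots> = ?A * (LINT u|lborel. ?G (0 + - 1 * u))"
    unfolding inner by simp
  also have "(LINT u|lborel. ?G (0 + - 1 * u)) = (LINT u|lborel. ?G u)"
    using lborel_integral_real_affine[of "-1" ?G 0] by simp
  also have "\<dots> = Gamma w * of_real (\<kappa>\<^sup>2 / 4) powr (- w) * (LINT x|lborel. P x * \<phi> x * rpow (- 2 * w) x)"
    by (rule mellin_swap[OF m2 pos(2) a i2])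
  finally show ?thesis
    by (simp only: mult.assoc)
qed

section \<open>Temperedness and the quaternionic transform\<close>

lemma dq_alt: "dq = density lborel (\<lambda>_. ennreal 4)"
  by (simp add: dq_def)

lemma integrable_dq_iff:
  fixes f :: "quat \<Rightarrow> complex"
  assumes "f \<in> borel_measurable borel"
  shows "integrable dq f \<longleftrightarrow> integrable lborel f"
proof -
  have "integrable lborel f" if "integrable lborel (\<lambda>x. 4 * f x)"
    using integrable_mult_right[OF that, of "1 / 4"] by simp
  then show ?thesis
    unfolding dq_alt using assms by (subst integrable_density) (auto simp: scaleR_conv_of_real)
qed

lemma integral_dq:
  fixes f :: "quat \<Rightarrow> complex"
  assumes "f \<in> borel_measurable borel"
  shows "(LINT x|dq. f x) = 4 * (LINT x|lborel. f x)"
  unfolding dq_alt using assms by (subst integral_density) (auto simp: scaleR_conv_of_real)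

lemma schwartz_seminorm_bound:
  assumes "\<phi> \<in> schwartz"
  shows "cmod (\<phi> x) * (1 + norm x) ^ k \<le> schwartz_seminorm k 0 \<phi>"
proof -
  have "{is :: 4 list. length is \<le> 0} = {[]}"
    by auto
  then have "schwartz_seminorm k 0 \<phi> = (SUP x. (1 + norm x) ^ k * cmod (\<phi> x))"
    by (simp add: schwartz_seminorm_def partial_derivs_def)
  moreover have "(1 + norm x) ^ k * cmod (\<phi> x) \<le> (SUP x. (1 + norm x) ^ k * cmod (\<phi> x))"
    using schwartz_bdd_above[OF assms, of k "[]"] by (intro cSUP_upper) (auto simp: partial_derivs_def)
  ultimately show ?thesis
    by (simp add: mult.commute)
qed

text \<open>Dividing \<open>f\<close> by \<open>(1 + norm x) ^ 4\<close> leaves an integrable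
  function, so a seminorm of order zero already dominates the functional.\<close>

lemma defines_tempered_of_bound:
  fixes f :: "quat \<Rightarrow> complex"
  assumes f [measurable]: "f \<in> borel_measurable borel" and \<alpha>: "0 < \<alpha>" "\<alpha> < 4"
    and bnd: "\<And>x. x \<noteq> 0 \<Longrightarrow> cmod (f x) \<le> C * norm x powr (- \<alpha>)"
  shows "defines_tempered f"
proof -
  have mult: "integrable lborel (\<lambda>x. f x * g x)"
    if [measurable]: "g \<in> borel_measurable borel" and D: "\<And>x. cmod (g x) * (1 + norm x) ^ 4 \<le> D" for g D
  proof (rule integrable_of_bound[OF _ \<alpha>, where C="\<bar>C\<bar> * D"])
    fix x :: quat assume x: "x \<noteq> 0"
    have "cmod (f x * g x) * (1 + norm x) ^ 4 = cmod (f x) * (cmod (g x) * (1 + norm x) ^ 4)"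
      by (simp add: norm_mult)
    also have "\<dots> \<le> (\<bar>C\<bar> * norm x powr (- \<alpha>)) * D"
      by (intro mult_mono D order_trans[OF bnd[OF x]] mult_right_mono) auto
    finally show "cmod (f x * g x) * (1 + norm x) ^ 4 \<le> \<bar>C\<bar> * D * norm x powr (- \<alpha>)"
      by (simp add: mult_ac)
  qed measurable
  have int: "integrable lborel (\<lambda>x. f x * \<phi> x)" if \<phi>: "\<phi> \<in> schwartz" for \<phi>
    by (rule mult[OF schwartz_measurable[OF \<phi>] schwartz_seminorm_bound[OF \<phi>]])
  have meas: "(\<lambda>x. f x * \<phi> x) \<in> borel_measurable borel" if \<phi>: "\<phi> \<in> schwartz" for \<phi>
    using schwartz_measurable[OF \<phi>] by measurable
  have dist: "distribution_of f \<phi> = 4 * (LINT x|lborel. f x * \<phi> x)" if "\<phi> \<in> schwartz" for \<phi>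
    unfolding distribution_of_def by (rule integral_dq[OF meas[OF that]])
  have local: "set_integrable dq K f" if K: "compact K" for K
  proof -
    have [measurable]: "K \<in> sets borel"
      using K by (simp add: borel_compact)
    obtain B where B: "\<And>x. x \<in> K \<Longrightarrow> norm x \<le> B"
      using compact_imp_bounded[OF K] by (auto simp: bounded_iff)
    have "integrable lborel (\<lambda>x. f x * indicator K x)"
    proof (rule mult)
      show "cmod (indicator K x) * (1 + norm x) ^ 4 \<le> (1 + \<bar>B\<bar>) ^ 4" for x
        using B[of x] by (auto simp: indicator_def intro!: power_mono)
    qed measurable
    then have "integrable dq (\<lambda>x. f x * indicator K x)"
      by (subst integrable_dq_iff) auto
    then show ?thesis
      unfolding set_integrable_def
      by (rule back_subst[of "integrable dq"]) (auto simp: indicator_def)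
  qed
  define M where "M = 4 * (LINT x|lborel. cmod (f x * of_real (1 / (1 + norm x) ^ 4)))"
  have M_int: "integrable lborel (\<lambda>x. f x * of_real (1 / (1 + norm x) ^ 4))"
  proof (rule mult)
    show "cmod (of_real (1 / (1 + norm x) ^ 4)) * (1 + norm x) ^ 4 \<le> 1" for x :: quat
      unfolding norm_of_real using one_plus_norm_power_pos[of x 4] by (simp del: one_plus_norm_power_pos)
  qed measurable
  have bound: "cmod (distribution_of f \<phi>) \<le> M * schwartz_seminorm 4 0 \<phi>" if \<phi>: "\<phi> \<in> schwartz" for \<phi>
  proof -
    have "cmod (LINT x|lborel. f x * \<phi> x)
        \<le> (LINT x|lborel. cmod (f x * of_real (1 / (1 + norm x) ^ 4)) * schwartz_seminorm 4 0 \<phi>)"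
    proof (rule Bochner_Integration.integral_norm_bound_integral[OF int[OF \<phi>]])
      show "integrable lborel (\<lambda>x. cmod (f x * of_real (1 / (1 + norm x) ^ 4)) * schwartz_seminorm 4 0 \<phi>)"
        by (intro integrable_mult_left integrable_norm M_int)
      fix x :: quat
      have "cmod (f x * \<phi> x) = cmod (f x) * (1 / (1 + norm x) ^ 4) * (cmod (\<phi> x) * (1 + norm x) ^ 4)"
        using one_plus_norm_power_pos[of x 4] by (simp add: norm_mult del: one_plus_norm_power_pos)
      also have "\<dots> \<le> cmod (f x) * (1 / (1 + norm x) ^ 4) * schwartz_seminorm 4 0 \<phi>"
        by (intro mult_left_mono schwartz_seminorm_bound \<phi> mult_nonneg_nonneg) auto
      finally show "cmod (f x * \<phi> x) \<le> cmod (f x * of_real (1 / (1 + norm x) ^ 4)) * schwartz_seminorm 4 0 \<phi>"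
        by (simp only: norm_mult norm_of_real) simp
    qed
    then show ?thesis
      unfolding dist[OF \<phi>] M_def by (simp add: norm_mult)
  qed
  have "tempered_distribution (distribution_of f)"
    unfolding tempered_distribution_def
  proof (intro conjI ballI allI)
    fix \<phi> \<psi> assume \<phi>: "\<phi> \<in> schwartz" and \<psi>: "\<psi> \<in> schwartz"
    show "distribution_of f (\<lambda>x. \<phi> x + \<psi> x) = distribution_of f \<phi> + distribution_of f \<psi>"
      unfolding distribution_of_def distrib_left
      using int[OF \<phi>] int[OF \<psi>] meas[OF \<phi>] meas[OF \<psi>]
      by (intro Bochner_Integration.integral_add) (simp_all add: integrable_dq_iff)
  next
    fix c \<phi>
    show "distribution_of f (\<lambda>x. c * \<phi> x) = c * distribution_of f \<phi>"
      unfolding distribution_of_def by (simp only: mult.left_commute[of _ c] integral_mult_right_zero)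
  next
    show "\<exists>C k m. \<forall>\<phi>\<in>schwartz. cmod (distribution_of f \<phi>) \<le> C * schwartz_seminorm k m \<phi>"
      using bound by blast
  qed
  with local int meas show ?thesis
    unfolding defines_tempered_def by (simp add: integrable_dq_iff)
qed

text \<open>The real part of \<open>x \<star> y\<close> is \<open>inner x (qconj y)\<close>. The
  trace doubles it, which turns \<open>2 * pi\<close> into \<open>4 * pi\<close>, and the factor 4
  is the density of \<open>dq\<close>.\<close>

lemma fourier_eq_ft:
  assumes "\<phi> \<in> schwartz"
  shows "fourier \<phi> y = 4 * ft (4 * pi) \<phi> (qconj y)"
proof -
  have "add_char (- (x \<star> y)) = osc (4 * pi) (qconj y) x" for x
  proof -
    have "inner x (qconj y) = (x \<star> y) $ 1"
      by (simp add: inner_vec_def sum_4)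
    moreover have "qtr (- (x \<star> y)) = - 2 * (x \<star> y) $ 1"
      by (simp add: qtr_def)
    moreover have "- 2 * of_real pi * \<i> * of_real (- 2 * t) = \<i> * of_real (4 * pi * t)" for t
      by simp
    ultimately show ?thesis
      unfolding add_char_def osc_def by (simp only:)
  qed
  then show ?thesis
    unfolding fourier_def ft_def using schwartz_measurable[OF assms]
    by (simp add: integral_dq)
qed

section \<open>Radial extensions and the factor\<close>

lemma qmod_powr_quarter: "qmod x powr (1/4) = norm x"
proof (cases "x = 0")
  case False
  then have eq: "qmod x = norm x powr 4"
    by (simp add: qmod_def qnrm_eq_norm flip: power_mult)
  show ?thesis
    unfolding eq powr_powr by simp
qed (simp add: qmod_def qnrm_eq_norm)

lemma radial_hecke:
  assumes P: "hecke n P" and F: "\<And>g. g \<in> G0 \<Longrightarrow> F g = P g" and x: "x \<noteq> 0"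
  shows "radial F x = rpow (- of_nat n) x * P x"
proof -
  have hom: "\<And>r x. r \<ge> 0 \<Longrightarrow> P (r *\<^sub>R x) = of_real (r ^ n) * P x"
    using P unfolding hecke_def by blast
  have "qmod x powr (1/4) = norm x"
    by (rule qmod_powr_quarter)
  then have "radial F x = P (inverse (norm x) *\<^sub>R x)"
    using x by (simp add: radial_def F mem_G0_iff)
  also have "\<dots> = of_real (inverse (norm x) ^ n) * P x"
    by (rule hom) simp
  also have "complex_of_real (inverse (norm x) ^ n) = rpow (- of_nat n) x"
  proof -
    have "inverse (norm x) ^ n = exp (of_nat n * - ln (norm x))"
      unfolding exp_of_nat_mult using x by (simp add: exp_minus)
    then show ?thesis
      using x by (simp add: rpow_eq exp_of_real[symmetric])
  qed
  finally show ?thesis .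
qed

lemma qmod_powr:
  assumes "x \<noteq> 0"
  shows "complex_of_real (qmod x) powr a = rpow (4 * a) x"
proof -
  have "ln (qmod x) = 4 * ln (norm x)" "qmod x > 0"
    using assms by (simp_all add: qmod_def qnrm_eq_norm ln_realpow)
  then show ?thesis
    using assms by (simp add: powr_def Ln_of_real rpow_eq mult_ac)
qed

lemma rpow_mult: "rpow a x * rpow b x = rpow (a + b) x"
  by (simp add: rpow_eq distrib_right exp_add)

lemma rpow_qconj [simp]: "rpow a (qconj x) = rpow a x"
  by (simp add: rpow_def)

text \<open>Also true at the origin, where both powers are 0 by convention.\<close>

lemma radial_powr:
  assumes P: "hecke n P" and F: "\<And>g. g \<in> G0 \<Longrightarrow> F g = P g"
  shows "radial F x * complex_of_real (qmod x) powr a = P x * rpow (4 * a - of_nat n) x"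
proof (cases "x = 0")
  case True
  then show ?thesis
    by (simp add: qmod_def qnrm_eq_norm rpow_eq)
next
  case False
  then show ?thesis
    using rpow_mult[of "- of_nat n" x "4 * a"] by (simp add: radial_hecke[OF P F] qmod_powr mult_ac)
qed

text \<open>\<open>qinv x\<close> is a positive multiple of \<open>qconj x\<close>, and a radial
  extension ignores positive factors.\<close>

lemma radial_qinv_powr:
  assumes P: "hecke n P" and F: "\<And>g. g \<in> G0 \<Longrightarrow> F g = P g"
  shows "radial F (qinv x) * complex_of_real (qmod x) powr a = P (qconj x) * rpow (4 * a - of_nat n) x"
proof (cases "x = 0")
  case True
  then show ?thesis
    by (simp add: qmod_def qnrm_eq_norm rpow_eq)
next
  case False
  have hom: "\<And>r x. r \<ge> 0 \<Longrightarrow> P (r *\<^sub>R x) = of_real (r ^ n) * P x"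
    using P unfolding hecke_def by blast
  have nz: "qconj x \<noteq> 0"
    using False by (metis norm_eq_zero norm_qconj)
  have n: "qinv x = inverse ((norm x)\<^sup>2) *\<^sub>R qconj x"
    by (simp add: qinv_def qnrm_eq_norm)
  have "radial F (qinv x) = radial F (qconj x)"
  proof -
    have "radial F (r *\<^sub>R y) = radial F y" if "r > 0" "y \<noteq> 0" for r y
    proof -
      have "inverse (norm (r *\<^sub>R y)) * r = inverse (norm y)"
        using that by simp
      then show ?thesis
        unfolding radial_def qmod_powr_quarter scaleR_scaleR by (rule arg_cong)
    qed
    then show ?thesis
      unfolding n using False nz by simp
  qed
  then show ?thesis
    using False nz rpow_mult[of "- of_nat n" x "4 * a"] by (simp add: radial_hecke[OF P F nz] qmod_powr mult_ac)
qed

text \<open>The constant of \<open>local_functional_equation\<close> at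
  \<open>\<kappa> = 4 * pi\<close>, divided by \<open>Gamma z\<close>. The density of
  \<open>dq\<close> enters the left side twice (pairing and transform) and the right side once,
  which leaves one factor 4.\<close>

definition gamma_factor :: "nat \<Rightarrow> complex \<Rightarrow> complex" where
  "gamma_factor n s = 4 * (\<i> * of_real (2 * pi)) ^ n * of_real (pi\<^sup>2)
     * Gamma (of_nat n / 2 + 2 * s) * of_real (4 * pi\<^sup>2) powr (- (of_nat n / 2 + 2 * s))
     * rGamma (of_nat n / 2 + 2 - 2 * s)"

text \<open>On the strip the argument of \<open>Gamma\<close> has positive real part and avoids the
  poles, while \<open>rGamma\<close> is entire.\<close>

lemma analytic_gamma_factor: "gamma_factor n analytic_on {s. 0 < Re s \<and> Re s < 1}"
proof -
  have "of_nat n / 2 + 2 * s \<notin> \<int>\<^sub>\<le>\<^sub>0" if "0 < Re s" for s :: complex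
  proof
    assume "of_nat n / 2 + 2 * s \<in> \<int>\<^sub>\<le>\<^sub>0"
    then obtain k :: int where "of_nat n / 2 + 2 * s = of_int k" "k \<le> 0"
      by (elim nonpos_Ints_cases)
    from this(1) have "Re (of_nat n / 2 + 2 * s) = Re (of_int k)"
      by (rule arg_cong)
    then have "real n / 2 + 2 * Re s = of_int k"
      by simp
    moreover have "real_of_int k \<le> 0"
      using \<open>k \<le> 0\<close> by simp
    moreover have "real n / 2 \<ge> 0"
      by simp
    ultimately show False
      using that by linarith
  qed
  moreover have "complex_of_real (4 * pi\<^sup>2) \<notin> \<real>\<^sub>\<le>\<^sub>0"
    by (simp add: complex_nonpos_Reals_iff)
  ultimately show ?thesis
    unfolding gamma_factor_def by (intro analytic_intros) auto
qed

theorem theorem3p18: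
  fixes N :: nat
  shows "\<exists>\<Gamma> :: complex \<Rightarrow> complex.
    \<Gamma> analytic_on {s. 0 < Re s \<and> Re s < 1} \<and>
    (\<forall>F \<in> coeff_space N. \<forall>s. 0 < Re s \<and> Re s < 1 \<longrightarrow>
      (let f = (\<lambda>x. radial F (qinv x) * complex_of_real (qmod x) powr (s - 1));
           h = (\<lambda>x. \<Gamma> s * radial F x * complex_of_real (qmod x) powr (- s))
       in defines_tempered f \<and> defines_tempered h \<and>
          (\<forall>\<phi>\<in>schwartz. fourier_distribution (distribution_of f) \<phi> = distribution_of h \<phi>)))"
proof (intro exI[of _ "gamma_factor N"] conjI ballI allI impI)
  show "gamma_factor N analytic_on {s. 0 < Re s \<and> Re s < 1}"
    by (rule analytic_gamma_factor)
next
  fix F s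
  assume F: "F \<in> coeff_space N" and "0 < Re s \<and> Re s < 1"
  then have s: "0 < Re s" "Re s < 1" by auto
  obtain P where P: "hecke N P" and FP: "\<And>g. g \<in> G0 \<Longrightarrow> F g = P g"
    using coeff_space_hecke[OF F] by blast
  define z where "z = of_nat N / 2 + 2 - 2 * s"
  define w where "w = of_nat N / 2 + 2 * s"
  let ?c = "gamma_factor N s"
  have f: "(\<lambda>x. radial F (qinv x) * complex_of_real (qmod x) powr (s - 1)) = (\<lambda>x. P (qconj x) * rpow (- 2 * z) (qconj x))"
  proof (rule ext)
    fix x
    have z: "4 * (s - 1) - of_nat N = - 2 * z"
      by (simp add: z_def algebra_simps)
    show "radial F (qinv x) * complex_of_real (qmod x) powr (s - 1) = P (qconj x) * rpow (- 2 * z) (qconj x)"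
      using radial_qinv_powr[OF P FP, of x "s - 1"] unfolding z rpow_qconj .
  qed
  have h: "(\<lambda>x. ?c * radial F x * complex_of_real (qmod x) powr (- s)) = (\<lambda>x. ?c * (P x * rpow (- 2 * w) x))"
  proof (rule ext)
    fix x
    have w: "4 * (- s) - of_nat N = - 2 * w"
      by (simp add: w_def algebra_simps)
    show "?c * radial F x * complex_of_real (qmod x) powr (- s) = ?c * (P x * rpow (- 2 * w) x)"
      using radial_powr[OF P FP, of x "- s"] unfolding w mult.assoc by (rule arg_cong)
  qed
  note [measurable] = hecke_measurable[OF P]
  have [measurable]: "qconj \<in> borel_measurable borel"
    by (intro borel_measurable_continuous_onI continuous_intros)
  obtain C where C: "C \<ge> 0" "\<And>x a. x \<noteq> 0 \<Longrightarrow> cmod (P x * rpow a x) \<le> C * norm x powr (real N + Re a)"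
    using hecke_rpow_bound[OF P] by blast
  have Re: "real N + Re (- 2 * z) = - (4 - 4 * Re s)" "real N + Re (- 2 * w) = - (4 * Re s)"
    by (simp_all add: z_def w_def)
  have tf: "defines_tempered (\<lambda>x. P (qconj x) * rpow (- 2 * z) (qconj x))"
  proof (rule defines_tempered_of_bound)
    fix x :: quat assume "x \<noteq> 0"
    then have "qconj x \<noteq> 0"
      by (metis norm_eq_zero norm_qconj)
    from C(2)[OF this, of "- 2 * z"]
    show "cmod (P (qconj x) * rpow (- 2 * z) (qconj x)) \<le> C * norm x powr - (4 - 4 * Re s)"
      unfolding Re by simp
  qed (use s in \<open>measurable, auto\<close>)
  have th: "defines_tempered (\<lambda>x. ?c * (P x * rpow (- 2 * w) x))"
  proof (rule defines_tempered_of_bound)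
    fix x :: quat assume "x \<noteq> 0"
    from mult_left_mono[OF C(2)[OF this, of "- 2 * w"], of "cmod ?c"]
    show "cmod (?c * (P x * rpow (- 2 * w) x)) \<le> cmod ?c * C * norm x powr - (4 * Re s)"
      unfolding Re by (simp add: norm_mult mult.assoc)
  qed (use s in \<open>measurable, auto\<close>)
  have eq: "fourier_distribution (distribution_of (\<lambda>x. P (qconj x) * rpow (- 2 * z) (qconj x))) \<phi>
      = distribution_of (\<lambda>x. ?c * (P x * rpow (- 2 * w) x)) \<phi>" if \<phi>: "\<phi> \<in> schwartz" for \<phi>
  proof -
    note [measurable] = schwartz_measurable[OF \<phi>]
    have [measurable]: "ft (4 * pi) \<phi> \<in> borel_measurable borel"
      by measurable
    have "fourier_distribution (distribution_of (\<lambda>x. P (qconj x) * rpow (- 2 * z) (qconj x))) \<phi>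
        = (LINT x|dq. 4 * (P (qconj x) * ft (4 * pi) \<phi> (qconj x) * rpow (- 2 * z) (qconj x)))"
      unfolding fourier_distribution_def distribution_of_def fourier_eq_ft[OF \<phi>] by (simp only: mult_ac)
    also have "\<dots> = 4 * (LINT x|lborel. 4 * (P (qconj x) * ft (4 * pi) \<phi> (qconj x) * rpow (- 2 * z) (qconj x)))"
      by (rule integral_dq) measurable
    also have "\<dots> = 16 * (LINT x|lborel. P (qconj x) * ft (4 * pi) \<phi> (qconj x) * rpow (- 2 * z) (qconj x))"
      by (simp only: integral_mult_right_zero) simp
    \<comment> \<open>Conjugation is orthogonal: one substitution removes the \<open>qconj\<close>
      that came from the inverse together with the one from the trace pairing.\<close>
    also have "(LINT x|lborel. P (qconj x) * ft (4 * pi) \<phi> (qconj x) * rpow (- 2 * z) (qconj x))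
        = (LINT x|lborel. P x * ft (4 * pi) \<phi> x * rpow (- 2 * z) x)"
      by (rule lborel_integral_orthogonal(1)[OF orthogonal_qconj, of "\<lambda>x. P x * ft (4 * pi) \<phi> x * rpow (- 2 * z) x"]) measurable
    finally have lhs: "fourier_distribution (distribution_of (\<lambda>x. P (qconj x) * rpow (- 2 * z) (qconj x))) \<phi>
        = 16 * (LINT x|lborel. P x * ft (4 * pi) \<phi> x * rpow (- 2 * z) x)" .
    have rhs: "distribution_of (\<lambda>x. ?c * (P x * rpow (- 2 * w) x)) \<phi>
        = 4 * ?c * (LINT x|lborel. P x * \<phi> x * rpow (- 2 * w) x)"
    proof -
      have "distribution_of (\<lambda>x. ?c * (P x * rpow (- 2 * w) x)) \<phi> = (LINT x|dq. ?c * (P x * \<phi> x * rpow (- 2 * w) x))"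
        unfolding distribution_of_def by (simp only: mult_ac)
      also have "\<dots> = 4 * (LINT x|lborel. ?c * (P x * \<phi> x * rpow (- 2 * w) x))"
        by (rule integral_dq) measurable
      also have "\<dots> = 4 * ?c * (LINT x|lborel. P x * \<phi> x * rpow (- 2 * w) x)"
        by (simp only: integral_mult_right_zero mult.assoc)
      finally show ?thesis .
    qed
    have "z \<notin> \<int>\<^sub>\<le>\<^sub>0"
    proof
      assume "z \<in> \<int>\<^sub>\<le>\<^sub>0"
      then obtain k :: int where "z = of_int k" "k \<le> 0"
        by (elim nonpos_Ints_cases)
      then have "Re z \<le> 0"
        by simp
      moreover have "Re z > 0"
        using s by (simp add: z_def add_nonneg_pos)
      ultimately show False
        by linarith
    qed
    then have G: "rGamma z * Gamma z = 1"
      by (simp add: rGamma_inverse_Gamma Gamma_nonzero)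
    let ?L = "LINT x|lborel. P x * ft (4 * pi) \<phi> x * rpow (- 2 * z) x"
    let ?I = "LINT x|lborel. P x * \<phi> x * rpow (- 2 * w) x"
    let ?A = "(\<i> * of_real (2 * pi)) ^ N * of_real (pi\<^sup>2) * Gamma w * of_real (4 * pi\<^sup>2) powr (- w)"
    have \<kappa>: "4 * pi \<noteq> 0" "4 * pi / 2 = 2 * pi" "(4 * pi)\<^sup>2 / 4 = 4 * pi\<^sup>2"
      by (simp_all add: power_mult_distrib)
    have fe: "Gamma z * ?L = ?A * ?I"
      using local_functional_equation[OF P \<phi> s \<kappa>(1), folded z_def w_def, unfolded \<kappa>] .
    have "?L = rGamma z * Gamma z * ?L"
      by (simp only: G mult_1_left)
    also have "\<dots> = rGamma z * (?A * ?I)"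
      by (simp only: mult.assoc[of "rGamma z" "Gamma z" ?L] fe)
    also have "\<dots> = ?A * rGamma z * ?I"
      by (simp only: mult_ac)
    finally have L: "?L = ?A * rGamma z * ?I" .
    have c: "?c = 4 * (?A * rGamma z)"
      unfolding gamma_factor_def z_def w_def by (simp only: mult.assoc)
    have "16 * (a * i) = 4 * (4 * a) * i" for a i :: complex
      by simp
    then show ?thesis
      unfolding lhs rhs unfolding L c .
  qed
  show "let f = (\<lambda>x. radial F (qinv x) * complex_of_real (qmod x) powr (s - 1));
           h = (\<lambda>x. ?c * radial F x * complex_of_real (qmod x) powr (- s))
       in defines_tempered f \<and> defines_tempered h \<and>
          (\<forall>\<phi>\<in>schwartz. fourier_distribution (distribution_of f) \<phi> = distribution_of h \<phi>)"
    unfolding Let_def f h by (intro conjI ballI tf th eq)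
qed

end
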